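(* For all $\alpha\in(0,1)$, $m,m'\in\mathbb{N}$ and $\varepsilon>0$ there is $\zeta>0$ such that the following holds. Suppose $\mathcal{U}_{\vec{k}}\subseteq[m]^n$ and $\mathcal{U}_{\vec{k}'}\subseteq[m']^n$ are $\alpha$-balanced multi-slices, and $\mu$ is a connected, $\alpha$-admissible distribution over $\mathcal{U}_{\vec{k}}\times\mathcal{U}_{\vec{k}'}$. Suppose $\mathcal{C}$ is an $(\alpha,\zeta)$-coupling between $(\mathcal{U}_{\vec{k}},\mathrm{Uniform})$ and $([m]^n,\nu_{\vec{k}}^{\otimes n})$, $\mathcal{C}'$ is an $(\alpha,\zeta)$-coupling between $(\mathcal{U}_{\vec{k}'},\mathrm{Uniform})$ and $([m']^n,\nu_{\vec{k}'}^{\otimes n})$, and that there is an $(\alpha,\zeta)$-coupling $\mathcal{C}''$ between $\mu$ and its product version $\tilde\mu$. Then for all $f\colon\mathcal{U}_{\vec{k}}\to\mathbb{R}$ and $g\colon\mathcal{U}_{\vec{k}'}\to\mathbb{R}$, \[ \Big|\mathbb{E}_{({\bf x},{\bf x}')\sim\mu}[f({\bf x})g({\bf x}')]-\mathbb{E}_{({\bf y},{\bf y}')\sim\tilde\mu}[\mathrm{T}_{\mathcal{C}}f({\bf y})\,\mathrm{T}_{\mathcal{C}'}g({\bf y}')]\Big|\le\varepsilon\|f\|_2\|g\|_2. \]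
   Context: For $\vec{k}=(k_1,\dots,k_m)$ nonnegative integers summing to $n$, $\mathcal{U}_{\vec{k}}\subseteq[m]^n$ is the set of vectors in which each symbol $j$ appears exactly $k_j$ times; it is $\alpha$-balanced if $k_j\ge\alpha n$ for all $j$; $\nu_{\vec{k}}(j)=k_j/n$. Norms are expectation norms w.r.t. the uniform measure on the multi-slice. For $\pi\in S_n$, $({}^{\pi}x)_i=x_{\pi(i)}$; a distribution on tuples of length-$n$ vectors is symmetric if applying the same $\pi$ to all components preserves it; pairs $(x,x')$ are identified with vectors in $([m]\times[m'])^n$. For symmetric distributions $\nu_1,\nu_2$ on $\Sigma^n$, an $(\alpha,\zeta)$-coupling is a jointly distributed $({\bf x},{\bf y})$ with marginals $\nu_1,\nu_2$, symmetric under $S_n$, with $\Pr[{\bf x}_i\ne{\bf y}_i]\le\zeta$ for all $i$, and $\Pr[|\{i:{\bf x}_i\ne{\bf y}_i\}|\ge\varepsilon n]\le\frac1\alpha e^{-\alpha\varepsilon^2n}$ for all $\varepsilon>0$. $\mathrm{T}_{\mathcal{C}}f(y)=\mathbb{E}_{({\bf x},{\bf y})\sim\mathcal{C}}[f({\bf x})\mid{\bf y}=y]$. For $\mu$ on pairs and $\vec a=(a_1,a_2)$, $\mu_{\vec a}=\Pr_{({\bf x},{\bf x}')\sim\mu,i\in_R[n]}[{\bf x}_i=a_1,{\bf x}'_i=a_2]$; $\mu$ is $\alpha$-admissible if symmetric under $S_n$ and each $\mu_{\vec a}$ is $0$ or $\ge\alpha$. $\mu$ is connected if for each of the two components, the bipartite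 graph between the support of that component's marginal and the support of the other component's marginal, with an edge whenever the pair lies in the support of $\mu$, is connected. The product version is $\tilde\mu=\prod_{i=1}^n\tilde\mu_i$ with $\tilde\mu_i(a_1,a_2)=\Pr_\mu[{\bf x}_i=a_1,{\bf x}'_i=a_2]$. *)

theory Defs
  imports "HOL-Probability.Probability" "HOL-Combinatorics.Permutations"
begin

text \<open>
  A vector in \<open>\<Sigma>\<^sup>n\<close> is a function in \<open>{1..n} \<rightarrow>\<^sub>E \<Sigma>\<close>, i.e. it takes the value \<^const>\<open>undefined\<close>
  outside \<open>{1..n}\<close>. For \<open>\<pi>\<close> permuting \<open>{1..n}\<close>, the permuted vector is \<open>x \<circ> \<pi>\<close>.
  The alphabet \<open>[m]\<close> is \<open>{1..m}\<close>, and only the values of \<open>k\<close> on \<open>{1..m}\<close> matter.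
\<close>

definition multislice :: "nat \<Rightarrow> nat \<Rightarrow> (nat \<Rightarrow> nat) \<Rightarrow> (nat \<Rightarrow> nat) set" where
  "multislice n m k =
     {x \<in> {1..n} \<rightarrow>\<^sub>E {1..m}. \<forall>j\<in>{1..m}. card {i \<in> {1..n}. x i = j} = k j}"

definition balanced :: "real \<Rightarrow> nat \<Rightarrow> nat \<Rightarrow> (nat \<Rightarrow> nat) \<Rightarrow> bool" where
  "balanced \<alpha> n m k \<longleftrightarrow> (\<forall>j\<in>{1..m}. real (k j) \<ge> \<alpha> * real n)"

definition freq_pmf :: "nat \<Rightarrow> nat \<Rightarrow> (nat \<Rightarrow> nat) \<Rightarrow> nat pmf" where
  "freq_pmf n m k = embed_pmf (\<lambda>j. if j \<in> {1..m} then real (k j) / real n else 0)"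

lemma pmf_freq_pmf:
  assumes "n \<ge> 1" and "(\<Sum>j=1..m. k j) = n"
  shows "pmf (freq_pmf n m k) j = (if j \<in> {1..m} then real (k j) / real n else 0)"
  unfolding freq_pmf_def
proof (rule pmf_embed_pmf)
  let ?p = "\<lambda>j. if j \<in> {1..m} then real (k j) / real n else 0"
  have "(\<integral>\<^sup>+ j. ennreal (?p j) \<partial>count_space UNIV) = (\<Sum>j\<in>{1..m}. ennreal (?p j))"
    by (rule nn_integral_count_space') auto
  also have "\<dots> = ennreal (\<Sum>j\<in>{1..m}. ?p j)"
    by (rule sum_ennreal) simp
  also have "(\<Sum>j\<in>{1..m}. ?p j) = real (\<Sum>j=1..m. k j) / real n"
    by (simp add: sum_divide_distrib)
  also have "\<dots> = 1"
    using assms by simp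
  finally show "(\<integral>\<^sup>+ j. ennreal (?p j) \<partial>count_space UNIV) = 1"
    by simp
qed simp

definition norm2 :: "'a set \<Rightarrow> ('a \<Rightarrow> real) \<Rightarrow> real" where
  "norm2 U f = sqrt (measure_pmf.expectation (pmf_of_set U) (\<lambda>x. \<bar>f x\<bar> ^ 2))"

definition symmetric :: "nat \<Rightarrow> ((nat \<Rightarrow> 'a) \<times> (nat \<Rightarrow> 'b)) pmf \<Rightarrow> bool" where
  "symmetric n \<mu> \<longleftrightarrow> (\<forall>\<pi>. \<pi> permutes {1..n} \<longrightarrow> map_pmf (\<lambda>(x, x'). (x \<circ> \<pi>, x' \<circ> \<pi>)) \<mu> = \<mu>)"

text \<open>Symmetry of \<open>\<nu>\<^sub>1\<close> and \<open>\<nu>\<^sub>2\<close> is implied by the symmetry of the joint distribution.\<close>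

definition is_coupling ::
  "nat \<Rightarrow> real \<Rightarrow> real \<Rightarrow> (nat \<Rightarrow> 'a) pmf \<Rightarrow> (nat \<Rightarrow> 'a) pmf \<Rightarrow> ((nat \<Rightarrow> 'a) \<times> (nat \<Rightarrow> 'a)) pmf \<Rightarrow> bool"
where
  "is_coupling n \<alpha> \<zeta> \<nu>\<^sub>1 \<nu>\<^sub>2 C \<longleftrightarrow>
     map_pmf fst C = \<nu>\<^sub>1 \<and> map_pmf snd C = \<nu>\<^sub>2 \<and>
     symmetric n C \<and>
     (\<forall>i\<in>{1..n}. measure_pmf.prob C {(x, y). x i \<noteq> y i} \<le> \<zeta>) \<and>
     (\<forall>\<epsilon>>0. measure_pmf.prob C {(x, y). real (card {i \<in> {1..n}. x i \<noteq> y i}) \<ge> \<epsilon> * real n}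
               \<le> 1 / \<alpha> * exp (- \<alpha> * \<epsilon>\<^sup>2 * real n))"

text \<open>
  The operator \<open>T\<^sub>C\<close>. Its value at \<open>y\<close> is meaningful only if \<open>y\<close> has positive probability under
  the second marginal of \<open>C\<close>.
\<close>

definition coupling_op ::
  "((nat \<Rightarrow> 'a) \<times> (nat \<Rightarrow> 'a)) pmf \<Rightarrow> ((nat \<Rightarrow> 'a) \<Rightarrow> real) \<Rightarrow> (nat \<Rightarrow> 'a) \<Rightarrow> real" where
  "coupling_op C f y = measure_pmf.expectation (cond_pmf C {p. snd p = y}) (\<lambda>p. f (fst p))"

definition pair_freq :: "nat \<Rightarrow> ((nat \<Rightarrow> 'a) \<times> (nat \<Rightarrow> 'b)) pmf \<Rightarrow> 'a \<times> 'b \<Rightarrow> real" where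
  "pair_freq n \<mu> a =
     measure_pmf.prob (pair_pmf \<mu> (pmf_of_set {1..n})) {((x, x'), i). x i = fst a \<and> x' i = snd a}"

definition admissible :: "real \<Rightarrow> nat \<Rightarrow> ((nat \<Rightarrow> 'a) \<times> (nat \<Rightarrow> 'b)) pmf \<Rightarrow> bool" where
  "admissible \<alpha> n \<mu> \<longleftrightarrow>
     symmetric n \<mu> \<and> (\<forall>a. pair_freq n \<mu> a = 0 \<or> pair_freq n \<mu> a \<ge> \<alpha>)"

definition bipartite_edges :: "('a \<times> 'b) set \<Rightarrow> (('a + 'b) \<times> ('a + 'b)) set" where
  "bipartite_edges E = (\<Union>(x, y)\<in>E. {(Inl x, Inr y), (Inr y, Inl x)})"

definition bipartite_connected :: "'a set \<Rightarrow> 'b set \<Rightarrow> ('a \<times> 'b) set \<Rightarrow> bool" where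
  "bipartite_connected A B E \<longleftrightarrow>
     (\<forall>u \<in> A <+> B. \<forall>v \<in> A <+> B. (u, v) \<in> (bipartite_edges E)\<^sup>*)"

text \<open>
  One conjunct for each of the two components; the vertices are whole vectors, not letters.
\<close>

definition connected_pmf :: "((nat \<Rightarrow> 'a) \<times> (nat \<Rightarrow> 'b)) pmf \<Rightarrow> bool" where
  "connected_pmf \<mu> \<longleftrightarrow>
     bipartite_connected (set_pmf (map_pmf fst \<mu>)) (set_pmf (map_pmf snd \<mu>)) (set_pmf \<mu>) \<and>
     bipartite_connected (set_pmf (map_pmf snd \<mu>)) (set_pmf (map_pmf fst \<mu>)) ((set_pmf \<mu>)\<inverse>)"

text \<open>
  The identification of \<open>\<Sigma>\<^sup>n \<times> \<Sigma>'\<^sup>n\<close> with \<open>(\<Sigma> \<times> \<Sigma>')\<^sup>n\<close>.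
\<close>

definition zip_vec :: "nat \<Rightarrow> (nat \<Rightarrow> 'a) \<times> (nat \<Rightarrow> 'b) \<Rightarrow> (nat \<Rightarrow> 'a \<times> 'b)" where
  "zip_vec n = (\<lambda>(x, x'). \<lambda>i\<in>{1..n}. (x i, x' i))"

definition fst_vec :: "nat \<Rightarrow> (nat \<Rightarrow> 'a \<times> 'b) \<Rightarrow> (nat \<Rightarrow> 'a)" where
  "fst_vec n z = (\<lambda>i\<in>{1..n}. fst (z i))"

definition snd_vec :: "nat \<Rightarrow> (nat \<Rightarrow> 'a \<times> 'b) \<Rightarrow> (nat \<Rightarrow> 'b)" where
  "snd_vec n z = (\<lambda>i\<in>{1..n}. snd (z i))"

definition product_version ::
  "nat \<Rightarrow> ((nat \<Rightarrow> 'a) \<times> (nat \<Rightarrow> 'b)) pmf \<Rightarrow> (nat \<Rightarrow> 'a \<times> 'b) pmf" where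
  "product_version n \<mu> =
     Pi_pmf {1..n} undefined (\<lambda>i. map_pmf (\<lambda>(x, x'). (x i, x' i)) \<mu>)"

end

theory Submission
  imports Defs "HOL-Library.Function_Algebras"
begin

text \<open>
  Let \<open>\<mu>'\<close> be the law of \<open>(x, x')\<close> obtained by drawing \<open>(y, y')\<close> from the product version of \<open>\<mu>\<close> and then \<open>x\<close>, \<open>x'\<close>
  from the conditional laws of the couplings. The claim is that the forms \<open>E f(x) g(x')\<close> under \<open>\<mu>\<close> and \<open>\<mu>'\<close>, both
  symmetric laws on the product of the two multislices with uniform marginals, differ by at most \<open>\<epsilon> \<parallel>f\<parallel> \<parallel>g\<parallel>\<close>.

  The difference \<open>D\<close> of the two operators commutes with the symmetric group, so \<open>D\<^sup>* D\<close> preserves the functions of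
  \<open>x\<^sub>J\<close> that are orthogonal to all functions of fewer than \<open>|J|\<close> coordinates (the pure \<open>J\<close>-juntas). These span,
  and iterating a self-adjoint operator on a finite sum shows that a norm bound on each of them is a norm bound
  everywhere. If \<open>|J|\<close> is bounded, the bound is a comparison of the marginals on \<open>J\<close>, which are
  close because every coordinate agrees with the product measure up to probability \<open>O(\<zeta>)\<close>.

  If \<open>|J|\<close> is large, each of the two operators separately has small norm on pure \<open>J\<close>-juntas. Composing the law with
  its reverse a bounded number of times makes every pair of letters occur with positive frequency, since the letter
  graph is connected, and a second moment estimate shows that the coordinates where \<open>x\<close> has a fixed letter contain
  linearly many copies of each letter of the other vector \<open>w\<close>. A uniformly random linear-size set \<open>S\<close> of coordinates
  can then be placed inside them, independently of \<open>w\<close>, and \<open>w\<close> may be shuffled inside \<open>S\<close>. As \<open>S\<close> meets \<open>J\<close> with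
  probability close to one, and shuffling one coordinate of \<open>J\<close> with many outside \<open>J\<close> nearly annihilates a pure
  junta, the operator is small.
\<close>

section \<open>Inner products and self-adjoint operators on finite sets\<close>

definition inner_on :: "'a set \<Rightarrow> ('a \<Rightarrow> real) \<Rightarrow> ('a \<Rightarrow> real) \<Rightarrow> real" where
  "inner_on U f g = (\<Sum>x\<in>U. f x * g x)"

abbreviation sqnorm_on :: "'a set \<Rightarrow> ('a \<Rightarrow> real) \<Rightarrow> real" where
  "sqnorm_on U f \<equiv> inner_on U f f"

definition fscale :: "real \<Rightarrow> ('a \<Rightarrow> real) \<Rightarrow> 'a \<Rightarrow> real" where
  "fscale c f = (\<lambda>x. c * f x)"

lemma fscale_apply [simp]: "fscale c f x = c * f x"
  by (simp add: fscale_def)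

interpretation fun_space: vector_space fscale
  by standard (auto simp: fun_eq_iff algebra_simps)

lemma inner_on_commute: "inner_on U f g = inner_on U g f"
  by (simp add: inner_on_def mult.commute)

lemma sqnorm_on_nonneg: "0 \<le> sqnorm_on U f"
  by (simp add: inner_on_def sum_nonneg)

lemma inner_on_add_left: "inner_on U (f + g) h = inner_on U f h + inner_on U g h"
  by (simp add: inner_on_def algebra_simps sum.distrib)

lemma inner_on_diff_left: "inner_on U (f - g) h = inner_on U f h - inner_on U g h"
  by (simp add: inner_on_def algebra_simps sum_subtractf)

lemma inner_on_scale_left: "inner_on U (fscale c f) h = c * inner_on U f h"
  by (simp add: inner_on_def algebra_simps sum_distrib_left)

lemma inner_on_sum_left: "inner_on U (\<lambda>x. \<Sum>i\<in>I. f i x) h = (\<Sum>i\<in>I. inner_on U (f i) h)"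
  unfolding inner_on_def sum_distrib_right by (rule sum.swap)

lemma inner_on_add_right: "inner_on U h (f + g) = inner_on U h f + inner_on U h g"
  by (simp add: inner_on_commute[of U h] inner_on_add_left)

lemma inner_on_scale_right: "inner_on U h (fscale c f) = c * inner_on U h f"
  by (simp add: inner_on_commute[of U h] inner_on_scale_left)

lemma inner_on_sum_right: "inner_on U h (\<lambda>x. \<Sum>i\<in>I. f i x) = (\<Sum>i\<in>I. inner_on U h (f i))"
  by (simp add: inner_on_commute[of U h] inner_on_sum_left)

lemma inner_on_cong:
  "(\<And>x. x \<in> U \<Longrightarrow> f x = f' x) \<Longrightarrow> (\<And>x. x \<in> U \<Longrightarrow> g x = g' x) \<Longrightarrow> inner_on U f g = inner_on U f' g'"
  by (auto simp: inner_on_def intro!: sum.cong)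

lemma inner_on_Cauchy_Schwarz: "(inner_on U f g)\<^sup>2 \<le> sqnorm_on U f * sqnorm_on U g"
  using Cauchy_Schwarz_ineq_sum[of f g U] by (simp add: inner_on_def power2_eq_square)

lemma inner_on_eq_0_of_sqnorm_eq_0: "sqnorm_on U g = 0 \<Longrightarrow> inner_on U f g = 0"
  using inner_on_Cauchy_Schwarz[of U f g] by simp

lemma sqnorm_on_add_le: "sqnorm_on U (f + g) \<le> 2 * sqnorm_on U f + 2 * sqnorm_on U g"
proof -
  have "sqnorm_on U (f + g) + sqnorm_on U (f - g) = 2 * sqnorm_on U f + 2 * sqnorm_on U g"
    by (simp add: inner_on_def sum_distrib_left sum.distrib[symmetric] algebra_simps)
  then show ?thesis
    using sqnorm_on_nonneg[of U "f - g"] by linarith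
qed

lemma orthogonal_to_span:
  assumes "v \<in> fun_space.span B" and "\<And>b. b \<in> B \<Longrightarrow> inner_on U r b = 0"
  shows "inner_on U r v = 0"
  using assms(1)
proof (induction rule: fun_space.span_induct_alt)
  case base
  show ?case by (simp add: inner_on_def)
next
  case (step c b v)
  then show ?case
    using assms(2) by (simp only: inner_on_add_right inner_on_scale_right)
qed

lemma ex_span_orthogonal_residual:
  assumes "finite B"
  shows "\<exists>v\<in>fun_space.span B. \<forall>b\<in>B. inner_on U (f - v) b = 0"
  using assms
proof (induction B arbitrary: f rule: finite_induct)
  case (insert b B)
  obtain v where v: "v \<in> fun_space.span B" "\<And>b'. b' \<in> B \<Longrightarrow> inner_on U (f - v) b' = 0"
    using insert.IH by blast
  obtain u where u: "u \<in> fun_space.span B" "\<And>b'. b' \<in> B \<Longrightarrow> inner_on U (b - u) b' = 0"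
    using insert.IH by blast
  define w s where "w = b - u" and "s = f - v"
  define c where "c = inner_on U s w / sqnorm_on U w"
  have residual: "inner_on U (f - (v + fscale c w)) g = inner_on U s g - c * inner_on U w g" for g
    by (simp add: s_def inner_on_diff_left inner_on_add_left inner_on_scale_left)
  have old: "inner_on U (f - (v + fscale c w)) b' = 0" if "b' \<in> B" for b'
    using v(2) u(2) that unfolding residual unfolding s_def w_def by simp
  have "inner_on U (f - (v + fscale c w)) w = 0"
    using inner_on_eq_0_of_sqnorm_eq_0[of U w s] unfolding residual by (simp add: c_def)
  moreover have "inner_on U (f - (v + fscale c w)) u = 0"
    by (rule orthogonal_to_span[OF u(1) old])
  moreover have "b = w + u"
    by (simp add: w_def)
  ultimately have new: "inner_on U (f - (v + fscale c w)) b = 0"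
    by (simp add: inner_on_add_right)
  have "fun_space.span B \<subseteq> fun_space.span (insert b B)"
    by (intro fun_space.span_mono) auto
  then have "v + fscale c w \<in> fun_space.span (insert b B)"
    using u(1) v(1) unfolding w_def
    by (intro fun_space.span_add fun_space.span_scale fun_space.span_diff) (auto intro: fun_space.span_base)
  then show ?case using old new by blast
qed simp

definition selfadjoint_on :: "'a set \<Rightarrow> (('a \<Rightarrow> real) \<Rightarrow> 'a \<Rightarrow> real) \<Rightarrow> bool" where
  "selfadjoint_on U Q \<longleftrightarrow> (\<forall>f g. inner_on U f (Q g) = inner_on U (Q f) g)"

definition rayleigh :: "'a set \<Rightarrow> (('a \<Rightarrow> real) \<Rightarrow> 'a \<Rightarrow> real) \<Rightarrow> ('a \<Rightarrow> real) \<Rightarrow> real" where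
  "rayleigh U Q f = inner_on U f (Q f) / sqnorm_on U f"

lemma selfadjoint_on_funpow: "selfadjoint_on U Q \<Longrightarrow> selfadjoint_on U (Q ^^ r)"
proof (induction r)
  case (Suc r)
  then show ?case
    unfolding selfadjoint_on_def by (metis comp_apply funpow.simps(2) funpow_Suc_right)
qed (simp add: selfadjoint_on_def)

lemma rayleigh_square_le:
  assumes "selfadjoint_on U Q"
  shows "(rayleigh U Q f)\<^sup>2 \<le> rayleigh U (Q ^^ 2) f"
proof -
  have "(inner_on U f (Q f))\<^sup>2 \<le> sqnorm_on U f * inner_on U f (Q (Q f))"
    using inner_on_Cauchy_Schwarz[of U f "Q f"] assms by (simp add: selfadjoint_on_def)
  then have "(inner_on U f (Q f))\<^sup>2 / (sqnorm_on U f)\<^sup>2 \<le> sqnorm_on U f * inner_on U f (Q (Q f)) / (sqnorm_on U f)\<^sup>2"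
    by (rule divide_right_mono) simp
  also have "\<dots> = rayleigh U (Q ^^ 2) f"
    by (simp add: rayleigh_def numeral_2_eq_2)
  finally show ?thesis
    by (simp add: rayleigh_def power_divide)
qed

lemma rayleigh_power_le:
  assumes "selfadjoint_on U Q" "0 \<le> rayleigh U Q f"
  shows "rayleigh U Q f ^ 2 ^ r \<le> rayleigh U (Q ^^ (2 ^ r)) f"
proof (induction r)
  case (Suc r)
  have "rayleigh U Q f ^ 2 ^ Suc r = (rayleigh U Q f ^ 2 ^ r)\<^sup>2"
    by (simp add: power_mult[symmetric] mult.commute)
  also have "\<dots> \<le> (rayleigh U (Q ^^ (2 ^ r)) f)\<^sup>2"
    using Suc assms(2) by (intro power_mono) auto
  also have "\<dots> \<le> rayleigh U ((Q ^^ (2 ^ r)) ^^ 2) f"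
    by (rule rayleigh_square_le[OF selfadjoint_on_funpow[OF assms(1)]])
  also have "(Q ^^ (2 ^ r)) ^^ 2 = Q ^^ (2 ^ Suc r)"
    by (simp add: funpow_mult mult.commute)
  finally show ?case .
qed simp

lemma form_le_iff_rayleigh_le:
  assumes "0 \<le> l"
  shows "inner_on U f (Q f) \<le> l * sqnorm_on U f \<longleftrightarrow> rayleigh U Q f \<le> l"
proof (cases "sqnorm_on U f = 0")
  case True
  then have "inner_on U f (Q f) = 0"
    using inner_on_eq_0_of_sqnorm_eq_0[of U f "Q f"] by (simp add: inner_on_commute)
  then show ?thesis using True assms by (simp add: rayleigh_def)
next
  case False
  then have "0 < sqnorm_on U f" using sqnorm_on_nonneg[of U f] by simp
  then show ?thesis by (simp add: rayleigh_def pos_divide_le_eq)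
qed

lemma form_le_of_power_form_le:
  assumes "selfadjoint_on U Q" and nonneg: "0 \<le> inner_on U f (Q f)" and "0 \<le> l"
    and power: "inner_on U f ((Q ^^ (2 ^ r)) f) \<le> l ^ 2 ^ r * sqnorm_on U f"
  shows "inner_on U f (Q f) \<le> l * sqnorm_on U f"
proof -
  have rayleigh_nonneg: "0 \<le> rayleigh U Q f"
    using nonneg sqnorm_on_nonneg[of U f] by (simp add: rayleigh_def)
  have "rayleigh U Q f ^ 2 ^ r \<le> rayleigh U (Q ^^ (2 ^ r)) f"
    by (rule rayleigh_power_le[OF assms(1) rayleigh_nonneg])
  also have "\<dots> \<le> l ^ 2 ^ r"
    using power \<open>0 \<le> l\<close> by (simp add: form_le_iff_rayleigh_le[symmetric])
  finally show ?thesis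
    using \<open>0 \<le> l\<close> rayleigh_nonneg by (simp add: form_le_iff_rayleigh_le power_mono_iff)
qed

lemma form_le_of_power_growth:
  assumes "selfadjoint_on U Q" and "0 < l"
    and growth: "\<And>r. sqnorm_on U ((Q ^^ r) f) \<le> c * (l ^ r)\<^sup>2"
  shows "inner_on U f (Q f) \<le> l * sqnorm_on U f"
proof -
  define b where "b = rayleigh U Q f"
  have bounded: "(b / l) ^ 2 ^ Suc r \<le> c / sqnorm_on U f" if "0 \<le> b" for r
  proof -
    have "b ^ 2 ^ Suc r \<le> rayleigh U (Q ^^ (2 ^ Suc r)) f"
      using rayleigh_power_le[OF assms(1)] that by (simp only: b_def)
    also have "inner_on U f ((Q ^^ (2 ^ Suc r)) f) = sqnorm_on U ((Q ^^ (2 ^ r)) f)"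
      using selfadjoint_on_funpow[OF assms(1), of "2 ^ r"]
      by (simp add: selfadjoint_on_def mult_2 funpow_add)
    then have "rayleigh U (Q ^^ (2 ^ Suc r)) f \<le> c * (l ^ 2 ^ r)\<^sup>2 / sqnorm_on U f"
      unfolding rayleigh_def using growth[of "2 ^ r"] sqnorm_on_nonneg by (auto intro: divide_right_mono)
    also have "(l ^ 2 ^ r)\<^sup>2 = l ^ 2 ^ Suc r"
      by (simp add: power_mult[symmetric] mult.commute)
    finally have "b ^ 2 ^ Suc r / l ^ 2 ^ Suc r \<le> c * l ^ 2 ^ Suc r / sqnorm_on U f / l ^ 2 ^ Suc r"
      using \<open>0 < l\<close> by (intro divide_right_mono) auto
    then show ?thesis using \<open>0 < l\<close> by (simp add: power_divide)
  qed
  have "b \<le> l"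
  proof (rule ccontr)
    assume "\<not> b \<le> l"
    then have b: "0 \<le> b" "1 < b / l" using \<open>0 < l\<close> by auto
    obtain r where "c / sqnorm_on U f < (b / l) ^ r"
      using real_arch_pow[OF b(2)] by blast
    also have "\<dots> \<le> (b / l) ^ 2 ^ Suc r"
      using b(2) less_exp[of "Suc r"] by (intro power_increasing) linarith+
    also have "\<dots> \<le> c / sqnorm_on U f" by (rule bounded[OF b(1)])
    finally show False by simp
  qed
  then show ?thesis
    using \<open>0 < l\<close> by (simp add: b_def form_le_iff_rayleigh_le)
qed

section \<open>Juntas\<close>

definition agree_on :: "'i set \<Rightarrow> ('i \<Rightarrow> 'a) \<Rightarrow> ('i \<Rightarrow> 'a) \<Rightarrow> bool" where
  "agree_on J x y \<longleftrightarrow> (\<forall>i\<in>J. x i = y i)"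

text \<open>On an orbit, invariance under the permutations fixing \<open>J\<close> pointwise means depending on the
  coordinates in \<open>J\<close> only. The group-theoretic form is visibly preserved by equivariant operators.\<close>

definition junta :: "nat \<Rightarrow> (nat \<Rightarrow> 'a) set \<Rightarrow> nat set \<Rightarrow> ((nat \<Rightarrow> 'a) \<Rightarrow> real) \<Rightarrow> bool" where
  "junta n U J h \<longleftrightarrow> (\<forall>\<pi>. \<pi> permutes {1..n} - J \<longrightarrow> (\<forall>x\<in>U. h (x \<circ> \<pi>) = h x))"

definition orthogonal_to_juntas :: "nat \<Rightarrow> (nat \<Rightarrow> 'a) set \<Rightarrow> nat \<Rightarrow> ((nat \<Rightarrow> 'a) \<Rightarrow> real) \<Rightarrow> bool" where
  "orthogonal_to_juntas n U e h \<longleftrightarrow>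
     (\<forall>J v. J \<subseteq> {1..n} \<longrightarrow> card J < e \<longrightarrow> junta n U J v \<longrightarrow> inner_on U h v = 0)"

definition pure_junta :: "nat \<Rightarrow> (nat \<Rightarrow> 'a) set \<Rightarrow> nat set \<Rightarrow> ((nat \<Rightarrow> 'a) \<Rightarrow> real) \<Rightarrow> bool" where
  "pure_junta n U J h \<longleftrightarrow> J \<subseteq> {1..n} \<and> junta n U J h \<and> orthogonal_to_juntas n U (card J) h"

lemma pure_juntaD:
  assumes "pure_junta n U J h"
  shows "J \<subseteq> {1..n}" "junta n U J h" "orthogonal_to_juntas n U (card J) h" "finite J"
  using assms finite_subset[of J "{1..n}"] by (auto simp: pure_junta_def)

definition pattern_ind :: "'i set \<Rightarrow> ('i \<Rightarrow> 'a) \<Rightarrow> ('i \<Rightarrow> 'a) \<Rightarrow> real" where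
  "pattern_ind J a x = of_bool (agree_on J x a)"

definition perm_avg :: "nat set \<Rightarrow> ((nat \<Rightarrow> 'a) \<Rightarrow> real) \<Rightarrow> (nat \<Rightarrow> 'a) \<Rightarrow> real" where
  "perm_avg A f x = (\<Sum>\<pi> | \<pi> permutes A. f (x \<circ> \<pi>)) / fact (card A)"

lemma perm_avg_comp:
  assumes "\<rho> permutes A"
  shows "perm_avg A f (x \<circ> \<rho>) = perm_avg A f x"
  using setum_permutations_compose_left[OF assms, of "\<lambda>\<pi>. f (x \<circ> \<pi>)"]
  by (simp add: perm_avg_def comp_assoc)

lemma perm_avg_of_comp:
  assumes "\<rho> permutes A"
  shows "perm_avg A (\<lambda>x. f (x \<circ> \<rho>)) = perm_avg A f"
  using sum_permutations_compose_right[OF assms, of "\<lambda>\<pi>. f (_ \<circ> \<pi>)"]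
  by (simp add: perm_avg_def comp_assoc fun_eq_iff)

lemma perm_avg_add: "perm_avg A (f + g) = perm_avg A f + perm_avg A g"
  by (simp add: perm_avg_def fun_eq_iff sum.distrib add_divide_distrib)

lemma perm_avg_scale: "perm_avg A (fscale c f) = fscale c (perm_avg A f)"
  by (simp add: perm_avg_def fun_eq_iff sum_distrib_left[symmetric])

lemma perm_avg_sum: "perm_avg A (\<lambda>x. \<Sum>i\<in>I. f i x) = (\<lambda>x. \<Sum>i\<in>I. perm_avg A (f i) x)"
  unfolding perm_avg_def by (subst sum.swap) (simp add: sum_divide_distrib)

lemma perm_avg_eq_self:
  assumes "finite A" "\<And>\<pi>. \<pi> permutes A \<Longrightarrow> f (x \<circ> \<pi>) = f x"
  shows "perm_avg A f x = f x"
  using assms by (simp add: perm_avg_def card_permutations)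

lemma perm_avg_square_le:
  assumes "finite A"
  shows "(perm_avg A f x)\<^sup>2 \<le> perm_avg A (\<lambda>x. (f x)\<^sup>2) x"
proof -
  have "(\<Sum>\<pi> | \<pi> permutes A. f (x \<circ> \<pi>))\<^sup>2 \<le> fact (card A) * (\<Sum>\<pi> | \<pi> permutes A. (f (x \<circ> \<pi>))\<^sup>2)"
    using Cauchy_Schwarz_ineq_sum[of "\<lambda>_. 1" "\<lambda>\<pi>. f (x \<circ> \<pi>)" "{\<pi>. \<pi> permutes A}"] assms
    by (simp add: card_permutations)
  then show ?thesis by (simp add: perm_avg_def power2_eq_square divide_simps mult.commute)
qed

locale perm_orbit =
  fixes n :: nat and \<Sigma> :: "'a set" and U :: "(nat \<Rightarrow> 'a) set"
  assumes finite_alphabet: "finite \<Sigma>" and finite_orbit: "finite U" and nonempty: "U \<noteq> {}"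
    and letters: "x \<in> U \<Longrightarrow> i \<in> {1..n} \<Longrightarrow> x i \<in> \<Sigma>"
    and comp_closed: "x \<in> U \<Longrightarrow> \<pi> permutes {1..n} \<Longrightarrow> x \<circ> \<pi> \<in> U"
    and transitive: "x \<in> U \<Longrightarrow> y \<in> U \<Longrightarrow> J \<subseteq> {1..n} \<Longrightarrow> agree_on J x y \<Longrightarrow>
      \<exists>\<pi>. \<pi> permutes {1..n} - J \<and> y = x \<circ> \<pi>"
begin

lemma card_pos: "0 < card U"
  using finite_orbit nonempty by (simp add: card_gt_0_iff)

lemma sum_permute:
  assumes "\<pi> permutes {1..n}"
  shows "(\<Sum>x\<in>U. F (x \<circ> \<pi>)) = (\<Sum>x\<in>U. F x)"
proof (rule sum.reindex_bij_witness[of _ "\<lambda>x. x \<circ> inv \<pi>" "\<lambda>x. x \<circ> \<pi>"])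
  fix x assume "x \<in> U"
  then show "x \<circ> \<pi> \<in> U" "x \<circ> inv \<pi> \<in> U" using comp_closed assms permutes_inv by blast+
  show "x \<circ> \<pi> \<circ> inv \<pi> = x" "x \<circ> inv \<pi> \<circ> \<pi> = x"
    using permutes_inv_o[OF assms] by (simp_all add: comp_assoc)
qed simp

lemma invariant_mult_card:
  fixes r :: "(nat \<Rightarrow> 'a) \<Rightarrow> real"
  assumes "\<And>\<pi> x. \<pi> permutes {1..n} \<Longrightarrow> x \<in> U \<Longrightarrow> r (x \<circ> \<pi>) = r x" and "x \<in> U"
  shows "r x * card U = (\<Sum>y\<in>U. r y)"
proof -
  have "r y = r x" if "y \<in> U" for y
    using transitive[OF \<open>x \<in> U\<close> that, of "{}"] assms by (auto simp: agree_on_def)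
  then show ?thesis by (simp add: mult.commute)
qed

lemma inner_on_permute:
  assumes "\<pi> permutes {1..n}"
  shows "inner_on U (\<lambda>x. f (x \<circ> \<pi>)) (\<lambda>x. g (x \<circ> \<pi>)) = inner_on U f g"
  unfolding inner_on_def using sum_permute[OF assms, of "\<lambda>x. f x * g x"] .

lemma inner_on_permute_left:
  assumes "\<pi> permutes {1..n}"
  shows "inner_on U (\<lambda>x. f (x \<circ> \<pi>)) g = inner_on U f (\<lambda>x. g (x \<circ> inv \<pi>))"
proof -
  have "x \<circ> \<pi> \<circ> inv \<pi> = x" for x :: "nat \<Rightarrow> 'a"
    using permutes_inv_o[OF assms] by (simp add: comp_assoc)
  then show ?thesis using inner_on_permute[OF assms, of f "\<lambda>x. g (x \<circ> inv \<pi>)"] by simp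
qed

lemma junta_eq:
  assumes "junta n U J h" "J \<subseteq> {1..n}" "x \<in> U" "y \<in> U" "agree_on J x y"
  shows "h x = h y"
  using transitive[OF assms(3,4,2,5)] assms(1,3) unfolding junta_def by metis

lemma juntaI:
  assumes "J \<subseteq> {1..n}" and "\<And>x y. x \<in> U \<Longrightarrow> y \<in> U \<Longrightarrow> agree_on J x y \<Longrightarrow> h x = h y"
  shows "junta n U J h"
  unfolding junta_def
proof (intro allI impI ballI)
  fix \<pi> x assume \<pi>: "\<pi> permutes {1..n} - J" and x: "x \<in> U"
  have "\<pi> permutes {1..n}" using \<pi> by (rule permutes_subset) auto
  then have "x \<circ> \<pi> \<in> U" using x comp_closed by blast
  moreover have "agree_on J (x \<circ> \<pi>) x"
    using \<pi> by (simp add: agree_on_def permutes_not_in)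
  ultimately show "h (x \<circ> \<pi>) = h x" using assms x by blast
qed

lemma junta_scale: "junta n U J f \<Longrightarrow> junta n U J (fscale c f)"
  by (simp add: junta_def)

lemma junta_permute:
  assumes "junta n U J h" "\<rho> permutes {1..n}" "J \<subseteq> {1..n}"
  shows "junta n U (\<rho> ` J) (\<lambda>x. h (x \<circ> \<rho>))"
proof (rule juntaI)
  show "\<rho> ` J \<subseteq> {1..n}" using assms(2,3) permutes_image by blast
  fix x y assume "x \<in> U" "y \<in> U" "agree_on (\<rho> ` J) x y"
  then show "h (x \<circ> \<rho>) = h (y \<circ> \<rho>)"
    using assms comp_closed by (intro junta_eq[OF assms(1,3)]) (auto simp: agree_on_def)
qed

lemma junta_pattern_ind: "J \<subseteq> {1..n} \<Longrightarrow> junta n U J (pattern_ind J a)"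
  by (rule juntaI) (auto simp: pattern_ind_def agree_on_def)

lemma junta_perm_avg: "junta n U J (perm_avg ({1..n} - J) f)"
  by (simp add: junta_def perm_avg_comp)

lemma perm_avg_junta:
  assumes "junta n U J h" "x \<in> U"
  shows "perm_avg ({1..n} - J) h x = h x"
  using assms by (intro perm_avg_eq_self) (auto simp: junta_def)

lemma inner_on_perm_avg_left:
  "inner_on U (perm_avg A f) g = (\<Sum>\<pi> | \<pi> permutes A. inner_on U (\<lambda>x. f (x \<circ> \<pi>)) g) / fact (card A)"
  unfolding inner_on_sum_left[symmetric]
  by (simp add: inner_on_def perm_avg_def sum_divide_distrib[symmetric] del: sum_divide_distrib)

lemma sum_perm_avg:
  assumes "A \<subseteq> {1..n}"
  shows "(\<Sum>x\<in>U. perm_avg A f x) = (\<Sum>x\<in>U. f x)"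
proof -
  have "(\<Sum>x\<in>U. perm_avg A f x) = (\<Sum>\<pi> | \<pi> permutes A. \<Sum>x\<in>U. f (x \<circ> \<pi>)) / fact (card A)"
    unfolding perm_avg_def sum_divide_distrib[symmetric] by (subst sum.swap) simp
  also have "(\<Sum>\<pi> | \<pi> permutes A. \<Sum>x\<in>U. f (x \<circ> \<pi>)) = (\<Sum>\<pi> | \<pi> permutes A. \<Sum>x\<in>U. f x)"
    using permutes_subset[OF _ assms] by (intro sum.cong sum_permute) auto
  also have "\<dots> = fact (card A) * (\<Sum>x\<in>U. f x)"
    using finite_subset[OF assms] by (simp add: card_permutations)
  finally show ?thesis by simp
qed

lemma sqnorm_on_perm_avg_le:
  assumes "A \<subseteq> {1..n}"
  shows "sqnorm_on U (perm_avg A f) \<le> sqnorm_on U f"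
proof -
  have "sqnorm_on U (perm_avg A f) \<le> (\<Sum>x\<in>U. perm_avg A (\<lambda>x. (f x)\<^sup>2) x)"
    using perm_avg_square_le[OF finite_subset[OF assms]]
    unfolding inner_on_def power2_eq_square by (intro sum_mono) simp
  also have "\<dots> = sqnorm_on U f"
    by (simp add: sum_perm_avg[OF assms] inner_on_def power2_eq_square)
  finally show ?thesis .
qed

lemma orthogonal_to_juntas_permute:
  assumes "orthogonal_to_juntas n U e h" "\<rho> permutes {1..n}"
  shows "orthogonal_to_juntas n U e (\<lambda>x. h (x \<circ> \<rho>))"
  unfolding orthogonal_to_juntas_def
proof (intro allI impI)
  fix J v assume J: "J \<subseteq> {1..n}" "card J < e" "junta n U J v"
  have inv: "inv \<rho> permutes {1..n}" using assms(2) permutes_inv by blast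
  have "inj_on (inv \<rho>) J" using permutes_inj[OF inv] inj_on_subset by blast
  then have "card (inv \<rho> ` J) < e" using J by (simp add: card_image)
  moreover have "inv \<rho> ` J \<subseteq> {1..n}" using J(1) permutes_image[OF inv] by blast
  ultimately show "inner_on U (\<lambda>x. h (x \<circ> \<rho>)) v = 0"
    using assms(1) junta_permute[OF J(3) inv J(1)]
    by (simp add: inner_on_permute_left[OF assms(2)] orthogonal_to_juntas_def)
qed

lemma orthogonal_to_juntas_perm_avg:
  assumes "orthogonal_to_juntas n U e h" "A \<subseteq> {1..n}"
  shows "orthogonal_to_juntas n U e (perm_avg A h)"
  using orthogonal_to_juntas_permute[OF assms(1) permutes_subset[OF _ assms(2)]]
  by (simp add: orthogonal_to_juntas_def inner_on_perm_avg_left)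

lemma junta_eq_sum_pattern_inds:
  assumes "junta n U J h" "J \<subseteq> {1..n}" "x \<in> U"
  shows "h x = (\<Sum>a\<in>U. h a / card {b\<in>U. agree_on J b a} * pattern_ind J a x)"
proof -
  let ?class = "\<lambda>a. {b\<in>U. agree_on J b a}"
  have "(\<Sum>a\<in>U. h a / card (?class a) * pattern_ind J a x) = (\<Sum>a\<in>?class x. h a / card (?class a))"
    using finite_orbit by (intro sum.mono_neutral_cong_right) (auto simp: pattern_ind_def agree_on_def)
  also have "\<dots> = (\<Sum>a\<in>?class x. h x / card (?class x))"
  proof (intro sum.cong refl)
    fix a assume a: "a \<in> ?class x"
    then have "?class a = ?class x" by (auto simp: agree_on_def)
    then show "h a / card (?class a) = h x / card (?class x)"
      using junta_eq[OF assms(1,2) _ assms(3), of a] a by simp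
  qed
  also have "x \<in> ?class x"
    using assms(3) by (simp add: agree_on_def)
  then have "card (?class x) \<noteq> 0"
    using finite_orbit by auto
  then have "(\<Sum>a\<in>?class x. h x / card (?class x)) = h x" by simp
  finally show ?thesis by simp
qed

definition small_pattern_inds :: "nat \<Rightarrow> ((nat \<Rightarrow> 'a) \<Rightarrow> real) set" where
  "small_pattern_inds e = (\<lambda>(J, a). pattern_ind J a) ` ({J. J \<subseteq> {1..n} \<and> card J < e} \<times> U)"

lemma finite_small_pattern_inds: "finite (small_pattern_inds e)"
proof -
  have "finite {J. J \<subseteq> {1..n} \<and> card J < e}" by (rule finite_subset[of _ "Pow {1..n}"]) auto
  then show ?thesis using finite_orbit by (simp add: small_pattern_inds_def)
qed

lemma orthogonal_to_juntasI:
  assumes "\<And>b. b \<in> small_pattern_inds e \<Longrightarrow> inner_on U r b = 0"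
  shows "orthogonal_to_juntas n U e r"
  unfolding orthogonal_to_juntas_def
proof (intro allI impI)
  fix J v assume J: "J \<subseteq> {1..n}" "card J < e" "junta n U J v"
  have "inner_on U r v =
      inner_on U r (\<lambda>x. \<Sum>a\<in>U. fscale (v a / card {b\<in>U. agree_on J b a}) (pattern_ind J a) x)"
    using junta_eq_sum_pattern_inds[OF J(3,1)] by (intro inner_on_cong) auto
  also have "\<dots> = (\<Sum>a\<in>U. v a / card {b\<in>U. agree_on J b a} * inner_on U r (pattern_ind J a))"
    unfolding inner_on_sum_right inner_on_scale_right ..
  also have "\<dots> = 0"
    using J(1,2) by (intro sum.neutral) (auto simp: small_pattern_inds_def intro!: assms)
  finally show "inner_on U r v = 0" .
qed

lemma perm_avg_pattern_ind_span:
  assumes "A \<subseteq> {1..n}" "b \<in> small_pattern_inds e"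
  shows "perm_avg A b \<in> fun_space.span (small_pattern_inds e)"
proof -
  obtain J a where J: "J \<subseteq> {1..n}" "card J < e" "a \<in> U" "b = pattern_ind J a"
    using assms(2) by (auto simp: small_pattern_inds_def)
  have shifted: "(\<lambda>x. b (x \<circ> \<pi>)) \<in> small_pattern_inds e" if "\<pi> permutes A" for \<pi>
  proof -
    have \<pi>: "\<pi> permutes {1..n}" using that assms(1) by (rule permutes_subset)
    have "(\<lambda>x. b (x \<circ> \<pi>)) = pattern_ind (\<pi> ` J) (a \<circ> inv \<pi>)"
      using permutes_inverses(2)[OF \<pi>] by (auto simp: J(4) pattern_ind_def agree_on_def)
    moreover have "card (\<pi> ` J) = card J"
      using permutes_inj[OF \<pi>] by (intro card_image) (auto intro: inj_on_subset)
    moreover have "\<pi> ` J \<subseteq> {1..n}"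
      using J(1) permutes_image[OF \<pi>] by blast
    ultimately show ?thesis
      using J(2) comp_closed[OF J(3) permutes_inv[OF \<pi>]] by (auto simp: small_pattern_inds_def)
  qed
  have pointwise: "(\<Sum>i\<in>I. F i) x = (\<Sum>i\<in>I. F i x)" for F :: "(nat \<Rightarrow> nat) \<Rightarrow> (nat \<Rightarrow> 'a) \<Rightarrow> real" and I x
    by (induction I rule: infinite_finite_induct) auto
  have "perm_avg A b = fscale (1 / fact (card A)) (\<Sum>\<pi> | \<pi> permutes A. (\<lambda>x. b (x \<circ> \<pi>)))"
    by (simp add: fun_eq_iff perm_avg_def pointwise)
  then show ?thesis
    using shifted by (auto intro!: fun_space.span_scale fun_space.span_sum intro: fun_space.span_base)
qed

lemma perm_avg_span:
  assumes "A \<subseteq> {1..n}" "v \<in> fun_space.span (small_pattern_inds e)"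
  shows "perm_avg A v \<in> fun_space.span (small_pattern_inds e)"
  using assms(2)
proof (induction rule: fun_space.span_induct_alt)
  case base
  have "perm_avg A (0 :: (nat \<Rightarrow> 'a) \<Rightarrow> real) = 0" by (simp add: fun_eq_iff perm_avg_def)
  then show ?case by (simp only: fun_space.span_zero)
next
  case (step c b v)
  then show ?case
    using perm_avg_pattern_ind_span[OF assms(1)]
    unfolding perm_avg_add perm_avg_scale by (intro fun_space.span_add fun_space.span_scale)
qed

lemma pure_junta_induct:
  assumes cong: "\<And>f g. (\<And>x. x \<in> U \<Longrightarrow> f x = g x) \<Longrightarrow> P f \<Longrightarrow> P g"
    and zero: "P 0"
    and add: "\<And>f g. P f \<Longrightarrow> P g \<Longrightarrow> P (f + g)"
    and pure: "\<And>J h. card J \<le> e \<Longrightarrow> pure_junta n U J h \<Longrightarrow> P h"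
    and J: "J \<subseteq> {1..n}" "card J \<le> e" "junta n U J h"
  shows "P h"
  using J
proof (induction "card J" arbitrary: J h rule: less_induct)
  case less
  let ?B = "small_pattern_inds (card J)" and ?A = "{1..n} - J"
  have P_span: "P u" if "u \<in> fun_space.span ?B" for u
    using that
  proof (induction rule: fun_space.span_induct_alt)
    case (step c b u)
    obtain I a where I: "I \<subseteq> {1..n}" "card I < card J" "b = pattern_ind I a"
      using step.hyps(1) by (auto simp: small_pattern_inds_def)
    have "P (fscale c b)"
      using less.hyps[OF I(2,1)] junta_scale[OF junta_pattern_ind[OF I(1)]] I less.prems(2) by simp
    then show ?case using add step.IH by blast
  qed (rule zero)
  obtain v where v: "v \<in> fun_space.span ?B" "\<And>b. b \<in> ?B \<Longrightarrow> inner_on U (h - v) b = 0"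
    using ex_span_orthogonal_residual[OF finite_small_pattern_inds] by blast
  have "pure_junta n U J (perm_avg ?A (h - v))"
    unfolding pure_junta_def using less.prems(1) v(2)
    by (intro conjI junta_perm_avg orthogonal_to_juntas_perm_avg orthogonal_to_juntasI) auto
  then have "P (perm_avg ?A v + perm_avg ?A (h - v))"
    using P_span[OF perm_avg_span[OF Diff_subset v(1)]] pure[OF less.prems(2)] by (intro add)
  moreover have "(perm_avg ?A v + perm_avg ?A (h - v)) x = h x" if "x \<in> U" for x
    using perm_avg_junta[OF less.prems(3) that] by (simp only: perm_avg_add[symmetric]) simp
  ultimately show ?case by (rule cong[rotated])
qed

end

section \<open>Shuffling a random set of coordinates\<close>

definition positions :: "nat \<Rightarrow> (nat \<Rightarrow> 'a) \<Rightarrow> 'a \<Rightarrow> nat set" where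
  "positions n x c = {i\<in>{1..n}. x i = c}"

lemma finite_positions [simp]: "finite (positions n x c)"
  by (simp add: positions_def)

lemma positions_subset: "positions n x c \<subseteq> {1..n}"
  by (auto simp: positions_def)

lemma positions_comp:
  assumes "\<pi> permutes {1..n}"
  shows "positions n (x \<circ> \<pi>) c = inv \<pi> ` positions n x c"
proof
  show "positions n (x \<circ> \<pi>) c \<subseteq> inv \<pi> ` positions n x c"
  proof
    fix i assume "i \<in> positions n (x \<circ> \<pi>) c"
    then have "\<pi> i \<in> positions n x c"
      using permutes_in_image[OF assms] by (auto simp: positions_def)
    then show "i \<in> inv \<pi> ` positions n x c"
      using permutes_inverses(2)[OF assms] by (metis image_eqI)
  qed
  show "inv \<pi> ` positions n x c \<subseteq> positions n (x \<circ> \<pi>) c"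
    using permutes_in_image[OF permutes_inv[OF assms]] permutes_inverses(1)[OF assms]
    by (auto simp: positions_def)
qed

lemma card_positions_comp:
  assumes "\<pi> permutes {1..n}"
  shows "card (positions n (x \<circ> \<pi>) c) = card (positions n x c)"
  unfolding positions_comp[OF assms]
  by (rule card_image) (meson assms inj_on_subset permutes_inj permutes_inv subset_UNIV)

lemma card_positions_Int_comp:
  assumes "\<pi> permutes {1..n}"
  shows "card (positions n (x \<circ> \<pi>) b \<inter> positions n (w \<circ> \<pi>) c) = card (positions n x b \<inter> positions n w c)"
proof -
  have "positions n (y \<circ> \<pi>) b \<inter> positions n (z \<circ> \<pi>) c = positions n ((\<lambda>i. (y i, z i)) \<circ> \<pi>) (b, c)"
    "positions n y b \<inter> positions n z c = positions n (\<lambda>i. (y i, z i)) (b, c)" for y z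
    by (auto simp: positions_def)
  then show ?thesis by (simp only: card_positions_comp[OF assms])
qed

lemma ex_permutes_of_card_fibres_eq:
  assumes "finite A" and "\<And>y. card {i\<in>A. f i = y} = card {i\<in>A. g i = y}"
  shows "\<exists>\<pi>. \<pi> permutes A \<and> (\<forall>i\<in>A. f i = g (\<pi> i))"
proof -
  have "image_mset f (mset_set A) = image_mset g (mset_set A)"
    using assms by (intro multiset_eqI) (simp add: count_image_mset_eq_card_vimage)
  from image_mset_eq_implies_permutes[OF assms(1) this] show ?thesis by blast
qed

definition stabilizer :: "nat \<Rightarrow> (nat \<Rightarrow> 'a) \<Rightarrow> (nat \<Rightarrow> nat) set" where
  "stabilizer n w = {\<tau>. \<tau> permutes {1..n} \<and> w \<circ> \<tau> = w}"

lemma finite_stabilizer [simp]: "finite (stabilizer n w)"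
  by (rule finite_subset[of _ "{\<tau>. \<tau> permutes {1..n}}"]) (auto simp: stabilizer_def finite_permutations)

lemma stabilizer_comp: "\<tau> \<in> stabilizer n w \<Longrightarrow> \<rho> \<in> stabilizer n w \<Longrightarrow> \<tau> \<circ> \<rho> \<in> stabilizer n w"
  unfolding stabilizer_def by (auto simp: permutes_compose comp_assoc[symmetric] simp del: comp_apply)

lemma stabilizer_inv:
  assumes "\<tau> \<in> stabilizer n w"
  shows "inv \<tau> \<in> stabilizer n w"
proof -
  have \<tau>: "\<tau> permutes {1..n}" "w \<circ> \<tau> = w" using assms by (auto simp: stabilizer_def)
  have "w \<circ> inv \<tau> = w \<circ> \<tau> \<circ> inv \<tau>" using \<tau>(2) by simp
  also have "\<dots> = w" using permutes_inv_o(1)[OF \<tau>(1)] by (simp add: comp_assoc)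
  finally show ?thesis using \<tau>(1) by (simp add: stabilizer_def permutes_inv)
qed

lemma card_stabilizer_pos: "0 < card (stabilizer n w)"
proof -
  have "id \<in> stabilizer n w" by (simp add: stabilizer_def permutes_id)
  then show ?thesis by (auto simp: card_gt_0_iff)
qed

lemma ex_subset_same_letters:
  assumes "finite S" and "\<And>i. i \<in> S \<Longrightarrow> card S \<le> card (B \<inter> positions n w (w i))" and "S \<subseteq> {1..n}"
  shows "\<exists>S'\<subseteq>B. S' \<subseteq> {1..n} \<and> (\<forall>c. card (S' \<inter> positions n w c) = card (S \<inter> positions n w c))"
proof -
  have "\<exists>T. T \<subseteq> B \<inter> positions n w c \<and> card T = card (S \<inter> positions n w c)" for c
  proof (cases "S \<inter> positions n w c = {}")
    case False
    then obtain i where "i \<in> S" "w i = c" by (auto simp: positions_def)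
    then have "card S \<le> card (B \<inter> positions n w c)" using assms(2) by blast
    moreover have "card (S \<inter> positions n w c) \<le> card S" using assms(1) by (intro card_mono) auto
    ultimately show ?thesis by (meson obtain_subset_with_card_n order_trans)
  qed (intro exI[of _ "{}"], simp)
  then obtain T where T: "\<And>c. T c \<subseteq> B \<inter> positions n w c" "\<And>c. card (T c) = card (S \<inter> positions n w c)"
    by metis
  have "(\<Union>c. T c) \<inter> positions n w c = T c" for c
    using T(1) by (auto simp: positions_def)
  moreover have "(\<Union>c. T c) \<subseteq> {1..n}"
    using T(1) positions_subset[of n w] by (meson UN_least le_infE order_trans)
  moreover have "(\<Union>c. T c) \<subseteq> B"
    using T(1) by blast
  ultimately show ?thesis
    using T(2) by (intro exI[of _ "\<Union>c. T c"]) (simp only: simp_thms)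
qed

lemma ex_stabilizer_image_subset:
  assumes "S \<subseteq> {1..n}" "S' \<subseteq> {1..n}"
    and "\<And>c. card (S' \<inter> positions n w c) = card (S \<inter> positions n w c)"
  shows "\<exists>\<tau>\<in>stabilizer n w. \<tau> ` S \<subseteq> S'"
proof -
  have card_fibre: "card {i\<in>{1..n}. (w i, i \<in> X) = (c, b)} =
      (if b then card (X \<inter> positions n w c) else card (positions n w c) - card (X \<inter> positions n w c))"
    if "X \<subseteq> {1..n}" for X c b
  proof -
    have "{i\<in>{1..n}. (w i, i \<in> X) = (c, b)} =
        (if b then X \<inter> positions n w c else positions n w c - X \<inter> positions n w c)"
      using that by (auto simp: positions_def)
    then show ?thesis by (simp add: card_Diff_subset)
  qed
  have "card {i\<in>{1..n}. (w i, i \<in> S) = p} = card {i\<in>{1..n}. (w i, i \<in> S') = p}" for p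
    by (cases p) (simp only: card_fibre[OF assms(1)] card_fibre[OF assms(2)] assms(3))
  then obtain \<tau> where \<tau>: "\<tau> permutes {1..n}" "\<forall>i\<in>{1..n}. (w i, i \<in> S) = (w (\<tau> i), \<tau> i \<in> S')"
    using ex_permutes_of_card_fibres_eq[of "{1..n}" "\<lambda>i. (w i, i \<in> S)" "\<lambda>i. (w i, i \<in> S')"] by blast
  have "w (\<tau> i) = w i" for i
    using \<tau> by (cases "i \<in> {1..n}") (auto simp: permutes_not_in)
  then have "\<tau> \<in> stabilizer n w" using \<tau>(1) by (auto simp: stabilizer_def)
  moreover have "\<tau> ` S \<subseteq> S'" using \<tau>(2) assms(1) by blast
  ultimately show ?thesis by blast
qed

definition placements :: "nat \<Rightarrow> (nat \<Rightarrow> 'a) \<Rightarrow> nat set \<Rightarrow> nat set \<Rightarrow> (nat \<Rightarrow> nat) set" where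
  "placements n w S B = {\<tau>\<in>stabilizer n w. \<tau> ` S \<subseteq> B}"

text \<open>Draw a uniform set \<open>S'\<close> independently of \<open>w\<close> and replace it by \<open>S = \<tau> ` S'\<close> with a uniform
  \<open>\<tau> \<in> placements n w S' B\<close>. The weight is the resulting density of \<open>S\<close> with respect to the uniform law.\<close>

definition placement_weight :: "nat \<Rightarrow> (nat \<Rightarrow> 'a) \<Rightarrow> nat set \<Rightarrow> nat set \<Rightarrow> real" where
  "placement_weight n w S B = of_bool (S \<subseteq> B) * card (stabilizer n w) / card (placements n w S B)"

lemma finite_placements [simp]: "finite (placements n w S B)"
  by (simp add: placements_def)

lemma placements_nonempty:
  assumes "S \<subseteq> {1..n}" "\<And>i. i \<in> S \<Longrightarrow> card S \<le> card (B \<inter> positions n w (w i))"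
  shows "placements n w S B \<noteq> {}"
proof -
  obtain S' where S': "S' \<subseteq> B" "S' \<subseteq> {1..n}" "\<And>c. card (S' \<inter> positions n w c) = card (S \<inter> positions n w c)"
    using ex_subset_same_letters[OF finite_subset[OF assms(1)] assms(2,1)] by auto
  then show ?thesis
    using ex_stabilizer_image_subset[OF assms(1) S'(2,3)] by (fastforce simp: placements_def)
qed

lemma card_placements_permute_ge:
  assumes "\<pi> permutes {1..n}"
  shows "card (placements n w S B) \<le> card (placements n (w \<circ> \<pi>) (inv \<pi> ` S) (inv \<pi> ` B))"
proof (rule card_inj_on_le[where f = "\<lambda>\<tau>. inv \<pi> \<circ> \<tau> \<circ> \<pi>"])
  note cancel = permutes_inverses[OF assms]
  show "inj_on (\<lambda>\<tau>. inv \<pi> \<circ> \<tau> \<circ> \<pi>) (placements n w S B)"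
    by (rule inj_on_inverseI[where g = "\<lambda>\<rho>. \<pi> \<circ> \<rho> \<circ> inv \<pi>"]) (simp add: fun_eq_iff cancel)
  show "(\<lambda>\<tau>. inv \<pi> \<circ> \<tau> \<circ> \<pi>) ` placements n w S B \<subseteq> placements n (w \<circ> \<pi>) (inv \<pi> ` S) (inv \<pi> ` B)"
  proof (rule image_subsetI)
    fix \<tau> assume \<tau>: "\<tau> \<in> placements n w S B"
    then have "w (\<tau> i) = w i" for i by (simp add: placements_def stabilizer_def fun_eq_iff)
    then have "w \<circ> \<pi> \<circ> (inv \<pi> \<circ> \<tau> \<circ> \<pi>) = w \<circ> \<pi>" by (simp add: fun_eq_iff cancel)
    moreover have "inv \<pi> \<circ> \<tau> \<circ> \<pi> permutes {1..n}"
      using \<tau> assms by (intro permutes_compose permutes_inv) (simp_all add: placements_def stabilizer_def)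
    moreover have "(inv \<pi> \<circ> \<tau> \<circ> \<pi>) ` inv \<pi> ` S \<subseteq> inv \<pi> ` B"
      using \<tau> by (auto simp: placements_def cancel)
    ultimately show "inv \<pi> \<circ> \<tau> \<circ> \<pi> \<in> placements n (w \<circ> \<pi>) (inv \<pi> ` S) (inv \<pi> ` B)"
      by (simp add: placements_def stabilizer_def del: comp_apply)
  qed
qed simp

lemma card_placements_permute:
  assumes "\<pi> permutes {1..n}"
  shows "card (placements n (w \<circ> \<pi>) (inv \<pi> ` S) (inv \<pi> ` B)) = card (placements n w S B)"
proof (rule antisym[OF _ card_placements_permute_ge[OF assms]])
  have "inv (inv \<pi>) ` inv \<pi> ` X = X" for X
    using permutes_inverses[OF assms] permutes_inv_inv[OF assms] by (force simp: image_comp)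
  moreover have "w \<circ> \<pi> \<circ> inv \<pi> = w"
    by (simp add: fun_eq_iff permutes_inverses[OF assms])
  ultimately show "card (placements n (w \<circ> \<pi>) (inv \<pi> ` S) (inv \<pi> ` B)) \<le> card (placements n w S B)"
    using card_placements_permute_ge[OF permutes_inv[OF assms], of "w \<circ> \<pi>" "inv \<pi> ` S" "inv \<pi> ` B"] by simp
qed

lemma placement_weight_permute:
  assumes "\<pi> permutes {1..n}"
  shows "placement_weight n (w \<circ> \<pi>) (inv \<pi> ` S) (inv \<pi> ` B) = placement_weight n w S B"
proof -
  have "inj (inv \<pi>)" using permutes_inj[OF permutes_inv[OF assms]] .
  moreover have "card (stabilizer n (w \<circ> \<pi>)) = card (stabilizer n w)"
    using card_placements_permute[OF assms, of w "{}" "{}"] by (simp add: placements_def)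
  ultimately show ?thesis
    by (simp only: placement_weight_def card_placements_permute[OF assms] inj_image_subset_iff)
qed

lemma card_placements_image:
  assumes "\<tau> \<in> stabilizer n w"
  shows "card (placements n w (\<tau> ` S) B) = card (placements n w S B)"
proof (rule bij_betw_same_card[OF bij_betw_byWitness[where f = "\<lambda>\<rho>. \<rho> \<circ> \<tau>" and f' = "\<lambda>\<rho>. \<rho> \<circ> inv \<tau>"]])
  have inverse: "\<tau> \<circ> inv \<tau> = id" "inv \<tau> \<circ> \<tau> = id"
    using assms permutes_inv_o by (auto simp: stabilizer_def)
  show "(\<lambda>\<rho>. \<rho> \<circ> \<tau>) ` placements n w (\<tau> ` S) B \<subseteq> placements n w S B"
    using stabilizer_comp[OF _ assms] by (auto simp: placements_def image_subset_iff)
  show "(\<lambda>\<rho>. \<rho> \<circ> inv \<tau>) ` placements n w S B \<subseteq> placements n w (\<tau> ` S) B"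
    using stabilizer_comp[OF _ stabilizer_inv[OF assms]] inverse(2)
    by (auto simp: placements_def image_subset_iff fun_eq_iff)
qed (use permutes_inverses[of \<tau> "{1..n}"] assms in \<open>auto simp: stabilizer_def fun_eq_iff\<close>)

definition subsets_of_card :: "nat \<Rightarrow> nat \<Rightarrow> nat set set" where
  "subsets_of_card n s = {S. S \<subseteq> {1..n} \<and> card S = s}"

lemma finite_subsets_of_card [simp]: "finite (subsets_of_card n s)"
  unfolding subsets_of_card_def by (rule finite_subset[of _ "Pow {1..n}"]) auto

lemma card_subsets_of_card: "card (subsets_of_card n s) = n choose s"
  using n_subsets[of "{1..n}" s] by (simp add: subsets_of_card_def)

lemma sum_subsets_of_card_permute:
  assumes "\<pi> permutes {1..n}"
  shows "(\<Sum>S\<in>subsets_of_card n s. F (\<pi> ` S)) = (\<Sum>S\<in>subsets_of_card n s. F S)"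
proof (rule sum.reindex_bij_betw, rule bij_betw_byWitness[where f' = "image (inv \<pi>)"])
  have closed: "\<rho> ` S \<in> subsets_of_card n s" if "\<rho> permutes {1..n}" "S \<in> subsets_of_card n s" for \<rho> S
    using that permutes_image[OF that(1)] card_image[OF inj_on_subset[OF permutes_inj[OF that(1)]], of S]
    by (auto simp: subsets_of_card_def)
  show "image \<pi> ` subsets_of_card n s \<subseteq> subsets_of_card n s"
    "image (inv \<pi>) ` subsets_of_card n s \<subseteq> subsets_of_card n s"
    using closed assms permutes_inv[OF assms] by auto
qed (simp_all add: image_comp permutes_inv_o[OF assms])

lemma sum_placement_weight_sets:
  assumes "\<And>S. S \<in> subsets_of_card n s \<Longrightarrow> placements n w S B \<noteq> {}"
  shows "(\<Sum>S\<in>subsets_of_card n s. placement_weight n w S B) = n choose s"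
proof -
  let ?SS = "subsets_of_card n s" and ?N = "\<lambda>S. real (card (placements n w S B))"
  have shift: "(\<Sum>S\<in>?SS. of_bool (S \<subseteq> B) / ?N S) = (\<Sum>S\<in>?SS. of_bool (\<tau> ` S \<subseteq> B) / ?N S)"
    if \<tau>: "\<tau> \<in> stabilizer n w" for \<tau>
    using sum_subsets_of_card_permute[of \<tau> n "\<lambda>S. of_bool (S \<subseteq> B) / ?N S" s] \<tau>
    by (simp add: card_placements_image stabilizer_def)
  have "(\<Sum>S\<in>?SS. placement_weight n w S B) = (\<Sum>\<tau>\<in>stabilizer n w. \<Sum>S\<in>?SS. of_bool (S \<subseteq> B) / ?N S)"
    by (simp add: placement_weight_def sum_distrib_left mult.commute)
  also have "\<dots> = (\<Sum>S\<in>?SS. \<Sum>\<tau>\<in>stabilizer n w. of_bool (\<tau> ` S \<subseteq> B) / ?N S)"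
    by (subst sum.swap) (intro sum.cong refl shift)
  also have "\<dots> = (\<Sum>S\<in>?SS. ?N S / ?N S)"
    by (simp add: placements_def sum_divide_distrib[symmetric] Int_def)
  also have "\<dots> = n choose s"
    using assms by (simp add: card_subsets_of_card)
  finally show ?thesis .
qed

lemma sum_placement_weight_stabilizer:
  assumes "placements n w S B \<noteq> {}"
  shows "(\<Sum>\<tau>\<in>stabilizer n w. placement_weight n w S (inv \<tau> ` B)) = card (stabilizer n w)"
proof -
  have weight: "placement_weight n w S (inv \<tau> ` B) =
      of_bool (\<tau> ` S \<subseteq> B) * real (card (stabilizer n w)) / card (placements n w S B)"
    if \<tau>: "\<tau> \<in> stabilizer n w" for \<tau>
  proof -
    have p: "\<tau> permutes {1..n}" "w \<circ> \<tau> = w" using \<tau> by (auto simp: stabilizer_def)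
    have S: "inv \<tau> ` \<tau> ` S = S" using permutes_inv_o[OF p(1)] by (simp add: image_comp)
    have "placement_weight n w S (inv \<tau> ` B) = placement_weight n w (\<tau> ` S) B"
      using placement_weight_permute[OF p(1), of w "\<tau> ` S" B] by (simp only: p(2) S)
    then show ?thesis by (simp add: placement_weight_def card_placements_image[OF \<tau>])
  qed
  have "(\<Sum>\<tau>\<in>stabilizer n w. placement_weight n w S (inv \<tau> ` B)) =
      (\<Sum>\<tau>\<in>stabilizer n w. of_bool (\<tau> ` S \<subseteq> B)) * real (card (stabilizer n w)) / card (placements n w S B)"
    by (simp only: weight sum_distrib_right sum_divide_distrib cong: sum.cong)
  also have "(\<Sum>\<tau>\<in>stabilizer n w. of_bool (\<tau> ` S \<subseteq> B) :: real) = card (placements n w S B)"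
    by (simp add: placements_def Int_def)
  finally show ?thesis using assms by simp
qed

definition equivariant :: "nat \<Rightarrow> (nat \<Rightarrow> 'a) set \<Rightarrow> (nat \<Rightarrow> 'b) set \<Rightarrow> ((nat \<Rightarrow> 'a) \<Rightarrow> (nat \<Rightarrow> 'b) \<Rightarrow> real) \<Rightarrow> bool" where
  "equivariant n U V K \<longleftrightarrow>
     (\<forall>\<pi>. \<pi> permutes {1..n} \<longrightarrow> (\<forall>x\<in>U. \<forall>y\<in>V. K (x \<circ> \<pi>) (y \<circ> \<pi>) = K x y))"

lemma equivariantD:
  "equivariant n U V K \<Longrightarrow> \<pi> permutes {1..n} \<Longrightarrow> x \<in> U \<Longrightarrow> y \<in> V \<Longrightarrow> K (x \<circ> \<pi>) (y \<circ> \<pi>) = K x y"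
  by (simp add: equivariant_def)

definition kernel_op :: "'b set \<Rightarrow> ('a \<Rightarrow> 'b \<Rightarrow> real) \<Rightarrow> ('b \<Rightarrow> real) \<Rightarrow> 'a \<Rightarrow> real" where
  "kernel_op V K g x = (\<Sum>y\<in>V. K x y * g y)"

lemma inner_on_kernel_op: "inner_on U f (kernel_op V K g) = (\<Sum>x\<in>U. \<Sum>y\<in>V. K x y * f x * g y)"
  by (simp add: inner_on_def kernel_op_def sum_distrib_left mult_ac)

lemma Cauchy_Schwarz_sum_weighted:
  fixes k :: "'a \<Rightarrow> real"
  assumes "\<And>p. p \<in> I \<Longrightarrow> 0 \<le> k p"
  shows "(\<Sum>p\<in>I. k p * a p * b p)\<^sup>2 \<le> (\<Sum>p\<in>I. k p * (a p)\<^sup>2) * (\<Sum>p\<in>I. k p * (b p)\<^sup>2)"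
proof -
  have "(\<Sum>p\<in>I. k p * a p * b p) = (\<Sum>p\<in>I. (sqrt (k p) * a p) * (sqrt (k p) * b p))"
    using assms by (intro sum.cong) (auto simp: algebra_simps)
  also have "\<dots>\<^sup>2 \<le> (\<Sum>p\<in>I. (sqrt (k p) * a p)\<^sup>2) * (\<Sum>p\<in>I. (sqrt (k p) * b p)\<^sup>2)"
    by (rule Cauchy_Schwarz_ineq_sum)
  also have "\<dots> = (\<Sum>p\<in>I. k p * (a p)\<^sup>2) * (\<Sum>p\<in>I. k p * (b p)\<^sup>2)"
    using assms by (simp add: power_mult_distrib cong: sum.cong)
  finally show ?thesis .
qed

lemma Cauchy_Schwarz_kernel_family:
  fixes k :: "'i \<Rightarrow> 'a \<Rightarrow> 'b \<Rightarrow> real"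
  assumes "\<And>i x y. i \<in> I \<Longrightarrow> x \<in> U \<Longrightarrow> y \<in> V \<Longrightarrow> 0 \<le> k i x y"
  shows "(\<Sum>i\<in>I. inner_on U f (kernel_op V (k i) (g i)))\<^sup>2 \<le>
    (\<Sum>x\<in>U. (\<Sum>i\<in>I. \<Sum>y\<in>V. k i x y) * (f x)\<^sup>2) * (\<Sum>i\<in>I. \<Sum>y\<in>V. (\<Sum>x\<in>U. k i x y) * (g i y)\<^sup>2)"
proof -
  have triple: "(\<Sum>i\<in>I. \<Sum>x\<in>U. \<Sum>y\<in>V. F i x y) = (\<Sum>(i, x, y)\<in>I \<times> U \<times> V. F i x y)" for F :: "'i \<Rightarrow> 'a \<Rightarrow> 'b \<Rightarrow> real"
    by (simp add: sum.cartesian_product split_def)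
  have left: "(\<Sum>x\<in>U. (\<Sum>i\<in>I. \<Sum>y\<in>V. k i x y) * (f x)\<^sup>2) = (\<Sum>i\<in>I. \<Sum>x\<in>U. \<Sum>y\<in>V. k i x y * (f x)\<^sup>2)"
    unfolding sum_distrib_right by (rule sum.swap)
  have right: "(\<Sum>i\<in>I. \<Sum>y\<in>V. (\<Sum>x\<in>U. k i x y) * (g i y)\<^sup>2) = (\<Sum>i\<in>I. \<Sum>x\<in>U. \<Sum>y\<in>V. k i x y * (g i y)\<^sup>2)"
    unfolding sum_distrib_right by (intro sum.cong refl sum.swap)
  show ?thesis
    unfolding inner_on_kernel_op left right triple
    using Cauchy_Schwarz_sum_weighted[of "I \<times> U \<times> V" "\<lambda>(i, x, y). k i x y" "\<lambda>(i, x, y). f x" "\<lambda>(i, x, y). g i y"] assms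
    by (auto simp: split_def)
qed

definition shuffled_kernel ::
  "nat \<Rightarrow> ((nat \<Rightarrow> 'a) \<Rightarrow> (nat \<Rightarrow> 'a) \<Rightarrow> real) \<Rightarrow> 'a \<Rightarrow> nat set \<Rightarrow> (nat \<Rightarrow> 'a) \<Rightarrow> (nat \<Rightarrow> 'a) \<Rightarrow> real" where
  "shuffled_kernel n K c0 S x w = K x w * placement_weight n w S (positions n x c0)"

context perm_orbit
begin

lemma shuffled_kernel_column_sum:
  assumes equiv: "equivariant n U U K" and w: "w \<in> U"
    and placeable: "\<And>x. x \<in> U \<Longrightarrow> K x w \<noteq> 0 \<Longrightarrow> placements n w S (positions n x c0) \<noteq> {}"
  shows "(\<Sum>x\<in>U. shuffled_kernel n K c0 S x w) = (\<Sum>x\<in>U. K x w)"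
proof -
  let ?weight = "\<lambda>x \<tau>. placement_weight n w S (inv \<tau> ` positions n x c0)"
  let ?Z = "real (card (stabilizer n w))"
  have shift: "(\<Sum>x\<in>U. shuffled_kernel n K c0 S x w) = (\<Sum>x\<in>U. K x w * ?weight x \<tau>)"
    if \<tau>: "\<tau> \<in> stabilizer n w" for \<tau>
  proof -
    have p: "\<tau> permutes {1..n}" "w \<circ> \<tau> = w" using \<tau> by (auto simp: stabilizer_def)
    have "(\<Sum>x\<in>U. shuffled_kernel n K c0 S x w) = (\<Sum>x\<in>U. shuffled_kernel n K c0 S (x \<circ> \<tau>) w)"
      by (rule sum_permute[OF p(1), symmetric])
    also have "\<dots> = (\<Sum>x\<in>U. K x w * ?weight x \<tau>)"
      using equivariantD[OF equiv p(1) _ w]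
      by (simp add: shuffled_kernel_def positions_comp[OF p(1)] p(2) del: comp_apply)
    finally show ?thesis .
  qed
  have "?Z * (\<Sum>x\<in>U. shuffled_kernel n K c0 S x w) = (\<Sum>\<tau>\<in>stabilizer n w. \<Sum>x\<in>U. K x w * ?weight x \<tau>)"
    using sum.cong[OF refl shift] by simp
  also have "\<dots> = (\<Sum>x\<in>U. K x w * (\<Sum>\<tau>\<in>stabilizer n w. ?weight x \<tau>))"
    unfolding sum_distrib_left by (rule sum.swap)
  also have "\<dots> = (\<Sum>x\<in>U. K x w * ?Z)"
  proof (intro sum.cong refl)
    fix x assume "x \<in> U"
    then show "K x w * (\<Sum>\<tau>\<in>stabilizer n w. ?weight x \<tau>) = K x w * ?Z"
      using sum_placement_weight_stabilizer[OF placeable] by (cases "K x w = 0") auto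
  qed
  finally show ?thesis
    using card_stabilizer_pos[of n w] by (auto simp: sum_distrib_right[symmetric])
qed

lemma sum_shuffled_kernel:
  assumes "\<And>S. S \<in> subsets_of_card n s \<Longrightarrow> K x w \<noteq> 0 \<Longrightarrow> placements n w S (positions n x c0) \<noteq> {}"
  shows "(\<Sum>S\<in>subsets_of_card n s. shuffled_kernel n K c0 S x w) = K x w * (n choose s)"
  using sum_placement_weight_sets[of n s w "positions n x c0"] assms
  by (cases "K x w = 0") (auto simp: shuffled_kernel_def sum_distrib_left[symmetric])

lemma shuffled_kernel_permute_right:
  assumes equiv: "equivariant n U U K" and x: "x \<in> U" and w: "w \<in> U"
    and S: "S \<subseteq> {1..n}" and \<pi>: "\<pi> permutes S"
  shows "shuffled_kernel n K c0 S x (w \<circ> \<pi>) = shuffled_kernel n K c0 S x w"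
proof (cases "S \<subseteq> positions n x c0")
  case True
  have p: "\<pi> permutes {1..n}" using \<pi> S by (rule permutes_subset)
  have "x \<circ> \<pi> = x"
  proof
    fix i show "(x \<circ> \<pi>) i = x i"
      using True permutes_in_image[OF \<pi>, of i] permutes_not_in[OF \<pi>, of i]
      by (cases "i \<in> S") (auto simp: positions_def)
  qed
  moreover have "inv \<pi> ` S = S" using \<pi> permutes_image permutes_inv by blast
  ultimately show ?thesis
    using equivariantD[OF equiv p x w] positions_comp[OF p, of x c0]
      placement_weight_permute[OF p, of w S "positions n x c0"]
    by (simp add: shuffled_kernel_def del: comp_apply)
qed (simp add: shuffled_kernel_def placement_weight_def)

lemma sum_invariant_mult_perm_avg:
  assumes "S \<subseteq> {1..n}" and invariant: "\<And>\<pi> w. \<pi> permutes S \<Longrightarrow> w \<in> U \<Longrightarrow> k (w \<circ> \<pi>) = k w"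
  shows "(\<Sum>w\<in>U. k w * perm_avg S h w) = (\<Sum>w\<in>U. k w * h w)"
proof -
  have "(\<Sum>w\<in>U. k w * h (w \<circ> \<pi>)) = (\<Sum>w\<in>U. k w * h w)" if \<pi>: "\<pi> permutes S" for \<pi>
    using sum_permute[OF permutes_subset[OF \<pi> assms(1)], of "\<lambda>w. k w * h w"] invariant[OF \<pi>] by simp
  moreover have "(\<Sum>w\<in>U. k w * perm_avg S h w) =
      (\<Sum>\<pi> | \<pi> permutes S. \<Sum>w\<in>U. k w * h (w \<circ> \<pi>)) / fact (card S)"
    unfolding perm_avg_def by (subst sum.swap) (simp add: sum_distrib_left sum_divide_distrib)
  ultimately show ?thesis
    using finite_subset[OF assms(1)] by (simp add: card_permutations)
qed

lemma sum_shuffled_kernel_forms: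
  assumes equiv: "equivariant n U U K"
    and placeable: "\<And>S x w. S \<in> subsets_of_card n s \<Longrightarrow> x \<in> U \<Longrightarrow> w \<in> U \<Longrightarrow> K x w \<noteq> 0 \<Longrightarrow>
      placements n w S (positions n x c0) \<noteq> {}"
  shows "(\<Sum>S\<in>subsets_of_card n s. inner_on U h (kernel_op U (shuffled_kernel n K c0 S) (perm_avg S h))) =
    (n choose s) * inner_on U h (kernel_op U K h)"
proof -
  let ?SS = "subsets_of_card n s" and ?k = "shuffled_kernel n K c0"
  have "kernel_op U (?k S) (perm_avg S h) x = kernel_op U (?k S) h x" if "S \<in> ?SS" "x \<in> U" for S x
    using that unfolding kernel_op_def
    by (intro sum_invariant_mult_perm_avg shuffled_kernel_permute_right[OF equiv]) (auto simp: subsets_of_card_def)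
  then have "(\<Sum>S\<in>?SS. inner_on U h (kernel_op U (?k S) (perm_avg S h))) = (\<Sum>S\<in>?SS. inner_on U h (kernel_op U (?k S) h))"
    by (intro sum.cong inner_on_cong) auto
  also have "\<dots> = (\<Sum>x\<in>U. \<Sum>w\<in>U. (\<Sum>S\<in>?SS. ?k S x w) * h x * h w)"
    unfolding inner_on_kernel_op sum_distrib_right by (subst sum.swap) (intro sum.cong refl sum.swap)
  also have "\<dots> = (n choose s) * inner_on U h (kernel_op U K h)"
    using placeable by (simp add: sum_shuffled_kernel inner_on_kernel_op sum_distrib_left mult_ac)
  finally show ?thesis .
qed

lemma form_square_le_avg_sqnorm_perm_avg:
  assumes nonneg: "\<And>x w. x \<in> U \<Longrightarrow> w \<in> U \<Longrightarrow> 0 \<le> K x w"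
    and equiv: "equivariant n U U K"
    and row: "\<And>x. x \<in> U \<Longrightarrow> (\<Sum>w\<in>U. K x w) \<le> 1"
    and col: "\<And>w. w \<in> U \<Longrightarrow> (\<Sum>x\<in>U. K x w) \<le> 1"
    and supp: "\<And>x w c. x \<in> U \<Longrightarrow> w \<in> U \<Longrightarrow> K x w \<noteq> 0 \<Longrightarrow> c \<in> \<Sigma> \<Longrightarrow>
      s \<le> card (positions n x c0 \<inter> positions n w c)"
    and s: "s \<le> n"
  shows "(inner_on U h (kernel_op U K h))\<^sup>2 \<le>
    sqnorm_on U h * ((\<Sum>S\<in>subsets_of_card n s. sqnorm_on U (perm_avg S h)) / (n choose s))"
proof -
  let ?SS = "subsets_of_card n s" and ?k = "shuffled_kernel n K c0" and ?N = "real (n choose s)"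
  have N: "0 < ?N" using s by simp
  have placeable: "placements n w S (positions n x c0) \<noteq> {}"
    if "S \<in> ?SS" "x \<in> U" "w \<in> U" "K x w \<noteq> 0" for S x w
    using that supp letters[OF that(3)] by (intro placements_nonempty) (auto simp: subsets_of_card_def)
  have k_nonneg: "0 \<le> ?k S x w" if "x \<in> U" "w \<in> U" for S x w
    using nonneg[OF that] by (simp add: shuffled_kernel_def placement_weight_def)
  have mass_le: "a * r\<^sup>2 \<le> r\<^sup>2" if "a \<le> 1" for a r :: real
    using mult_right_mono[OF that, of "r\<^sup>2"] by simp
  have forms: "(\<Sum>S\<in>?SS. inner_on U h (kernel_op U (?k S) (perm_avg S h))) = ?N * inner_on U h (kernel_op U K h)"
    by (rule sum_shuffled_kernel_forms[OF equiv placeable])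
  have rows: "(\<Sum>x\<in>U. (\<Sum>S\<in>?SS. \<Sum>w\<in>U. ?k S x w) * (h x)\<^sup>2) \<le> ?N * sqnorm_on U h"
  proof -
    have "(\<Sum>S\<in>?SS. \<Sum>w\<in>U. ?k S x w) = ?N * (\<Sum>w\<in>U. K x w)" if "x \<in> U" for x
      using placeable that by (subst sum.swap) (simp add: sum_shuffled_kernel sum_distrib_right mult.commute[of ?N])
    then have "(\<Sum>x\<in>U. (\<Sum>S\<in>?SS. \<Sum>w\<in>U. ?k S x w) * (h x)\<^sup>2) = ?N * (\<Sum>x\<in>U. (\<Sum>w\<in>U. K x w) * (h x)\<^sup>2)"
      by (simp add: mult.assoc flip: sum_distrib_left)
    also have "\<dots> \<le> ?N * (\<Sum>x\<in>U. (h x)\<^sup>2)"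
      using row by (intro mult_left_mono sum_mono mass_le) auto
    finally show ?thesis by (simp add: inner_on_def power2_eq_square)
  qed
  have cols: "(\<Sum>S\<in>?SS. \<Sum>w\<in>U. (\<Sum>x\<in>U. ?k S x w) * (perm_avg S h w)\<^sup>2) \<le> (\<Sum>S\<in>?SS. sqnorm_on U (perm_avg S h))"
    unfolding inner_on_def power2_eq_square[symmetric]
    using col placeable by (intro sum_mono mass_le) (simp add: shuffled_kernel_column_sum[OF equiv])
  have "(?N * inner_on U h (kernel_op U K h))\<^sup>2 \<le> (?N * sqnorm_on U h) * (\<Sum>S\<in>?SS. sqnorm_on U (perm_avg S h))"
    unfolding forms[symmetric]
    by (rule order_trans[OF Cauchy_Schwarz_kernel_family mult_mono[OF rows cols]])
      (auto intro!: sum_nonneg mult_nonneg_nonneg k_nonneg sqnorm_on_nonneg)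
  then show ?thesis
    using N by (simp add: power_mult_distrib power2_eq_square field_simps)
qed

end

definition move_coord :: "nat \<Rightarrow> nat \<Rightarrow> ((nat \<Rightarrow> 'a) \<Rightarrow> real) \<Rightarrow> (nat \<Rightarrow> 'a) \<Rightarrow> real" where
  "move_coord i j h x = h (x \<circ> Transposition.transpose i j)"

lemma ex_permutes_pair:
  assumes "a \<in> X" "b \<in> X" "a' \<in> X" "b' \<in> X" "a \<noteq> b" "a' \<noteq> b'"
  shows "\<exists>\<pi>. \<pi> permutes X \<and> \<pi> a = a' \<and> \<pi> b = b'"
proof (intro exI conjI)
  let ?c = "Transposition.transpose a a' b"
  let ?\<pi> = "Transposition.transpose ?c b' \<circ> Transposition.transpose a a'"
  have c: "?c \<in> X" "?c \<noteq> a'" using assms by (auto simp: Transposition.transpose_def)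
  show "?\<pi> permutes X"
    using assms c(1) by (intro permutes_compose permutes_swap_id)
  show "?\<pi> a = a'" using c(2) assms(6) by (simp add: Transposition.transpose_def)
  show "?\<pi> b = b'" by simp
qed

context perm_orbit
begin

lemma move_coord_permute:
  assumes h: "junta n U J h" and J: "J \<subseteq> {1..n}" "i \<in> J"
    and \<pi>: "\<pi> permutes insert i ({1..n} - J)" and j: "j \<in> insert i ({1..n} - J)" and x: "x \<in> U"
  shows "move_coord i j h (x \<circ> \<pi>) = move_coord i (\<pi> j) h x"
proof -
  have \<pi>j: "\<pi> j \<in> insert i ({1..n} - J)" using permutes_in_image[OF \<pi>] j by blast
  have \<pi>n: "\<pi> permutes {1..n}" using \<pi> by (rule permutes_subset) (use J in auto)
  have swap: "Transposition.transpose i k permutes {1..n}" if "k \<in> insert i ({1..n} - J)" for k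
    using that J by (intro permutes_swap_id) auto
  have "(x \<circ> \<pi> \<circ> Transposition.transpose i j) k = (x \<circ> Transposition.transpose i (\<pi> j)) k" if k: "k \<in> J" for k
  proof (cases "k = i")
    case False
    then have "k \<noteq> j" "k \<noteq> \<pi> j" "\<pi> k = k"
      using k j \<pi>j permutes_not_in[OF \<pi>, of k] by auto
    then show ?thesis using False by (simp add: Transposition.transpose_def)
  qed simp
  then show ?thesis
    unfolding move_coord_def
    by (intro junta_eq[OF h J(1)] comp_closed[OF comp_closed[OF x \<pi>n] swap[OF j]] comp_closed[OF x swap[OF \<pi>j]])
      (simp add: agree_on_def)
qed

lemma inner_on_move_coord_eq:
  assumes h: "junta n U J h" and J: "J \<subseteq> {1..n}" "i \<in> J"
    and "{a, b, a', b'} \<subseteq> insert i ({1..n} - J)" and "a \<noteq> b" "a' \<noteq> b'"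
  shows "inner_on U (move_coord i a h) (move_coord i b h) = inner_on U (move_coord i a' h) (move_coord i b' h)"
proof -
  let ?X = "insert i ({1..n} - J)"
  obtain \<pi> where \<pi>: "\<pi> permutes ?X" "\<pi> a = a'" "\<pi> b = b'"
    using ex_permutes_pair[of a ?X b a' b'] assms by auto
  have "inner_on U (move_coord i a' h) (move_coord i b' h) =
      inner_on U (\<lambda>x. move_coord i a h (x \<circ> \<pi>)) (\<lambda>x. move_coord i b h (x \<circ> \<pi>))"
    using assms(4) \<pi> by (intro inner_on_cong) (simp_all only: move_coord_permute[OF h J \<pi>(1)] insert_subset)
  also have "\<dots> = inner_on U (move_coord i a h) (move_coord i b h)"
    using J by (intro inner_on_permute permutes_subset[OF \<pi>(1)]) auto
  finally show ?thesis by simp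
qed

text \<open>The sum of \<open>h\<close> over all positions of its coordinate \<open>i\<close> outside \<open>J - {i}\<close> no longer depends on \<open>i\<close>.\<close>

lemma inner_on_sum_move_coord_eq_0:
  assumes h: "pure_junta n U J h" and i: "i \<in> J"
  shows "(\<Sum>j\<in>insert i ({1..n} - J). inner_on U h (move_coord i j h)) = 0"
proof -
  let ?X = "insert i ({1..n} - J)"
  note J = pure_juntaD[OF h]
  have "junta n U (J - {i}) (\<lambda>x. \<Sum>j\<in>?X. move_coord i j h x)"
    unfolding junta_def
  proof (intro allI impI ballI)
    fix \<pi> x assume "\<pi> permutes {1..n} - (J - {i})" and x: "x \<in> U"
    moreover have "{1..n} - (J - {i}) = ?X" using J(1) i by auto
    ultimately have \<pi>: "\<pi> permutes ?X" by simp
    have "(\<Sum>j\<in>?X. move_coord i j h (x \<circ> \<pi>)) = (\<Sum>j\<in>?X. move_coord i (\<pi> j) h x)"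
      by (intro sum.cong refl move_coord_permute[OF J(2,1) i \<pi> _ x])
    also have "\<dots> = (\<Sum>j\<in>?X. move_coord i j h x)"
      using sum.permute[OF \<pi>, of "\<lambda>j. move_coord i j h x"] by (simp add: comp_def)
    finally show "(\<Sum>j\<in>?X. move_coord i j h (x \<circ> \<pi>)) = (\<Sum>j\<in>?X. move_coord i j h x)" .
  qed
  moreover have "card (J - {i}) < card J" using card_Diff1_less[OF J(4) i] .
  ultimately have "inner_on U h (\<lambda>x. \<Sum>j\<in>?X. move_coord i j h x) = 0"
    using J(1,3) unfolding orthogonal_to_juntas_def by blast
  then show ?thesis by (simp only: inner_on_sum_right)
qed

lemma inner_on_move_coord_nonpos:
  assumes h: "pure_junta n U J h" and i: "i \<in> J"
    and j: "j \<in> insert i ({1..n} - J)" "j' \<in> insert i ({1..n} - J)" "j \<noteq> j'"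
  shows "inner_on U (move_coord i j h) (move_coord i j' h) \<le> 0"
proof -
  note J = pure_juntaD[OF h]
  let ?Y = "{1..n} - J" and ?r = "inner_on U (move_coord i j h) (move_coord i j' h)"
  have hi: "move_coord i i h = h" by (simp add: move_coord_def fun_eq_iff)
  have "inner_on U h (move_coord i l h) = ?r" if "l \<in> ?Y" for l
    using inner_on_move_coord_eq[OF J(2,1) i, of i l j j'] that i j by (auto simp: hi)
  then have "(\<Sum>l\<in>?Y. inner_on U h (move_coord i l h)) = card ?Y * ?r" by simp
  moreover have "(\<Sum>l\<in>insert i ?Y. inner_on U h (move_coord i l h)) =
      sqnorm_on U h + (\<Sum>l\<in>?Y. inner_on U h (move_coord i l h))"
    using i by (simp add: hi)
  ultimately have "sqnorm_on U h + card ?Y * ?r = 0"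
    using inner_on_sum_move_coord_eq_0[OF h i] by simp
  then have "card ?Y * ?r \<le> 0"
    using sqnorm_on_nonneg[of U h] by linarith
  moreover have "0 < real (card ?Y)" using j by (auto simp: card_gt_0_iff)
  ultimately show ?thesis by (simp only: mult_le_0_iff) linarith
qed

lemma sqnorm_on_perm_avg_pure_junta_le:
  assumes h: "pure_junta n U J h" and S: "S \<subseteq> {1..n}" "i \<in> S" "i \<in> J"
  shows "sqnorm_on U (perm_avg S h) \<le> sqnorm_on U h / (1 + card (S - J))"
proof -
  define S' where "S' = insert i (S - J)"
  define c where "c = 1 / real (card S')"
  let ?u = "\<lambda>j. move_coord i j h" and ?mean = "fscale c (\<lambda>x. \<Sum>j\<in>S'. move_coord i j h x)"
  have finS': "finite S'" using S(1) finite_subset by (auto simp: S'_def)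
  have cardS': "card S' = 1 + card (S - J)" using S finite_subset[OF S(1)] by (simp add: S'_def)
  have swap: "Transposition.transpose i j permutes S" if "j \<in> S'" for j
    using that S by (intro permutes_swap_id) (auto simp: S'_def)
  have same: "perm_avg S (?u j) = perm_avg S h" if "j \<in> S'" for j
    using perm_avg_of_comp[OF swap[OF that]] by (simp add: move_coord_def[abs_def])
  have "perm_avg S ?mean = fscale c (\<lambda>x. \<Sum>j\<in>S'. perm_avg S h x)"
    by (simp only: perm_avg_scale perm_avg_sum same cong: sum.cong)
  also have "\<dots> = perm_avg S h"
    using cardS' by (simp add: fun_eq_iff c_def)
  finally have "sqnorm_on U (perm_avg S h) \<le> sqnorm_on U ?mean"
    using sqnorm_on_perm_avg_le[OF S(1), of ?mean] by simp
  also have "\<dots> = c\<^sup>2 * (\<Sum>j\<in>S'. \<Sum>l\<in>S'. inner_on U (?u j) (?u l))"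
    unfolding inner_on_scale_left inner_on_scale_right unfolding inner_on_sum_left unfolding inner_on_sum_right
    by (simp add: power2_eq_square)
  also have "\<dots> \<le> c\<^sup>2 * (\<Sum>j\<in>S'. sqnorm_on U h)"
  proof (intro mult_left_mono sum_mono)
    fix j assume j: "j \<in> S'"
    have "(\<Sum>l\<in>S'. inner_on U (?u j) (?u l)) = sqnorm_on U (?u j) + (\<Sum>l\<in>S' - {j}. inner_on U (?u j) (?u l))"
      using finS' j by (rule sum.remove)
    also have "sqnorm_on U (?u j) = sqnorm_on U h"
      unfolding move_coord_def by (rule inner_on_permute[OF permutes_subset[OF swap[OF j] S(1)]])
    also have "(\<Sum>l\<in>S' - {j}. inner_on U (?u j) (?u l)) \<le> 0"
      using j S by (intro sum_nonpos inner_on_move_coord_nonpos[OF h S(3)]) (auto simp: S'_def)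
    finally show "(\<Sum>l\<in>S'. inner_on U (?u j) (?u l)) \<le> sqnorm_on U h" by simp
  qed simp
  also have "\<dots> = sqnorm_on U h / card S'"
    using cardS' by (simp add: c_def power2_eq_square)
  finally show ?thesis by (simp add: cardS')
qed

end

lemma card_subsets_of_card_Int:
  assumes "B \<subseteq> {1..n}" "k \<le> s"
  shows "card {S\<in>subsets_of_card n s. card (S \<inter> B) = k} = (card B choose k) * ((n - card B) choose (s - k))"
proof -
  let ?T = "{T. T \<subseteq> B \<and> card T = k}" and ?R = "{R. R \<subseteq> {1..n} - B \<and> card R = s - k}"
  have fin: "finite B" using assms(1) finite_subset by blast
  have "bij_betw (\<lambda>S. (S \<inter> B, S - B)) {S\<in>subsets_of_card n s. card (S \<inter> B) = k} (?T \<times> ?R)"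
  proof (rule bij_betw_byWitness[where f' = "\<lambda>(T, R). T \<union> R"])
    show "(\<lambda>S. (S \<inter> B, S - B)) ` {S\<in>subsets_of_card n s. card (S \<inter> B) = k} \<subseteq> ?T \<times> ?R"
      using fin by (auto simp: subsets_of_card_def card_Diff_subset_Int)
    show "(\<lambda>(T, R). T \<union> R) ` (?T \<times> ?R) \<subseteq> {S\<in>subsets_of_card n s. card (S \<inter> B) = k}"
    proof safe
      fix T R assume T: "T \<subseteq> B" "k = card T" and R: "R \<subseteq> {1..n} - B" "card R = s - card T"
      have "finite T" "finite R" "T \<inter> R = {}" "(T \<union> R) \<inter> B = T"
        using T(1) R(1) fin finite_subset[OF R(1)] by (auto intro: finite_subset)
      then show "T \<union> R \<in> subsets_of_card n s" "card ((T \<union> R) \<inter> B) = card T"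
        using T R assms by (auto simp: subsets_of_card_def card_Un_disjoint)
    qed
  qed auto
  from bij_betw_same_card[OF this] show ?thesis
    using assms(1) fin by (simp add: card_cartesian_product n_subsets card_Diff_subset)
qed

lemma sum_subsets_of_card_inverse_Int_le:
  assumes "B \<subseteq> {1..n}"
  shows "(\<Sum>S\<in>subsets_of_card n s. 1 / (1 + real (card (S \<inter> B)))) \<le> (Suc n choose Suc s) / (1 + real (card B))"
proof -
  let ?b = "card B" and ?SS = "subsets_of_card n s"
  have b: "?b \<le> n" using card_mono[OF _ assms] by simp
  have "card (S \<inter> B) \<le> s" if "S \<in> ?SS" for S
    using that card_mono[of S "S \<inter> B"] finite_subset[of S "{1..n}"] by (auto simp: subsets_of_card_def)
  then have "(\<Sum>S\<in>?SS. 1 / (1 + real (card (S \<inter> B)))) =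
      (\<Sum>k\<le>s. \<Sum>S | S \<in> ?SS \<and> card (S \<inter> B) = k. 1 / (1 + real (card (S \<inter> B))))"
    by (intro sum.group[symmetric]) auto
  also have "\<dots> = (\<Sum>k\<le>s. (?b choose k) * ((n - ?b) choose (s - k)) / (1 + real k))"
    by (intro sum.cong refl) (simp add: card_subsets_of_card_Int[OF assms])
  also have "\<dots> = (\<Sum>k\<le>s. (Suc ?b choose Suc k) * ((n - ?b) choose (s - k))) / (1 + real ?b)"
    unfolding sum_divide_distrib of_nat_sum
  proof (intro sum.cong refl)
    fix k
    have "real (?b choose k) / (1 + real k) = real (Suc ?b choose Suc k) / (1 + real ?b)"
      using arg_cong[OF Suc_times_binomial_eq[of ?b k], of real] by (simp add: field_simps)
    then show "(?b choose k) * ((n - ?b) choose (s - k)) / (1 + real k) =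
        (Suc ?b choose Suc k) * ((n - ?b) choose (s - k)) / (1 + real ?b)"
      by (metis of_nat_mult times_divide_eq_left)
  qed
  also have "\<dots> \<le> (Suc n choose Suc s) / (1 + real ?b)"
  proof (intro divide_right_mono of_nat_mono)
    have "(\<Sum>k\<le>s. (Suc ?b choose Suc k) * ((n - ?b) choose (s - k))) \<le>
        (\<Sum>k\<le>Suc s. (Suc ?b choose k) * ((n - ?b) choose (Suc s - k)))"
      by (subst sum.atMost_Suc_shift) simp
    also have "\<dots> = (Suc ?b + (n - ?b)) choose Suc s" by (rule vandermonde)
    finally show "(\<Sum>k\<le>s. (Suc ?b choose Suc k) * ((n - ?b) choose (s - k))) \<le> Suc n choose Suc s"
      using b by simp
  qed simp
  finally show ?thesis .
qed

lemma (in perm_orbit) avg_sqnorm_perm_avg_pure_junta_le: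
  assumes h: "pure_junta n U J h" and s: "s \<le> n"
  shows "(\<Sum>S\<in>subsets_of_card n s. sqnorm_on U (perm_avg S h)) / (n choose s) \<le>
    (1 + real n) / (1 + real s) * (1 / (1 + real (card J)) + 1 / (1 + real (n - card J))) * sqnorm_on U h"
proof -
  note J = pure_juntaD[OF h]
  let ?SS = "subsets_of_card n s" and ?Jc = "{1..n} - J"
  define N where "N = sqnorm_on U h"
  have N: "0 \<le> N" by (simp add: N_def sqnorm_on_nonneg)
  have card_Jc: "card ?Jc = n - card J" using J by (simp add: card_Diff_subset)
  have point: "sqnorm_on U (perm_avg S h) \<le> N * (1 / (1 + real (card (S \<inter> J))) + 1 / (1 + real (card (S \<inter> ?Jc))))"
    if S: "S \<in> ?SS" for S
  proof (cases "S \<inter> J = {}")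
    case True
    have "sqnorm_on U (perm_avg S h) \<le> N"
      using sqnorm_on_perm_avg_le[of S h] S by (simp add: N_def subsets_of_card_def)
    also have "\<dots> \<le> N * (1 + 1 / (1 + real (card (S \<inter> ?Jc))))"
      using N by (simp add: algebra_simps)
    finally show ?thesis using True by simp
  next
    case False
    then obtain i where "i \<in> S" "i \<in> J" by blast
    then have "sqnorm_on U (perm_avg S h) \<le> N / (1 + real (card (S - J)))"
      using sqnorm_on_perm_avg_pure_junta_le[OF h, of S i] S by (simp add: N_def subsets_of_card_def)
    also have "S - J = S \<inter> ?Jc" using S by (auto simp: subsets_of_card_def)
    finally show ?thesis using N by (simp add: algebra_simps add_increasing)
  qed
  have "(\<Sum>S\<in>?SS. sqnorm_on U (perm_avg S h)) \<le>
      (\<Sum>S\<in>?SS. N * (1 / (1 + real (card (S \<inter> J))) + 1 / (1 + real (card (S \<inter> ?Jc)))))"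
    by (rule sum_mono[OF point])
  also have "\<dots> = N * ((\<Sum>S\<in>?SS. 1 / (1 + real (card (S \<inter> J)))) + (\<Sum>S\<in>?SS. 1 / (1 + real (card (S \<inter> ?Jc)))))"
    by (simp only: sum_distrib_left[symmetric] sum.distrib)
  also have "\<dots> \<le> N * ((Suc n choose Suc s) / (1 + real (card J)) + (Suc n choose Suc s) / (1 + real (card ?Jc)))"
    by (intro mult_left_mono add_mono sum_subsets_of_card_inverse_Int_le J(1) N) auto
  also have "real (Suc n choose Suc s) = (1 + real n) / (1 + real s) * (n choose s)"
    using arg_cong[OF Suc_times_binomial_eq[of n s], of real] by (simp add: field_simps)
  also have "N * (r * B / a + r * B / b) = r * (1 / a + 1 / b) * N * B" for r a b B :: real
    by (simp add: algebra_simps)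
  finally show ?thesis
    using s unfolding N_def[symmetric] card_Jc by (simp add: pos_divide_le_eq)
qed

section \<open>Equivariant Markov kernels\<close>

definition equivariant_markov ::
  "nat \<Rightarrow> (nat \<Rightarrow> 'a) set \<Rightarrow> (nat \<Rightarrow> 'b) set \<Rightarrow> ((nat \<Rightarrow> 'a) \<Rightarrow> (nat \<Rightarrow> 'b) \<Rightarrow> real) \<Rightarrow> bool" where
  "equivariant_markov n U V K \<longleftrightarrow>
     (\<forall>x\<in>U. \<forall>y\<in>V. 0 \<le> K x y) \<and> (\<forall>x\<in>U. (\<Sum>y\<in>V. K x y) = 1) \<and>
     (\<forall>y\<in>V. (\<Sum>x\<in>U. K x y) = card U / card V) \<and> equivariant n U V K"

lemma equivariant_markovD:
  assumes "equivariant_markov n U V K"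
  shows "\<And>x y. x \<in> U \<Longrightarrow> y \<in> V \<Longrightarrow> 0 \<le> K x y" "\<And>x. x \<in> U \<Longrightarrow> (\<Sum>y\<in>V. K x y) = 1"
    "\<And>y. y \<in> V \<Longrightarrow> (\<Sum>x\<in>U. K x y) = card U / card V" "equivariant n U V K"
  using assms unfolding equivariant_markov_def by blast+

definition kernel_comp :: "'b set \<Rightarrow> ('a \<Rightarrow> 'b \<Rightarrow> real) \<Rightarrow> ('b \<Rightarrow> 'c \<Rightarrow> real) \<Rightarrow> 'a \<Rightarrow> 'c \<Rightarrow> real" where
  "kernel_comp V K L x z = (\<Sum>y\<in>V. K x y * L y z)"

definition letter_ind :: "'i \<Rightarrow> 'a \<Rightarrow> ('i \<Rightarrow> 'a) \<Rightarrow> real" where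
  "letter_ind i c x = of_bool (x i = c)"

lemma letter_ind_bounds: "0 \<le> letter_ind i c x" "letter_ind i c x \<le> 1"
  by (simp_all add: letter_ind_def)

lemma kernel_op_comp: "kernel_op W (kernel_comp V K L) g = kernel_op V K (kernel_op W L g)"
  unfolding kernel_op_def kernel_comp_def sum_distrib_left sum_distrib_right
  by (subst sum.swap) (simp add: mult_ac)

lemma kernel_op_sum: "kernel_op V K (\<lambda>y. \<Sum>i\<in>I. f i y) x = (\<Sum>i\<in>I. kernel_op V K (f i) x)"
  unfolding kernel_op_def sum_distrib_left by (rule sum.swap)

lemma kernel_op_add: "kernel_op V K (f + g) = kernel_op V K f + kernel_op V K g"
  by (simp add: kernel_op_def fun_eq_iff algebra_simps sum.distrib)

lemma kernel_op_diff: "kernel_op V K (f - g) = kernel_op V K f - kernel_op V K g"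
  by (simp add: kernel_op_def fun_eq_iff algebra_simps sum_subtractf)

lemma kernel_op_scale: "kernel_op V K (fscale c f) = fscale c (kernel_op V K f)"
  by (simp add: kernel_op_def fun_eq_iff sum_distrib_left mult_ac)

lemma kernel_op_cong: "(\<And>y. y \<in> V \<Longrightarrow> f y = g y) \<Longrightarrow> kernel_op V K f = kernel_op V K g"
  by (simp add: kernel_op_def fun_eq_iff cong: sum.cong)

lemma kernel_op_mono:
  assumes "equivariant_markov n U V K" "x \<in> U" "\<And>y. y \<in> V \<Longrightarrow> f y \<le> g y"
  shows "kernel_op V K f x \<le> kernel_op V K g x"
  unfolding kernel_op_def using assms equivariant_markovD(1)[OF assms(1,2)] by (intro sum_mono mult_left_mono) auto

lemma kernel_op_bounds:
  assumes "equivariant_markov n U V K" "x \<in> U" "\<And>y. y \<in> V \<Longrightarrow> 0 \<le> f y" "\<And>y. y \<in> V \<Longrightarrow> f y \<le> 1"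
  shows "0 \<le> kernel_op V K f x" "kernel_op V K f x \<le> 1"
  using kernel_op_mono[OF assms(1,2), of "\<lambda>_. 0" f] kernel_op_mono[OF assms(1,2), of f "\<lambda>_. 1"]
    assms(3,4) equivariant_markovD(2)[OF assms(1,2)]
  by (simp_all add: kernel_op_def)

lemma sum_abs_kernel_op_le:
  assumes "equivariant_markov n U V K"
  shows "(\<Sum>x\<in>U. \<bar>kernel_op V K g x\<bar>) \<le> card U / card V * (\<Sum>y\<in>V. \<bar>g y\<bar>)"
proof -
  have "(\<Sum>x\<in>U. \<bar>kernel_op V K g x\<bar>) \<le> (\<Sum>x\<in>U. \<Sum>y\<in>V. K x y * \<bar>g y\<bar>)"
    unfolding kernel_op_def using equivariant_markovD(1)[OF assms]
    by (intro sum_mono order_trans[OF sum_abs]) (auto simp: abs_mult intro!: sum_mono)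
  also have "\<dots> = (\<Sum>y\<in>V. (\<Sum>x\<in>U. K x y) * \<bar>g y\<bar>)" unfolding sum_distrib_right by (rule sum.swap)
  also have "\<dots> = card U / card V * (\<Sum>y\<in>V. \<bar>g y\<bar>)"
    by (simp add: equivariant_markovD(3)[OF assms] sum_distrib_left cong: sum.cong)
  finally show ?thesis .
qed

lemma equivariant_kernel_comp:
  assumes "perm_orbit n \<Sigma> V" and K: "equivariant n U V K" and L: "equivariant n V W L"
  shows "equivariant n U W (kernel_comp V K L)"
  unfolding equivariant_def
proof (intro allI impI ballI)
  interpret V: perm_orbit n \<Sigma> V by fact
  fix \<pi> x z assume \<pi>: "\<pi> permutes {1..n}" and "x \<in> U" "z \<in> W"
  have "kernel_comp V K L (x \<circ> \<pi>) (z \<circ> \<pi>) = (\<Sum>y\<in>V. K (x \<circ> \<pi>) (y \<circ> \<pi>) * L (y \<circ> \<pi>) (z \<circ> \<pi>))"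
    unfolding kernel_comp_def using V.sum_permute[OF \<pi>, of "\<lambda>y. K (x \<circ> \<pi>) y * L y (z \<circ> \<pi>)"] by simp
  also have "\<dots> = kernel_comp V K L x z"
    unfolding kernel_comp_def
    using equivariantD[OF K \<pi> \<open>x \<in> U\<close>] equivariantD[OF L \<pi> _ \<open>z \<in> W\<close>] by simp
  finally show "kernel_comp V K L (x \<circ> \<pi>) (z \<circ> \<pi>) = kernel_comp V K L x z" .
qed

lemma equivariant_markov_comp:
  assumes V: "perm_orbit n \<Sigma> V" and K: "equivariant_markov n U V K" and L: "equivariant_markov n V W L"
  shows "equivariant_markov n U W (kernel_comp V K L)"
  unfolding equivariant_markov_def
proof (intro conjI ballI)
  show "equivariant n U W (kernel_comp V K L)"
    by (rule equivariant_kernel_comp[OF V equivariant_markovD(4)[OF K] equivariant_markovD(4)[OF L]])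
next
  fix x z assume "x \<in> U" "z \<in> W"
  then show "0 \<le> kernel_comp V K L x z"
    unfolding kernel_comp_def using equivariant_markovD(1)[OF K] equivariant_markovD(1)[OF L]
    by (intro sum_nonneg) auto
next
  fix x assume x: "x \<in> U"
  have "(\<Sum>z\<in>W. kernel_comp V K L x z) = (\<Sum>y\<in>V. K x y * (\<Sum>z\<in>W. L y z))"
    unfolding kernel_comp_def sum_distrib_left by (rule sum.swap)
  then show "(\<Sum>z\<in>W. kernel_comp V K L x z) = 1"
    using equivariant_markovD(2)[OF L] equivariant_markovD(2)[OF K x] by simp
next
  fix z assume z: "z \<in> W"
  have "(\<Sum>x\<in>U. kernel_comp V K L x z) = (\<Sum>y\<in>V. (\<Sum>x\<in>U. K x y) * L y z)"
    unfolding kernel_comp_def sum_distrib_right by (rule sum.swap)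
  also have "\<dots> = card U / card V * (\<Sum>y\<in>V. L y z)"
    using equivariant_markovD(3)[OF K] by (simp add: sum_distrib_left)
  also have "\<dots> = card U / card W"
    using equivariant_markovD(3)[OF L z] perm_orbit.card_pos[OF V] by simp
  finally show "(\<Sum>x\<in>U. kernel_comp V K L x z) = card U / card W" .
qed

lemma junta_kernel_op:
  assumes "perm_orbit n \<Sigma> V" and K: "equivariant n U V K" and g: "junta n V J g"
  shows "junta n U J (kernel_op V K g)"
  unfolding junta_def
proof (intro allI impI ballI)
  interpret V: perm_orbit n \<Sigma> V by fact
  fix \<pi> x assume \<pi>: "\<pi> permutes {1..n} - J" and x: "x \<in> U"
  have p: "\<pi> permutes {1..n}" using \<pi> by (rule permutes_subset) auto
  have "kernel_op V K g (x \<circ> \<pi>) = (\<Sum>y\<in>V. K (x \<circ> \<pi>) (y \<circ> \<pi>) * g (y \<circ> \<pi>))"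
    unfolding kernel_op_def using V.sum_permute[OF p, of "\<lambda>y. K (x \<circ> \<pi>) y * g y"] by simp
  also have "\<dots> = kernel_op V K g x"
    unfolding kernel_op_def using g \<pi> equivariantD[OF K p x] by (intro sum.cong) (auto simp: junta_def)
  finally show "kernel_op V K g (x \<circ> \<pi>) = kernel_op V K g x" .
qed

lemma (in perm_orbit) junta_letter_ind: "i \<in> {1..n} \<Longrightarrow> junta n U {i} (letter_ind i c)"
  by (rule juntaI) (auto simp: letter_ind_def agree_on_def)

lemma (in perm_orbit) sum_letter_ind_mult:
  assumes "x \<in> U" "i \<in> {1..n}"
  shows "(\<Sum>c\<in>\<Sigma>. p c * letter_ind i c x) = p (x i)"
proof -
  have "(\<Sum>c\<in>\<Sigma>. p c * letter_ind i c x) = (\<Sum>c\<in>\<Sigma>. if x i = c then p c else 0)"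
    by (intro sum.cong) (auto simp: letter_ind_def)
  then show ?thesis
    using letters[OF assms] finite_alphabet by (simp add: sum.delta')
qed

lemma (in perm_orbit) ex_letter_expansion:
  assumes u: "junta n U {i} u" and i: "i \<in> {1..n}" and bounds: "\<And>x. x \<in> U \<Longrightarrow> 0 \<le> u x \<and> u x \<le> 1"
  shows "\<exists>p. (\<forall>c. 0 \<le> p c \<and> p c \<le> 1) \<and> (\<forall>x\<in>U. u x = (\<Sum>c\<in>\<Sigma>. fscale (p c) (letter_ind i c) x))"
proof -
  define p where "p c = (if \<exists>x\<in>U. x i = c then u (SOME x. x \<in> U \<and> x i = c) else 0)" for c
  have p_letter: "p (x i) = u x" if "x \<in> U" for x
  proof -
    have ex: "\<exists>y. y \<in> U \<and> y i = x i" using that by blast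
    have "u (SOME y. y \<in> U \<and> y i = x i) = u x"
      using someI_ex[OF ex] that i by (intro junta_eq[OF u]) (auto simp: agree_on_def)
    then show ?thesis using ex by (auto simp: p_def)
  qed
  have "0 \<le> p c \<and> p c \<le> 1" for c
    using p_letter bounds by (cases "\<exists>x\<in>U. x i = c") (force, simp add: p_def)
  then show ?thesis
    using p_letter sum_letter_ind_mult[OF _ i] by (intro exI[of _ p]) simp
qed

definition letter_transition_ge ::
  "nat \<Rightarrow> (nat \<Rightarrow> 'a) set \<Rightarrow> (nat \<Rightarrow> 'b) set \<Rightarrow> ((nat \<Rightarrow> 'a) \<Rightarrow> (nat \<Rightarrow> 'b) \<Rightarrow> real) \<Rightarrow> real \<Rightarrow> 'a \<Rightarrow> 'b \<Rightarrow> bool" where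
  "letter_transition_ge n U V K \<beta> b c \<longleftrightarrow>
     (\<forall>i\<in>{1..n}. \<forall>x\<in>U. x i = b \<longrightarrow> \<beta> \<le> kernel_op V K (letter_ind i c) x)"

lemma letter_transition_ge_comp:
  assumes K: "equivariant_markov n U V K" and L: "equivariant_markov n V W L" and "0 \<le> \<beta>'"
    and "letter_transition_ge n U V K \<beta> a b" and "letter_transition_ge n V W L \<beta>' b c"
  shows "letter_transition_ge n U W (kernel_comp V K L) (\<beta> * \<beta>') a c"
  unfolding letter_transition_ge_def
proof (intro ballI impI)
  fix i x assume i: "i \<in> {1..n}" and x: "x \<in> U" "x i = a"
  have "0 \<le> kernel_op W L (letter_ind i c) y" if "y \<in> V" for y
    by (rule kernel_op_bounds(1)[OF L that letter_ind_bounds])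
  then have step: "fscale \<beta>' (letter_ind i b) y \<le> kernel_op W L (letter_ind i c) y" if "y \<in> V" for y
    using assms(5) i that by (auto simp: letter_transition_ge_def letter_ind_def)
  have "\<beta> * \<beta>' \<le> kernel_op V K (letter_ind i b) x * \<beta>'"
    using assms(4) i x \<open>0 \<le> \<beta>'\<close> by (intro mult_right_mono) (auto simp: letter_transition_ge_def)
  also have "\<dots> = kernel_op V K (fscale \<beta>' (letter_ind i b)) x"
    by (simp add: kernel_op_scale[THEN fun_cong])
  also have "\<dots> \<le> kernel_op V K (kernel_op W L (letter_ind i c)) x"
    by (rule kernel_op_mono[OF K x(1) step])
  finally show "\<beta> * \<beta>' \<le> kernel_op W (kernel_comp V K L) (letter_ind i c) x"
    by (simp only: kernel_op_comp)
qed

definition kernel_cov :: "'b set \<Rightarrow> ('a \<Rightarrow> 'b \<Rightarrow> real) \<Rightarrow> ('b \<Rightarrow> real) \<Rightarrow> ('b \<Rightarrow> real) \<Rightarrow> 'a \<Rightarrow> real" where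
  "kernel_cov V K f g x = kernel_op V K (f * g) x - kernel_op V K f x * kernel_op V K g x"

lemma kernel_cov_comp:
  "kernel_cov W (kernel_comp V K L) f g x =
     kernel_op V K (kernel_cov W L f g) x + kernel_cov V K (kernel_op W L f) (kernel_op W L g) x"
proof -
  have "kernel_cov W L f g = kernel_op W L (f * g) - kernel_op W L f * kernel_op W L g"
    by (simp add: fun_eq_iff kernel_cov_def)
  then have "kernel_op V K (kernel_cov W L f g) x =
      kernel_op V K (kernel_op W L (f * g)) x - kernel_op V K (kernel_op W L f * kernel_op W L g) x"
    by (simp only: kernel_op_diff minus_apply)
  then show ?thesis
    by (simp only: kernel_cov_def[of W "kernel_comp V K L"] kernel_cov_def[of V K] kernel_op_comp)
qed

lemma kernel_cov_sum:
  "kernel_cov V K (\<lambda>y. \<Sum>i\<in>I. f i y) (\<lambda>y. \<Sum>j\<in>J. g j y) x = (\<Sum>i\<in>I. \<Sum>j\<in>J. kernel_cov V K (f i) (g j) x)"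
proof -
  have "(\<lambda>y. \<Sum>i\<in>I. f i y) * (\<lambda>y. \<Sum>j\<in>J. g j y) = (\<lambda>y. \<Sum>i\<in>I. \<Sum>j\<in>J. (f i * g j) y)"
    by (simp add: fun_eq_iff sum_product)
  then show ?thesis
    by (simp only: kernel_cov_def kernel_op_sum sum_product sum_subtractf)
qed

lemma kernel_cov_scale: "kernel_cov V K (fscale a f) (fscale b g) x = a * b * kernel_cov V K f g x"
proof -
  have "fscale a f * fscale b g = fscale (a * b) (f * g)" by (simp add: fun_eq_iff)
  then show ?thesis
    by (simp only: kernel_cov_def kernel_op_scale fscale_apply) (simp add: algebra_simps)
qed

lemma kernel_cov_cong:
  assumes "\<And>y. y \<in> V \<Longrightarrow> f y = f' y" "\<And>y. y \<in> V \<Longrightarrow> g y = g' y"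
  shows "kernel_cov V K f g x = kernel_cov V K f' g' x"
proof -
  have "kernel_op V K (f * g) = kernel_op V K (f' * g')"
    using assms by (intro kernel_op_cong) simp
  then show ?thesis
    using kernel_op_cong[OF assms(1), where K = K] kernel_op_cong[OF assms(2), where K = K]
    by (simp only: kernel_cov_def)
qed

text \<open>How far a kernel is from acting independently on two distinct coordinates, in \<open>L\<^sup>1\<close>.\<close>

definition pair_dependence_le ::
  "nat \<Rightarrow> (nat \<Rightarrow> 'a) set \<Rightarrow> (nat \<Rightarrow> 'b) set \<Rightarrow> ((nat \<Rightarrow> 'a) \<Rightarrow> (nat \<Rightarrow> 'b) \<Rightarrow> real) \<Rightarrow> real \<Rightarrow> bool" where
  "pair_dependence_le n U V K \<eta> \<longleftrightarrow> (\<forall>i\<in>{1..n}. \<forall>j\<in>{1..n}. i \<noteq> j \<longrightarrow>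
     (\<forall>b c. (\<Sum>x\<in>U. \<bar>kernel_cov V K (letter_ind i b) (letter_ind j c) x\<bar>) \<le> \<eta> * card U))"

lemma pair_dependence_leD:
  "pair_dependence_le n U V K \<eta> \<Longrightarrow> i \<in> {1..n} \<Longrightarrow> j \<in> {1..n} \<Longrightarrow> i \<noteq> j \<Longrightarrow>
    (\<Sum>x\<in>U. \<bar>kernel_cov V K (letter_ind i b) (letter_ind j c) x\<bar>) \<le> \<eta> * card U"
  unfolding pair_dependence_le_def by blast

lemma (in perm_orbit) sum_abs_kernel_cov_juntas_le:
  assumes dep: "pair_dependence_le n W U K \<eta>" and ij: "i \<in> {1..n}" "j \<in> {1..n}" "i \<noteq> j"
    and u: "junta n U {i} u" "\<And>x. x \<in> U \<Longrightarrow> 0 \<le> u x \<and> u x \<le> 1"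
    and v: "junta n U {j} v" "\<And>x. x \<in> U \<Longrightarrow> 0 \<le> v x \<and> v x \<le> 1"
  shows "(\<Sum>a\<in>W. \<bar>kernel_cov U K u v a\<bar>) \<le> (real (card \<Sigma>))\<^sup>2 * \<eta> * card W"
proof -
  let ?cov = "\<lambda>b c. kernel_cov U K (letter_ind i b) (letter_ind j c)"
  obtain p where p: "\<And>c. 0 \<le> p c \<and> p c \<le> 1" "\<And>x. x \<in> U \<Longrightarrow> u x = (\<Sum>c\<in>\<Sigma>. fscale (p c) (letter_ind i c) x)"
    using ex_letter_expansion[OF u(1) ij(1) u(2)] by blast
  obtain q where q: "\<And>c. 0 \<le> q c \<and> q c \<le> 1" "\<And>x. x \<in> U \<Longrightarrow> v x = (\<Sum>c\<in>\<Sigma>. fscale (q c) (letter_ind j c) x)"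
    using ex_letter_expansion[OF v(1) ij(2) v(2)] by blast
  have coefficient: "\<bar>p b * q c\<bar> \<le> 1" for b c
    using p(1)[of b] q(1)[of c] by (simp add: mult_le_one)
  have "\<bar>kernel_cov U K u v a\<bar> \<le> (\<Sum>b\<in>\<Sigma>. \<Sum>c\<in>\<Sigma>. \<bar>?cov b c a\<bar>)" for a
  proof -
    have "kernel_cov U K u v a = (\<Sum>b\<in>\<Sigma>. \<Sum>c\<in>\<Sigma>. p b * q c * ?cov b c a)"
      by (subst kernel_cov_cong[OF p(2) q(2)]) (simp_all only: kernel_cov_sum kernel_cov_scale)
    also have "\<bar>\<dots>\<bar> \<le> (\<Sum>b\<in>\<Sigma>. \<Sum>c\<in>\<Sigma>. \<bar>p b * q c * ?cov b c a\<bar>)"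
      by (rule order_trans[OF sum_abs sum_mono[OF sum_abs]])
    also have "\<dots> \<le> (\<Sum>b\<in>\<Sigma>. \<Sum>c\<in>\<Sigma>. \<bar>?cov b c a\<bar>)"
      unfolding abs_mult[of "p _ * q _"] by (intro sum_mono mult_left_le_one_le coefficient abs_ge_zero)
    finally show ?thesis .
  qed
  then have "(\<Sum>a\<in>W. \<bar>kernel_cov U K u v a\<bar>) \<le> (\<Sum>a\<in>W. \<Sum>b\<in>\<Sigma>. \<Sum>c\<in>\<Sigma>. \<bar>?cov b c a\<bar>)"
    by (rule sum_mono)
  also have "\<dots> = (\<Sum>b\<in>\<Sigma>. \<Sum>c\<in>\<Sigma>. \<Sum>a\<in>W. \<bar>?cov b c a\<bar>)"
    by (subst sum.swap) (intro sum.cong refl sum.swap)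
  also have "\<dots> \<le> (\<Sum>b\<in>\<Sigma>. \<Sum>c\<in>\<Sigma>. \<eta> * card W)"
    by (intro sum_mono pair_dependence_leD[OF dep ij])
  finally show ?thesis by (simp add: power2_eq_square)
qed

lemma pair_dependence_le_comp:
  fixes U :: "(nat \<Rightarrow> 'a) set" and V :: "(nat \<Rightarrow> 'b) set" and W :: "(nat \<Rightarrow> 'c) set"
  assumes V: "perm_orbit n \<Sigma> V" and W: "perm_orbit n \<Sigma>' W"
    and K: "equivariant_markov n U V K" and L: "equivariant_markov n V W L"
    and depK: "pair_dependence_le n U V K \<eta>" and depL: "pair_dependence_le n V W L \<eta>'"
  shows "pair_dependence_le n U W (kernel_comp V K L) (\<eta>' + (real (card \<Sigma>))\<^sup>2 * \<eta>)"
  unfolding pair_dependence_le_def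
proof (intro ballI impI allI)
  interpret V: perm_orbit n \<Sigma> V by fact
  interpret W: perm_orbit n \<Sigma>' W by fact
  fix i j and b c :: 'c assume ij: "i \<in> {1..n}" "j \<in> {1..n}" "i \<noteq> j"
  let ?f = "letter_ind i b" and ?g = "letter_ind j c"
  have junta: "junta n V {k} (kernel_op W L (letter_ind k a))" if "k \<in> {1..n}" for k a
    by (rule junta_kernel_op[OF W equivariant_markovD(4)[OF L] W.junta_letter_ind[OF that]])
  have bounds: "0 \<le> kernel_op W L (letter_ind k a) y \<and> kernel_op W L (letter_ind k a) y \<le> 1" if "y \<in> V" for k a y
    by (intro conjI kernel_op_bounds[OF L that] letter_ind_bounds)
  have "(\<Sum>x\<in>U. \<bar>kernel_cov W (kernel_comp V K L) ?f ?g x\<bar>) \<le>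
      (\<Sum>x\<in>U. \<bar>kernel_op V K (kernel_cov W L ?f ?g) x\<bar>) +
      (\<Sum>x\<in>U. \<bar>kernel_cov V K (kernel_op W L ?f) (kernel_op W L ?g) x\<bar>)"
    unfolding kernel_cov_comp sum.distrib[symmetric] by (intro sum_mono abs_triangle_ineq)
  also have "\<dots> \<le> card U / card V * (\<Sum>y\<in>V. \<bar>kernel_cov W L ?f ?g y\<bar>) + (real (card \<Sigma>))\<^sup>2 * \<eta> * card U"
    by (rule add_mono, rule sum_abs_kernel_op_le[OF K]) (intro V.sum_abs_kernel_cov_juntas_le[OF depK ij] junta[OF ij(1)] junta[OF ij(2)] bounds)
  also have "\<dots> \<le> card U / card V * (\<eta>' * card V) + (real (card \<Sigma>))\<^sup>2 * \<eta> * card U"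
    by (intro add_right_mono mult_left_mono pair_dependence_leD[OF depL ij]) simp
  also have "\<dots> = (\<eta>' + (real (card \<Sigma>))\<^sup>2 * \<eta>) * card U"
    using V.card_pos by (simp add: field_simps)
  finally show "(\<Sum>x\<in>U. \<bar>kernel_cov W (kernel_comp V K L) ?f ?g x\<bar>) \<le> (\<eta>' + (real (card \<Sigma>))\<^sup>2 * \<eta>) * card U" .
qed

section \<open>Contraction on pure juntas of high degree\<close>

lemma card_positions_Int_eq_sum:
  "real (card (positions n x b \<inter> positions n y c)) = (\<Sum>i\<in>positions n x b. letter_ind i c y)"
proof -
  have "positions n x b \<inter> {i. y i = c} = positions n x b \<inter> positions n y c"
    by (auto simp: positions_def)
  then show ?thesis by (simp add: letter_ind_def)
qed

lemma kernel_Chebyshev: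
  assumes K: "equivariant_markov n U V K" and x: "x \<in> U" and t: "0 < t" "2 * t \<le> kernel_op V K N x"
  shows "t\<^sup>2 * kernel_op V K (\<lambda>y. of_bool (N y < t)) x \<le> kernel_cov V K N N x"
proof -
  define \<mu> where "\<mu> = kernel_op V K N x"
  have "t\<^sup>2 * kernel_op V K (\<lambda>y. of_bool (N y < t)) x = (\<Sum>y\<in>V. K x y * (t\<^sup>2 * of_bool (N y < t)))"
    by (simp add: kernel_op_def sum_distrib_left mult_ac)
  also have "\<dots> \<le> (\<Sum>y\<in>V. K x y * (N y - \<mu>)\<^sup>2)"
  proof (intro sum_mono mult_left_mono equivariant_markovD(1)[OF K x])
    fix y
    show "t\<^sup>2 * of_bool (N y < t) \<le> (N y - \<mu>)\<^sup>2"
    proof (cases "N y < t")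
      case True
      then have "t \<le> \<mu> - N y" using t(2) by (simp add: \<mu>_def)
      then have "t\<^sup>2 \<le> (\<mu> - N y)\<^sup>2" using t(1) by (intro power_mono) auto
      then show ?thesis using True by (simp add: power2_commute)
    qed simp
  qed
  also have "\<dots> = (\<Sum>y\<in>V. K x y * (N y * N y)) - 2 * \<mu> * (\<Sum>y\<in>V. K x y * N y) + \<mu>\<^sup>2 * (\<Sum>y\<in>V. K x y)"
    by (simp add: power2_eq_square algebra_simps sum.distrib sum_subtractf sum_distrib_left)
  also have "\<dots> = kernel_cov V K N N x"
    using equivariant_markovD(2)[OF K x]
    by (simp add: \<mu>_def kernel_cov_def kernel_op_def power2_eq_square algebra_simps)
  finally show ?thesis .
qed

lemma kernel_cov_card_positions_le:
  fixes b :: 'a and c :: 'b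
  assumes K: "equivariant_markov n U V K" and x: "x \<in> U"
  defines "N \<equiv> \<lambda>y. real (card (positions n x b \<inter> positions n y c))"
  shows "kernel_cov V K N N x \<le>
    n + (\<Sum>i\<in>{1..n}. \<Sum>j\<in>{1..n} - {i}. \<bar>kernel_cov V K (letter_ind i c) (letter_ind j c) x\<bar>)"
proof -
  let ?I = "positions n x b" and ?cov = "\<lambda>i j. kernel_cov V K (letter_ind i c) (letter_ind j c) x"
  have variance: "?cov i i \<le> 1" for i
  proof -
    have "kernel_op V K (letter_ind i c * letter_ind i c) x \<le> 1"
      by (rule kernel_op_bounds(2)[OF K x]) (auto simp: letter_ind_def)
    then show ?thesis
      using zero_le_square[of "kernel_op V K (letter_ind i c) x"] unfolding kernel_cov_def by linarith
  qed
  have "kernel_cov V K N N x = (\<Sum>i\<in>?I. \<Sum>j\<in>?I. ?cov i j)"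
    unfolding N_def card_positions_Int_eq_sum kernel_cov_sum ..
  also have "\<dots> = (\<Sum>i\<in>?I. ?cov i i + (\<Sum>j\<in>?I - {i}. ?cov i j))"
    by (intro sum.cong refl sum.remove) auto
  also have "\<dots> \<le> (\<Sum>i\<in>?I. 1 + (\<Sum>j\<in>{1..n} - {i}. \<bar>?cov i j\<bar>))"
  proof (intro sum_mono add_mono variance)
    fix i
    have "(\<Sum>j\<in>?I - {i}. ?cov i j) \<le> (\<Sum>j\<in>?I - {i}. \<bar>?cov i j\<bar>)" by (intro sum_mono) simp
    also have "\<dots> \<le> (\<Sum>j\<in>{1..n} - {i}. \<bar>?cov i j\<bar>)"
      using positions_subset[of n x b] by (intro sum_mono2) auto
    finally show "(\<Sum>j\<in>?I - {i}. ?cov i j) \<le> (\<Sum>j\<in>{1..n} - {i}. \<bar>?cov i j\<bar>)" .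
  qed
  also have "\<dots> \<le> (\<Sum>i\<in>{1..n}. 1 + (\<Sum>j\<in>{1..n} - {i}. \<bar>?cov i j\<bar>))"
    using positions_subset[of n x b] by (intro sum_mono2) (auto intro!: add_nonneg_nonneg sum_nonneg)
  finally show ?thesis by (simp add: sum.distrib)
qed

lemma few_common_positions_mass_le:
  fixes \<beta> \<kappa> \<eta> :: real
  assumes K: "equivariant_markov n U V K" and dep: "pair_dependence_le n U V K \<eta>"
    and trans: "letter_transition_ge n U V K \<beta> b c"
    and count: "\<And>x. x \<in> U \<Longrightarrow> \<kappa> * n \<le> card (positions n x b)"
    and pos: "0 < \<beta>" "0 < \<kappa>" "0 < n" "0 \<le> \<eta>"
  shows "(\<Sum>x\<in>U. kernel_op V K (\<lambda>y. of_bool (card (positions n x b \<inter> positions n y c) < \<beta> * \<kappa> * n / 2)) x)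
    \<le> 4 * (1 / n + \<eta>) / (\<beta> * \<kappa>)\<^sup>2 * card U"
proof -
  define t where "t = \<beta> * \<kappa> * n / 2"
  have t: "0 < t" using pos by (simp add: t_def)
  let ?N = "\<lambda>x y. real (card (positions n x b \<inter> positions n y c))"
  let ?cov = "\<lambda>i j x. kernel_cov V K (letter_ind i c) (letter_ind j c) x"
  have mean: "2 * t \<le> kernel_op V K (?N x) x" if x: "x \<in> U" for x
  proof -
    have "2 * t \<le> (\<Sum>i\<in>positions n x b. \<beta>)"
      using count[OF x] pos by (simp add: t_def mult.assoc mult.commute[of _ \<beta>])
    also have "\<dots> \<le> (\<Sum>i\<in>positions n x b. kernel_op V K (letter_ind i c) x)"
      using trans x by (intro sum_mono) (auto simp: letter_transition_ge_def positions_def)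
    finally show ?thesis unfolding card_positions_Int_eq_sum kernel_op_sum .
  qed
  have "t\<^sup>2 * (\<Sum>x\<in>U. kernel_op V K (\<lambda>y. of_bool (?N x y < t)) x) \<le>
      (\<Sum>x\<in>U. n + (\<Sum>i\<in>{1..n}. \<Sum>j\<in>{1..n} - {i}. \<bar>?cov i j x\<bar>))"
    unfolding sum_distrib_left
    by (intro sum_mono order_trans[OF kernel_Chebyshev[OF K _ t mean] kernel_cov_card_positions_le[OF K]])
  also have "\<dots> = real n * card U + (\<Sum>i\<in>{1..n}. \<Sum>j\<in>{1..n} - {i}. \<Sum>x\<in>U. \<bar>?cov i j x\<bar>)"
    unfolding sum.distrib by (subst sum.swap, subst sum.swap[of _ U]) simp
  also have "\<dots> \<le> real n * card U + (\<Sum>i\<in>{1..n}. \<Sum>j\<in>{1..n} - {i}. \<eta> * card U)"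
    by (intro add_left_mono sum_mono pair_dependence_leD[OF dep]) auto
  also have "\<dots> \<le> real n * card U + (\<Sum>i\<in>{1..n}. \<Sum>j\<in>{1..n}. \<eta> * card U)"
    using pos(4) by (intro add_left_mono sum_mono sum_mono2) auto
  also have "\<dots> = (real n + n\<^sup>2 * \<eta>) * card U" by (simp add: power2_eq_square algebra_simps)
  finally have "(\<Sum>x\<in>U. kernel_op V K (\<lambda>y. of_bool (?N x y < t)) x) \<le> (real n + n\<^sup>2 * \<eta>) * card U / t\<^sup>2"
    using t by (simp add: pos_le_divide_eq mult.commute)
  also have "\<dots> = 4 * (1 / n + \<eta>) / (\<beta> * \<kappa>)\<^sup>2 * card U"
    using pos by (simp add: t_def field_simps power2_eq_square)
  finally show ?thesis unfolding t_def .
qed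

lemma equivariant_swap: "equivariant n U V K \<Longrightarrow> equivariant n V U (\<lambda>y x. K x y)"
  by (simp add: equivariant_def)

lemma equivariant_row_sum_le:
  fixes \<gamma> :: real
  assumes "perm_orbit n \<Sigma> U" "perm_orbit n \<Sigma>' V" and k: "equivariant n U V k"
    and mass: "(\<Sum>x\<in>U. \<Sum>y\<in>V. k x y) \<le> \<gamma> * card U" and x: "x \<in> U"
  shows "(\<Sum>y\<in>V. k x y) \<le> \<gamma>"
proof -
  interpret U: perm_orbit n \<Sigma> U by fact
  interpret V: perm_orbit n \<Sigma>' V by fact
  have "(\<Sum>y\<in>V. k (x \<circ> \<pi>) y) = (\<Sum>y\<in>V. k x y)" if "\<pi> permutes {1..n}" "x \<in> U" for \<pi> x
    using V.sum_permute[OF that(1), of "k (x \<circ> \<pi>)"] equivariantD[OF k that] by simp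
  from U.invariant_mult_card[OF this x] have "(\<Sum>y\<in>V. k x y) * card U \<le> \<gamma> * card U"
    using mass by (simp only:)
  then show ?thesis using U.card_pos by simp
qed

text \<open>All rows of an equivariant kernel have the same sum, and likewise all columns;
  hence a small total mass already makes the operator norm small.\<close>

lemma (in perm_orbit) equivariant_form_le_mass:
  fixes \<gamma> :: real
  assumes nonneg: "\<And>x w. x \<in> U \<Longrightarrow> w \<in> U \<Longrightarrow> 0 \<le> k x w" and k: "equivariant n U U k"
    and mass: "(\<Sum>x\<in>U. \<Sum>w\<in>U. k x w) \<le> \<gamma> * card U"
  shows "inner_on U h (kernel_op U k h) \<le> \<gamma> * sqnorm_on U h"
proof -
  have orbit: "perm_orbit n \<Sigma> U" ..
  have rows: "(\<Sum>w\<in>U. k x w) \<le> \<gamma>" if "x \<in> U" for x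
    by (rule equivariant_row_sum_le[OF orbit orbit k mass that])
  have cols: "(\<Sum>x\<in>U. k x w) \<le> \<gamma>" if "w \<in> U" for w
    by (rule equivariant_row_sum_le[OF orbit orbit equivariant_swap[OF k] _ that]) (subst sum.swap, rule mass)
  have "inner_on U h (kernel_op U k h) \<le> (\<Sum>x\<in>U. \<Sum>w\<in>U. k x w * (h x)\<^sup>2 / 2 + k x w * (h w)\<^sup>2 / 2)"
    unfolding inner_on_kernel_op
  proof (intro sum_mono)
    fix x w assume "x \<in> U" "w \<in> U"
    then have "k x w * (h x * h w) \<le> k x w * (((h x)\<^sup>2 + (h w)\<^sup>2) / 2)"
      using nonneg sum_squares_bound[of "h x" "h w"] by (intro mult_left_mono) auto
    then show "k x w * h x * h w \<le> k x w * (h x)\<^sup>2 / 2 + k x w * (h w)\<^sup>2 / 2"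
      by (simp add: algebra_simps add_divide_distrib)
  qed
  also have "\<dots> = (\<Sum>x\<in>U. (\<Sum>w\<in>U. k x w) * (h x)\<^sup>2) / 2 + (\<Sum>w\<in>U. (\<Sum>x\<in>U. k x w) * (h w)\<^sup>2) / 2"
    unfolding sum.distrib sum_divide_distrib[symmetric] sum_distrib_right
    by (subst (2) sum.swap) simp
  also have "\<dots> \<le> (\<Sum>x\<in>U. \<gamma> * (h x)\<^sup>2) / 2 + (\<Sum>w\<in>U. \<gamma> * (h w)\<^sup>2) / 2"
    using rows cols by (intro add_mono divide_right_mono sum_mono mult_right_mono) auto
  also have "\<dots> = \<gamma> * sqnorm_on U h"
    by (simp add: inner_on_def power2_eq_square sum_distrib_left)
  finally show ?thesis .
qed

definition all_letters_within :: "nat \<Rightarrow> 'a set \<Rightarrow> nat \<Rightarrow> nat set \<Rightarrow> (nat \<Rightarrow> 'a) \<Rightarrow> bool" where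
  "all_letters_within n \<Sigma> s B w \<longleftrightarrow> (\<forall>c\<in>\<Sigma>. s \<le> card (B \<inter> positions n w c))"

lemma equivariant_restrict_all_letters_within:
  assumes "equivariant n U U K"
  shows "equivariant n U U (\<lambda>x w. K x w * of_bool (all_letters_within n \<Sigma> s (positions n x b) w))"
    and "equivariant n U U (\<lambda>x w. K x w * of_bool (\<not> all_letters_within n \<Sigma> s (positions n x b) w))"
  using assms by (simp_all add: equivariant_def all_letters_within_def card_positions_Int_comp del: comp_apply)

context perm_orbit
begin

lemma form_missing_letter_le:
  fixes \<beta> \<kappa> \<eta> :: real
  assumes K: "equivariant_markov n U U K" and dep: "pair_dependence_le n U U K \<eta>"
    and trans: "\<And>c. c \<in> \<Sigma> \<Longrightarrow> letter_transition_ge n U U K \<beta> b c"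
    and count: "\<And>x. x \<in> U \<Longrightarrow> \<kappa> * n \<le> card (positions n x b)"
    and pos: "0 < \<beta>" "0 < \<kappa>" "0 < n" "0 \<le> \<eta>" and s: "s \<le> \<beta> * \<kappa> * n / 2"
  shows "inner_on U h (kernel_op U (\<lambda>x w. K x w * of_bool (\<not> all_letters_within n \<Sigma> s (positions n x b) w)) h)
    \<le> card \<Sigma> * (4 * (1 / n + \<eta>) / (\<beta> * \<kappa>)\<^sup>2) * sqnorm_on U h"
proof (rule equivariant_form_le_mass)
  note K_nonneg = equivariant_markovD(1)[OF K]
  let ?missing = "\<lambda>x w. \<not> all_letters_within n \<Sigma> s (positions n x b) w"
  let ?few = "\<lambda>c x w. card (positions n x b \<inter> positions n w c) < \<beta> * \<kappa> * n / 2"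
  show "0 \<le> K x w * of_bool (?missing x w)" if "x \<in> U" "w \<in> U" for x w
    using K_nonneg[OF that] by simp
  show "equivariant n U U (\<lambda>x w. K x w * of_bool (?missing x w))"
    by (rule equivariant_restrict_all_letters_within(2)[OF equivariant_markovD(4)[OF K]])
  have "(\<Sum>x\<in>U. \<Sum>w\<in>U. K x w * of_bool (?missing x w)) \<le> (\<Sum>x\<in>U. \<Sum>w\<in>U. \<Sum>c\<in>\<Sigma>. K x w * of_bool (?few c x w))"
  proof (intro sum_mono)
    fix x w assume xw: "x \<in> U" "w \<in> U"
    have "(of_bool (?missing x w) :: real) \<le> (\<Sum>c\<in>\<Sigma>. of_bool (?few c x w))"
    proof (cases "?missing x w")
      case True
      then obtain c where "c \<in> \<Sigma>" "?few c x w"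
        using s by (force simp: all_letters_within_def)
      then show ?thesis
        using member_le_sum[of c \<Sigma> "\<lambda>c. of_bool (?few c x w) :: real"] finite_alphabet by simp
    qed (simp add: sum_nonneg)
    then show "K x w * of_bool (?missing x w) \<le> (\<Sum>c\<in>\<Sigma>. K x w * of_bool (?few c x w))"
      unfolding sum_distrib_left[symmetric] by (rule mult_left_mono[OF _ K_nonneg[OF xw]])
  qed
  also have "\<dots> = (\<Sum>c\<in>\<Sigma>. \<Sum>x\<in>U. kernel_op U K (\<lambda>w. of_bool (?few c x w)) x)"
    unfolding kernel_op_def by (subst sum.swap[of _ \<Sigma>], subst sum.swap[of _ \<Sigma>]) simp
  also have "\<dots> \<le> (\<Sum>c\<in>\<Sigma>. 4 * (1 / n + \<eta>) / (\<beta> * \<kappa>)\<^sup>2 * card U)"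
    by (intro sum_mono few_common_positions_mass_le[OF K dep trans count pos])
  finally show "(\<Sum>x\<in>U. \<Sum>w\<in>U. K x w * of_bool (?missing x w)) \<le>
      card \<Sigma> * (4 * (1 / n + \<eta>) / (\<beta> * \<kappa>)\<^sup>2) * card U" by simp
qed

lemma form_all_letters_within_square_le:
  assumes K: "equivariant_markov n U U K" and h: "pure_junta n U J h" and s: "s \<le> n"
  shows "(inner_on U h (kernel_op U (\<lambda>x w. K x w * of_bool (all_letters_within n \<Sigma> s (positions n x b) w)) h))\<^sup>2
    \<le> (1 + real n) / (1 + real s) * (1 / (1 + real (card J)) + 1 / (1 + real (n - card J))) * (sqnorm_on U h)\<^sup>2"
proof -
  let ?k = "\<lambda>x w. K x w * of_bool (all_letters_within n \<Sigma> s (positions n x b) w)"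
  note K_nonneg = equivariant_markovD(1)[OF K]
  have restrict_le: "(\<Sum>y\<in>U. a y * of_bool (P y)) \<le> (\<Sum>y\<in>U. a y)" if "\<And>y. y \<in> U \<Longrightarrow> 0 \<le> a y" for a :: "_ \<Rightarrow> real" and P
    using that by (intro sum_mono) auto
  have "(inner_on U h (kernel_op U ?k h))\<^sup>2 \<le>
      sqnorm_on U h * ((\<Sum>S\<in>subsets_of_card n s. sqnorm_on U (perm_avg S h)) / (n choose s))"
  proof (rule form_square_le_avg_sqnorm_perm_avg[OF _ _ _ _ _ s])
    show "equivariant n U U ?k"
      by (rule equivariant_restrict_all_letters_within(1)[OF equivariant_markovD(4)[OF K]])
    fix x w assume x: "x \<in> U" and w: "w \<in> U"
    show "0 \<le> ?k x w" using K_nonneg[OF x w] by simp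
    show "(\<Sum>w\<in>U. ?k x w) \<le> 1"
      unfolding equivariant_markovD(2)[OF K x, symmetric] by (intro restrict_le K_nonneg[OF x])
    show "(\<Sum>x\<in>U. ?k x w) \<le> 1"
      using restrict_le[of "\<lambda>x. K x w", OF K_nonneg[OF _ w]] equivariant_markovD(3)[OF K w] card_pos by simp
    show "s \<le> card (positions n x b \<inter> positions n w c)" if "?k x w \<noteq> 0" "c \<in> \<Sigma>" for c
      using that by (auto simp: all_letters_within_def)
  qed
  also have "\<dots> \<le> sqnorm_on U h * ((1 + real n) / (1 + real s) *
      (1 / (1 + real (card J)) + 1 / (1 + real (n - card J))) * sqnorm_on U h)"
    by (intro mult_left_mono avg_sqnorm_perm_avg_pure_junta_le[OF h s] sqnorm_on_nonneg)
  finally show ?thesis by (simp add: power2_eq_square mult_ac)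
qed

end

definition contraction_rate :: "nat \<Rightarrow> real \<Rightarrow> real \<Rightarrow> nat \<Rightarrow> real" where
  "contraction_rate m \<beta> \<kappa> d = m * (8 / d / (\<beta> * \<kappa>)\<^sup>2) + sqrt (8 / (\<beta> * \<kappa>\<^sup>2) / d)"

lemma contraction_rate_tendsto_0: "contraction_rate m \<beta> \<kappa> \<longlonglongrightarrow> 0"
proof -
  have null: "(\<lambda>d. c / real d) \<longlonglongrightarrow> 0" for c
    using tendsto_mult_right[OF lim_1_over_n, of c] by simp
  have "(\<lambda>d. sqrt (8 / (\<beta> * \<kappa>\<^sup>2) / real d)) \<longlonglongrightarrow> 0"
    using tendsto_real_sqrt[OF null] by (simp only: real_sqrt_zero)
  then show ?thesis
    unfolding contraction_rate_def[abs_def]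
    by (intro tendsto_add_zero tendsto_mult_right_zero tendsto_divide_zero null)
qed

lemma shuffle_factor_le:
  fixes \<beta> \<kappa> :: real and n s d e :: nat
  assumes pos: "0 < \<beta>" "0 < \<kappa>" "\<kappa> \<le> 1" and d: "1 \<le> d" "d \<le> e" and e: "e \<le> (1 - \<kappa>) * n"
    and s: "\<beta> * \<kappa> * n / 2 \<le> 1 + real s"
  shows "(1 + real n) / (1 + real s) * (1 / (1 + real e) + 1 / (1 + real (n - e))) \<le> 8 / (\<beta> * \<kappa>\<^sup>2) / d"
proof -
  have "(1 - \<kappa>) * n \<le> n" using pos by (simp add: algebra_simps)
  then have n: "0 < n" "e \<le> n" using e d by linarith+
  have \<kappa>d: "\<kappa> * d \<le> real d" "0 < \<kappa> * d" using pos d by (auto simp: mult_left_le_one_le)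
  have "1 / (1 + real e) \<le> 1 / (\<kappa> * d)"
    using d \<kappa>d by (intro divide_left_mono) auto
  moreover have "1 / (1 + real (n - e)) \<le> 1 / (\<kappa> * d)"
  proof (rule divide_left_mono)
    have "\<kappa> * d \<le> \<kappa> * n" using n(2) d pos by simp
    also have "\<dots> \<le> n - e" using e n(2) by (simp add: of_nat_diff algebra_simps)
    finally show "\<kappa> * d \<le> 1 + real (n - e)" using n(2) by (simp add: of_nat_diff)
  qed (use \<kappa>d in auto)
  moreover have "(1 + real n) / (1 + real s) \<le> (2 * real n) / (\<beta> * \<kappa> * n / 2)"
    using s pos n by (intro frac_le) auto
  ultimately have "(1 + real n) / (1 + real s) * (1 / (1 + real e) + 1 / (1 + real (n - e))) \<le>
      (2 * real n) / (\<beta> * \<kappa> * n / 2) * (1 / (\<kappa> * d) + 1 / (\<kappa> * d))"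
    using pos by (intro mult_mono add_mono) auto
  also have "\<dots> = 8 / (\<beta> * \<kappa>\<^sup>2) / d"
    using n d pos by (simp add: field_simps power2_eq_square)
  finally show ?thesis .
qed

lemma (in perm_orbit) full_support_kernel_contraction:
  fixes \<beta> \<kappa> \<eta> :: real and d :: nat
  assumes K: "equivariant_markov n U U K" and dep: "pair_dependence_le n U U K \<eta>"
    and trans: "\<And>c. c \<in> \<Sigma> \<Longrightarrow> letter_transition_ge n U U K \<beta> b c"
    and count: "\<And>x. x \<in> U \<Longrightarrow> \<kappa> * n \<le> card (positions n x b)"
    and pos: "0 < \<beta>" "\<beta> \<le> 1" "0 < \<kappa>" "\<kappa> \<le> 1" and \<eta>: "0 \<le> \<eta>" "\<eta> \<le> 1 / d"
    and h: "pure_junta n U J h" and d: "1 \<le> d" "d \<le> card J" and J: "card J \<le> (1 - \<kappa>) * n"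
  shows "inner_on U h (kernel_op U K h) \<le> contraction_rate (card \<Sigma>) \<beta> \<kappa> d * sqnorm_on U h"
proof -
  define s where "s = nat \<lfloor>\<beta> * \<kappa> * n / 2\<rfloor>"
  let ?within = "\<lambda>x w. all_letters_within n \<Sigma> s (positions n x b) w"
  let ?\<theta> = "(1 + real n) / (1 + real s) * (1 / (1 + real (card J)) + 1 / (1 + real (n - card J)))"
  have "card J \<le> n" using card_mono[OF _ pure_juntaD(1)[OF h]] by simp
  then have n: "0 < n" "d \<le> n" using d by auto
  have \<beta>\<kappa>: "0 < \<beta> * \<kappa>" "\<beta> * \<kappa> \<le> 1" using pos by (auto simp: mult_le_one)
  have "real s = \<lfloor>\<beta> * \<kappa> * n / 2\<rfloor>" using \<beta>\<kappa> by (simp add: s_def)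
  then have s: "s \<le> \<beta> * \<kappa> * n / 2" "\<beta> * \<kappa> * n / 2 \<le> 1 + real s"
    using floor_correct[of "\<beta> * \<kappa> * n / 2"] by linarith+
  have "real s \<le> 1 * real n / 2"
    using s(1) mult_right_mono[OF \<beta>\<kappa>(2), of "real n"] by simp
  then have s_le_n: "s \<le> n" by simp
  have \<theta>_le: "?\<theta> \<le> 8 / (\<beta> * \<kappa>\<^sup>2) / d"
    by (rule shuffle_factor_le[OF pos(1,3,4) d J s(2)])
  have "inner_on U h (kernel_op U (\<lambda>x w. K x w * of_bool (?within x w)) h) \<le> sqrt (?\<theta> * (sqnorm_on U h)\<^sup>2)"
    by (rule real_le_rsqrt[OF form_all_letters_within_square_le[OF K h s_le_n]])
  also have "\<dots> = sqrt ?\<theta> * sqnorm_on U h"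
    by (simp only: real_sqrt_mult real_sqrt_abs abs_of_nonneg[OF sqnorm_on_nonneg])
  also have "\<dots> \<le> sqrt (8 / (\<beta> * \<kappa>\<^sup>2) / d) * sqnorm_on U h"
    by (intro mult_right_mono real_sqrt_le_mono \<theta>_le sqnorm_on_nonneg)
  finally have within: "inner_on U h (kernel_op U (\<lambda>x w. K x w * of_bool (?within x w)) h) \<le> \<dots>" .
  have "1 / n + \<eta> \<le> 2 / d"
    using n d \<eta>(2) frac_le[of 1 1 d n] by simp
  then have "card \<Sigma> * (4 * (1 / n + \<eta>) / (\<beta> * \<kappa>)\<^sup>2) \<le> card \<Sigma> * (8 / d / (\<beta> * \<kappa>)\<^sup>2)"
    by (intro mult_left_mono divide_right_mono) auto
  then have missing: "inner_on U h (kernel_op U (\<lambda>x w. K x w * of_bool (\<not> ?within x w)) h) \<le>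
      card \<Sigma> * (8 / d / (\<beta> * \<kappa>)\<^sup>2) * sqnorm_on U h"
    by (intro order_trans[OF form_missing_letter_le[OF K dep trans count pos(1,3) n(1) \<eta>(1) s(1)]]
        mult_right_mono sqnorm_on_nonneg)
  have "inner_on U h (kernel_op U K h) = inner_on U h (kernel_op U (\<lambda>x w. K x w * of_bool (?within x w)) h) +
      inner_on U h (kernel_op U (\<lambda>x w. K x w * of_bool (\<not> ?within x w)) h)"
    unfolding inner_on_kernel_op sum.distrib[symmetric] by (intro sum.cong refl) auto
  then show ?thesis
    using within missing by (simp add: contraction_rate_def algebra_simps)
qed

primrec kernel_power :: "'a set \<Rightarrow> ('a \<Rightarrow> 'a \<Rightarrow> real) \<Rightarrow> nat \<Rightarrow> 'a \<Rightarrow> 'a \<Rightarrow> real" where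
  "kernel_power U M 0 = M"
| "kernel_power U M (Suc r) = kernel_comp U (kernel_power U M r) (kernel_power U M r)"

lemma kernel_op_kernel_power: "kernel_op U (kernel_power U M r) = kernel_op U M ^^ (2 ^ r)"
proof (induction r)
  case (Suc r)
  have "kernel_op U (kernel_power U M (Suc r)) g = (kernel_op U M ^^ (2 ^ Suc r)) g" for g
    by (simp only: kernel_power.simps kernel_op_comp Suc.IH power_Suc mult_2 funpow_add comp_apply)
  then show ?case by (rule ext)
qed simp

lemma selfadjoint_on_kernel_op:
  assumes "\<And>x w. x \<in> U \<Longrightarrow> w \<in> U \<Longrightarrow> K x w = K w x"
  shows "selfadjoint_on U (kernel_op U K)"
  unfolding selfadjoint_on_def
proof (intro allI)
  fix f g
  have "inner_on U f (kernel_op U K g) = (\<Sum>w\<in>U. \<Sum>x\<in>U. K x w * f x * g w)"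
    unfolding inner_on_kernel_op by (rule sum.swap)
  also have "\<dots> = inner_on U g (kernel_op U K f)"
    unfolding inner_on_kernel_op using assms by (intro sum.cong refl) simp
  finally show "inner_on U f (kernel_op U K g) = inner_on U (kernel_op U K f) g"
    by (simp only: inner_on_commute)
qed

context perm_orbit
begin

lemma equivariant_markov_kernel_power:
  assumes "equivariant_markov n U U M"
  shows "equivariant_markov n U U (kernel_power U M r)"
  by (induction r) (auto intro: assms equivariant_markov_comp[OF perm_orbit_axioms])

lemma pair_dependence_le_kernel_power:
  assumes M: "equivariant_markov n U U M" and "pair_dependence_le n U U M \<eta>"
  shows "pair_dependence_le n U U (kernel_power U M r) ((1 + (real (card \<Sigma>))\<^sup>2) ^ r * \<eta>)"
proof (induction r)
  case (Suc r)
  note M_r = equivariant_markov_kernel_power[OF M, of r]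
  from pair_dependence_le_comp[OF perm_orbit_axioms perm_orbit_axioms M_r M_r Suc Suc]
  show ?case by (simp add: algebra_simps)
qed (simp add: assms)

lemma letter_transition_ge_kernel_power:
  assumes M: "equivariant_markov n U U M" and "0 \<le> \<beta>"
    and "\<And>b c. (b, c) \<in> R \<Longrightarrow> letter_transition_ge n U U M \<beta> b c" and "(b, c) \<in> R ^^ (2 ^ r)"
  shows "letter_transition_ge n U U (kernel_power U M r) (\<beta> ^ 2 ^ r) b c"
  using assms(4)
proof (induction r arbitrary: b c)
  case (Suc r)
  have "R ^^ (2 ^ Suc r) = R ^^ (2 ^ r) O R ^^ (2 ^ r)" by (simp add: mult_2 relpow_add)
  then obtain a where "(b, a) \<in> R ^^ (2 ^ r)" "(a, c) \<in> R ^^ (2 ^ r)" using Suc.prems by blast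
  note M_r = equivariant_markov_kernel_power[OF M, of r]
  from letter_transition_ge_comp[OF M_r M_r _ Suc.IH[OF \<open>(b, a) \<in> _\<close>] Suc.IH[OF \<open>(a, c) \<in> _\<close>]]
  show ?case using \<open>0 \<le> \<beta>\<close> by (simp add: mult_2 power_add)
qed (simp add: assms(3))

text \<open>Only after \<open>2\<^sup>r\<close> steps does \<open>M\<close> connect \<open>b\<close> to every letter; since \<open>M\<close> is self-adjoint, the resulting
  bound on its powers transfers back to a single step.\<close>

lemma chain_contraction:
  fixes \<beta> \<kappa> \<eta> \<delta> :: real and d :: nat
  assumes M: "equivariant_markov n U U M" and sym: "\<And>x w. x \<in> U \<Longrightarrow> w \<in> U \<Longrightarrow> M x w = M w x"
    and dep: "pair_dependence_le n U U M \<eta>"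
    and trans: "\<And>a c. (a, c) \<in> R \<Longrightarrow> letter_transition_ge n U U M \<beta> a c"
    and reach: "\<And>c. c \<in> \<Sigma> \<Longrightarrow> (b, c) \<in> R ^^ (2 ^ r)"
    and count: "\<And>x. x \<in> U \<Longrightarrow> \<kappa> * n \<le> card (positions n x b)"
    and pos: "0 < \<beta>" "\<beta> \<le> 1" "0 < \<kappa>" "\<kappa> \<le> 1"
    and \<eta>: "0 \<le> \<eta>" "(1 + (real (card \<Sigma>))\<^sup>2) ^ r * \<eta> \<le> 1 / d"
    and h: "pure_junta n U J h" and d: "1 \<le> d" "d \<le> card J" and J: "card J \<le> (1 - \<kappa>) * n"
    and \<delta>: "0 \<le> \<delta>" "contraction_rate (card \<Sigma>) (\<beta> ^ 2 ^ r) \<kappa> d \<le> \<delta> ^ 2 ^ r"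
    and nonneg: "0 \<le> inner_on U h (kernel_op U M h)"
  shows "inner_on U h (kernel_op U M h) \<le> \<delta> * sqnorm_on U h"
proof (rule form_le_of_power_form_le[OF selfadjoint_on_kernel_op[OF sym] nonneg \<delta>(1)])
  have "inner_on U h (kernel_op U (kernel_power U M r) h) \<le>
      contraction_rate (card \<Sigma>) (\<beta> ^ 2 ^ r) \<kappa> d * sqnorm_on U h"
  proof (rule full_support_kernel_contraction[OF _ _ _ count _ _ pos(3,4) _ \<eta>(2) h d J])
    show "letter_transition_ge n U U (kernel_power U M r) (\<beta> ^ 2 ^ r) b c" if "c \<in> \<Sigma>" for c
      by (rule letter_transition_ge_kernel_power[OF M less_imp_le[OF pos(1)] trans reach[OF that]])
  qed (use pos \<eta>(1) in \<open>auto simp: power_le_one intro: equivariant_markov_kernel_power[OF M]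
      pair_dependence_le_kernel_power[OF M dep]\<close>)
  also have "\<dots> \<le> \<delta> ^ 2 ^ r * sqnorm_on U h"
    by (intro mult_right_mono \<delta>(2) sqnorm_on_nonneg)
  finally show "inner_on U h ((kernel_op U M ^^ (2 ^ r)) h) \<le> \<delta> ^ 2 ^ r * sqnorm_on U h"
    by (simp only: kernel_op_kernel_power)
qed

end

section \<open>From pure juntas to all functions\<close>

abbreviation kernel_adjoint :: "'a set \<Rightarrow> ('a \<Rightarrow> 'b \<Rightarrow> real) \<Rightarrow> ('a \<Rightarrow> real) \<Rightarrow> 'b \<Rightarrow> real" where
  "kernel_adjoint U D \<equiv> kernel_op U (\<lambda>y x. D x y)"

lemma inner_on_kernel_adjoint: "inner_on V (kernel_adjoint U D f) g = inner_on U f (kernel_op V D g)"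
  unfolding inner_on_commute[of V] inner_on_kernel_op by (subst sum.swap) (simp add: mult_ac)

definition gram_op :: "'a set \<Rightarrow> 'b set \<Rightarrow> ('a \<Rightarrow> 'b \<Rightarrow> real) \<Rightarrow> ('a \<Rightarrow> real) \<Rightarrow> 'a \<Rightarrow> real" where
  "gram_op U V D f = kernel_op V D (kernel_adjoint U D f)"

lemma inner_on_gram_op: "inner_on U f (gram_op U V D g) = inner_on V (kernel_adjoint U D f) (kernel_adjoint U D g)"
  by (simp only: gram_op_def inner_on_kernel_adjoint)

lemma selfadjoint_on_gram_op: "selfadjoint_on U (gram_op U V D)"
  unfolding selfadjoint_on_def inner_on_commute[of U "gram_op U V D _"] inner_on_gram_op
  by (simp add: inner_on_commute)

lemma gram_op_power_add: "(gram_op U V D ^^ r) (f + g) = (gram_op U V D ^^ r) f + (gram_op U V D ^^ r) g"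
  by (induction r) (simp_all only: funpow.simps id_apply comp_apply gram_op_def kernel_op_add)

lemma gram_op_power_zero: "(gram_op U V D ^^ r) 0 = 0"
proof (induction r)
  case (Suc r)
  have "gram_op U V D 0 = 0" by (simp add: gram_op_def kernel_op_def fun_eq_iff)
  with Suc show ?case by (simp only: funpow.simps comp_apply)
qed simp

definition power_growth_le :: "'a set \<Rightarrow> (('a \<Rightarrow> real) \<Rightarrow> 'a \<Rightarrow> real) \<Rightarrow> real \<Rightarrow> ('a \<Rightarrow> real) \<Rightarrow> bool" where
  "power_growth_le U Q l f \<longleftrightarrow> (\<exists>c\<ge>0. \<forall>r. sqnorm_on U ((Q ^^ r) f) \<le> c * (l ^ r)\<^sup>2)"

lemma power_growth_le_zero: "power_growth_le U (gram_op U V D) l 0"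
  unfolding power_growth_le_def gram_op_power_zero by (intro exI[of _ 0]) (simp add: inner_on_def)

lemma power_growth_le_add:
  assumes "power_growth_le U (gram_op U V D) l f" "power_growth_le U (gram_op U V D) l g"
  shows "power_growth_le U (gram_op U V D) l (f + g)"
proof -
  let ?Q = "gram_op U V D"
  obtain b c where b: "0 \<le> b" "\<And>r. sqnorm_on U ((?Q ^^ r) f) \<le> b * (l ^ r)\<^sup>2"
    and c: "0 \<le> c" "\<And>r. sqnorm_on U ((?Q ^^ r) g) \<le> c * (l ^ r)\<^sup>2"
    using assms unfolding power_growth_le_def by blast
  have "sqnorm_on U ((?Q ^^ r) (f + g)) \<le> (2 * b + 2 * c) * (l ^ r)\<^sup>2" for r
    unfolding gram_op_power_add
    using sqnorm_on_add_le[of U "(?Q ^^ r) f" "(?Q ^^ r) g"] b(2)[of r] c(2)[of r] by (simp add: algebra_simps)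
  then show ?thesis
    using b(1) c(1) unfolding power_growth_le_def by (intro exI[of _ "2 * b + 2 * c"]) auto
qed

lemma power_growth_le_cong:
  assumes "\<And>x. x \<in> U \<Longrightarrow> f x = g x" "power_growth_le U (gram_op U V D) l f"
  shows "power_growth_le U (gram_op U V D) l g"
proof -
  have "gram_op U V D f = gram_op U V D g"
    unfolding gram_op_def by (simp only: kernel_op_cong[OF assms(1)])
  then have "sqnorm_on U ((gram_op U V D ^^ r) f) = sqnorm_on U ((gram_op U V D ^^ r) g)" for r
    using assms(1) by (cases r) (auto simp only: funpow_Suc_right comp_apply funpow_0 intro: inner_on_cong)
  then show ?thesis using assms(2) by (simp only: power_growth_le_def)
qed

lemma power_growth_le_of_step:
  assumes Q: "\<And>f. W f \<Longrightarrow> W (Q f)" "\<And>f. W f \<Longrightarrow> sqnorm_on U (Q f) \<le> l\<^sup>2 * sqnorm_on U f" and h: "W h"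
  shows "power_growth_le U Q l h"
proof -
  have invariant: "W ((Q ^^ r) h)" for r by (induction r) (auto simp: h Q(1))
  have "sqnorm_on U ((Q ^^ r) h) \<le> sqnorm_on U h * (l ^ r)\<^sup>2" for r
  proof (induction r)
    case (Suc r)
    have "sqnorm_on U ((Q ^^ Suc r) h) \<le> l\<^sup>2 * sqnorm_on U ((Q ^^ r) h)"
      using Q(2)[OF invariant] by simp
    also have "\<dots> \<le> l\<^sup>2 * (sqnorm_on U h * (l ^ r)\<^sup>2)" using Suc by (intro mult_left_mono) auto
    finally show ?case by (simp add: power_mult_distrib mult_ac)
  qed simp
  then show ?thesis unfolding power_growth_le_def using sqnorm_on_nonneg by blast
qed

lemma le_of_square_le_mult: "x * x \<le> k * x \<Longrightarrow> 0 \<le> k \<Longrightarrow> 0 \<le> x \<Longrightarrow> x \<le> (k :: real)"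
  by (cases "x = 0") (auto simp: mult_le_cancel_right)

lemma sqnorm_on_gram_op_le:
  assumes "0 \<le> l"
    and f: "sqnorm_on V (kernel_adjoint U D f) \<le> l * sqnorm_on U f"
    and Qf: "sqnorm_on V (kernel_adjoint U D (gram_op U V D f)) \<le> l * sqnorm_on U (gram_op U V D f)"
  shows "sqnorm_on U (gram_op U V D f) \<le> l\<^sup>2 * sqnorm_on U f"
proof -
  let ?Qf = "gram_op U V D f"
  have "(sqnorm_on U ?Qf)\<^sup>2 \<le> sqnorm_on V (kernel_adjoint U D ?Qf) * sqnorm_on V (kernel_adjoint U D f)"
    using inner_on_Cauchy_Schwarz[of V "kernel_adjoint U D ?Qf"] by (simp only: inner_on_gram_op)
  also have "\<dots> \<le> (l * sqnorm_on U ?Qf) * (l * sqnorm_on U f)"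
    using assms by (intro mult_mono f Qf) (auto simp: sqnorm_on_nonneg)
  finally have "sqnorm_on U ?Qf * sqnorm_on U ?Qf \<le> (l\<^sup>2 * sqnorm_on U f) * sqnorm_on U ?Qf"
    by (simp add: power2_eq_square mult_ac)
  then show ?thesis
    by (rule le_of_square_le_mult) (simp_all add: sqnorm_on_nonneg)
qed

context perm_orbit
begin

lemma pure_junta_gram_op:
  assumes V: "perm_orbit n \<Sigma>' V" and D: "equivariant n U V D" and h: "pure_junta n U J h"
  shows "pure_junta n U J (gram_op U V D h)"
proof -
  have junta: "junta n U I (gram_op U V D f)" if "junta n U I f" for I f
    unfolding gram_op_def
    by (rule junta_kernel_op[OF V D junta_kernel_op[OF perm_orbit_axioms equivariant_swap[OF D] that]])
  have "orthogonal_to_juntas n U (card J) (gram_op U V D h)"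
    unfolding orthogonal_to_juntas_def
  proof (intro allI impI)
    fix I v assume "I \<subseteq> {1..n}" "card I < card J" "junta n U I v"
    then have "inner_on U h (gram_op U V D v) = 0"
      using junta[of I v] pure_juntaD(3)[OF h] by (simp add: orthogonal_to_juntas_def)
    then show "inner_on U (gram_op U V D h) v = 0"
      using selfadjoint_on_gram_op[of U V D] by (simp add: selfadjoint_on_def)
  qed
  then show ?thesis
    using pure_juntaD(1)[OF h] junta[OF pure_juntaD(2)[OF h]] by (simp add: pure_junta_def)
qed

lemma additive_closure_of_juntas:
  assumes cong: "\<And>f g. (\<And>x. x \<in> U \<Longrightarrow> f x = g x) \<Longrightarrow> P f \<Longrightarrow> P g"
    and zero: "P 0" and add: "\<And>f g. P f \<Longrightarrow> P g \<Longrightarrow> P (f + g)"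
    and junta: "\<And>J h. J \<subseteq> {1..n} \<Longrightarrow> card J \<le> e \<Longrightarrow> junta n U J h \<Longrightarrow> P h"
    and determined: "\<And>x. x \<in> U \<Longrightarrow> \<exists>J\<subseteq>{1..n}. card J \<le> e \<and> (\<forall>y\<in>U. agree_on J y x \<longrightarrow> y = x)"
  shows "P f"
proof -
  have "P (\<lambda>x. \<Sum>a\<in>S. f a * of_bool (x = a))" if "finite S" "S \<subseteq> U" for S
    using that
  proof (induction S rule: finite_induct)
    case empty
    then show ?case using zero by (simp add: zero_fun_def)
  next
    case (insert a S)
    then obtain J where J: "J \<subseteq> {1..n}" "card J \<le> e" "\<forall>y\<in>U. agree_on J y a \<longrightarrow> y = a"
      using determined[of a] by auto
    have "junta n U J (\<lambda>x. f a * of_bool (x = a))"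
      using J(3) by (intro juntaI[OF J(1)]) (auto simp: agree_on_def of_bool_def)
    then have "P (\<lambda>x. f a * of_bool (x = a))" by (rule junta[OF J(1,2)])
    then have "P ((\<lambda>x. f a * of_bool (x = a)) + (\<lambda>x. \<Sum>a\<in>S. f a * of_bool (x = a)))"
      using insert.prems by (intro add insert.IH) blast+
    then show ?case
      unfolding plus_fun_def sum.insert[OF insert.hyps] .
  qed
  from this[OF finite_orbit order_refl] show ?thesis
    by (rule cong[rotated]) (use finite_orbit in \<open>simp add: Int_insert_right\<close>)
qed

lemma sqnorm_on_kernel_adjoint_le_of_pure_juntas:
  assumes V: "perm_orbit n \<Sigma>' V" and D: "equivariant n U V D" and l: "0 < l"
    and pure: "\<And>J h. card J \<le> e \<Longrightarrow> pure_junta n U J h \<Longrightarrow>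
      sqnorm_on V (kernel_adjoint U D h) \<le> l * sqnorm_on U h"
    and determined: "\<And>x. x \<in> U \<Longrightarrow> \<exists>J\<subseteq>{1..n}. card J \<le> e \<and> (\<forall>y\<in>U. agree_on J y x \<longrightarrow> y = x)"
  shows "sqnorm_on V (kernel_adjoint U D f) \<le> l * sqnorm_on U f"
proof -
  let ?growth = "power_growth_le U (gram_op U V D) l"
  have growth_pure: "?growth h" if J: "card J \<le> e" and h: "pure_junta n U J h" for J h
  proof (rule power_growth_le_of_step[of "pure_junta n U J"])
    fix u assume u: "pure_junta n U J u"
    show Qu: "pure_junta n U J (gram_op U V D u)" by (rule pure_junta_gram_op[OF V D u])
    show "sqnorm_on U (gram_op U V D u) \<le> l\<^sup>2 * sqnorm_on U u"
      using l by (intro sqnorm_on_gram_op_le pure[OF J u] pure[OF J Qu]) simp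
  qed (rule h)
  have growth_junta: "?growth h" if "J \<subseteq> {1..n}" "card J \<le> e" "junta n U J h" for J h
    by (rule pure_junta_induct[OF power_growth_le_cong power_growth_le_zero power_growth_le_add growth_pure that])
  have "?growth f"
    by (rule additive_closure_of_juntas[OF power_growth_le_cong power_growth_le_zero power_growth_le_add
          growth_junta determined])
  then obtain c where "\<And>r. sqnorm_on U ((gram_op U V D ^^ r) f) \<le> c * (l ^ r)\<^sup>2"
    unfolding power_growth_le_def by blast
  from form_le_of_power_growth[OF selfadjoint_on_gram_op l this] show ?thesis
    by (simp only: inner_on_gram_op)
qed

end

section \<open>Symmetric laws on pairs of orbits\<close>

lemma symmetric_swap:
  assumes "symmetric n \<mu>"
  shows "symmetric n (map_pmf prod.swap \<mu>)"
  unfolding symmetric_def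
proof (intro allI impI)
  fix \<pi> assume "\<pi> permutes {1..n}"
  then have "map_pmf prod.swap (map_pmf (\<lambda>(x, y). (x \<circ> \<pi>, y \<circ> \<pi>)) \<mu>) = map_pmf prod.swap \<mu>"
    using assms by (simp add: symmetric_def)
  then show "map_pmf (\<lambda>(x, y). (x \<circ> \<pi>, y \<circ> \<pi>)) (map_pmf prod.swap \<mu>) = map_pmf prod.swap \<mu>"
    by (simp add: map_pmf_comp split_def prod.swap_def)
qed

lemma pmf_map_swap: "pmf (map_pmf prod.swap \<mu>) (y, x) = pmf \<mu> (x, y)"
  using pmf_map_inj'[of prod.swap \<mu> "(x, y)"] by (simp add: prod.swap_def)

definition transition :: "'a set \<Rightarrow> ('a \<times> 'b) pmf \<Rightarrow> 'a \<Rightarrow> 'b \<Rightarrow> real" where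
  "transition U \<mu> x y = card U * pmf \<mu> (x, y)"

locale symmetric_law = U: perm_orbit n \<Sigma> U + V: perm_orbit n \<Sigma>' V
  for n :: nat and \<Sigma> :: "'a set" and \<Sigma>' :: "'b set" and U :: "(nat \<Rightarrow> 'a) set" and V :: "(nat \<Rightarrow> 'b) set" +
  fixes \<mu> :: "((nat \<Rightarrow> 'a) \<times> (nat \<Rightarrow> 'b)) pmf"
  assumes supp: "set_pmf \<mu> \<subseteq> U \<times> V" and sym: "symmetric n \<mu>"

lemma (in symmetric_law) symmetric_law_swap: "symmetric_law n \<Sigma>' \<Sigma> V U (map_pmf prod.swap \<mu>)"
  using supp sym by unfold_locales (auto intro: symmetric_swap)

lemma (in symmetric_law) expectation_eq_sum:
  "measure_pmf.expectation \<mu> (\<lambda>(x, y). F x y) = (\<Sum>x\<in>U. \<Sum>y\<in>V. pmf \<mu> (x, y) * F x y)"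
proof -
  have "measure_pmf.expectation \<mu> (\<lambda>(x, y). F x y) = (\<Sum>w\<in>U \<times> V. (\<lambda>(x, y). F x y) w * pmf \<mu> w)"
    using U.finite_orbit V.finite_orbit supp by (intro integral_measure_pmf_real) auto
  then show ?thesis by (simp add: sum.cartesian_product split_def mult.commute)
qed

lemma (in symmetric_law) equivariant_pmf: "equivariant n U V (\<lambda>x y. pmf \<mu> (x, y))"
  unfolding equivariant_def
proof (intro allI impI ballI)
  fix \<pi> x y assume \<pi>: "\<pi> permutes {1..n}"
  have "inj (\<lambda>(x :: nat \<Rightarrow> 'a, y :: nat \<Rightarrow> 'b). (x \<circ> \<pi>, y \<circ> \<pi>))"
    by (rule inj_on_inverseI[where g = "\<lambda>(x, y). (x \<circ> inv \<pi>, y \<circ> inv \<pi>)"])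
      (auto simp: comp_assoc permutes_inv_o[OF \<pi>])
  from pmf_map_inj'[OF this, of \<mu> "(x, y)"] show "pmf \<mu> (x \<circ> \<pi>, y \<circ> \<pi>) = pmf \<mu> (x, y)"
    using sym \<pi> by (simp add: symmetric_def)
qed

lemma (in symmetric_law) sum_pmf_right:
  assumes "x \<in> U"
  shows "(\<Sum>y\<in>V. pmf \<mu> (x, y)) = 1 / card U"
proof -
  have "(\<Sum>y\<in>V. pmf \<mu> (x \<circ> \<pi>, y)) = (\<Sum>y\<in>V. pmf \<mu> (x, y))" if "\<pi> permutes {1..n}" "x \<in> U" for \<pi> x
    using V.sum_permute[OF that(1), of "\<lambda>y. pmf \<mu> (x \<circ> \<pi>, y)"] equivariantD[OF equivariant_pmf that] by simp
  then have "(\<Sum>y\<in>V. pmf \<mu> (x, y)) * card U = (\<Sum>x\<in>U. \<Sum>y\<in>V. pmf \<mu> (x, y))"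
    using assms by (rule U.invariant_mult_card)
  also have "\<dots> = 1"
    using expectation_eq_sum[of "\<lambda>_ _. 1"] by (simp add: split_def)
  finally show ?thesis using U.card_pos by (simp add: eq_divide_eq)
qed

lemma (in symmetric_law) sum_pmf_left:
  assumes "y \<in> V"
  shows "(\<Sum>x\<in>U. pmf \<mu> (x, y)) = 1 / card V"
  using symmetric_law.sum_pmf_right[OF symmetric_law_swap assms] by (simp add: pmf_map_swap)

lemma (in symmetric_law) equivariant_markov_transition: "equivariant_markov n U V (transition U \<mu>)"
  unfolding equivariant_markov_def
proof (intro conjI ballI)
  show "equivariant n U V (transition U \<mu>)"
    using equivariant_pmf by (simp add: equivariant_def transition_def)
  show "(\<Sum>y\<in>V. transition U \<mu> x y) = 1" if "x \<in> U" for x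
    using sum_pmf_right[OF that] U.card_pos by (simp add: transition_def sum_distrib_left[symmetric])
  show "(\<Sum>x\<in>U. transition U \<mu> x y) = card U / card V" if "y \<in> V" for y
    using sum_pmf_left[OF that] by (simp add: transition_def sum_distrib_left[symmetric])
qed (simp add: transition_def)

definition letters_at :: "nat \<Rightarrow> (nat \<Rightarrow> 'a) \<times> (nat \<Rightarrow> 'b) \<Rightarrow> 'a \<times> 'b" where
  "letters_at i w = (fst w i, snd w i)"

context symmetric_law
begin

lemma prob_fst_snd_eq_inner:
  "measure_pmf.prob \<mu> {w. P (fst w) \<and> R (snd w)} =
     inner_on U (\<lambda>x. of_bool (P x)) (kernel_op V (transition U \<mu>) (\<lambda>y. of_bool (R y))) / card U"
proof -
  have "measure_pmf.prob \<mu> {w. P (fst w) \<and> R (snd w)} =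
      measure_pmf.expectation \<mu> (indicator {w. P (fst w) \<and> R (snd w)})" by simp
  also have "(indicator {w. P (fst w) \<and> R (snd w)} :: _ \<Rightarrow> real) = (\<lambda>(x, y). of_bool (P x) * of_bool (R y))"
    by (auto simp: fun_eq_iff indicator_def)
  finally show ?thesis
    using U.card_pos
    by (simp add: expectation_eq_sum inner_on_kernel_op transition_def sum_divide_distrib mult.assoc)
qed

lemma prob_fst_eq_card: "measure_pmf.prob \<mu> {w. P (fst w)} = card {x\<in>U. P x} / card U"
proof -
  have "measure_pmf.prob \<mu> {w. P (fst w)} =
      inner_on U (\<lambda>x. of_bool (P x)) (kernel_op V (transition U \<mu>) (\<lambda>y. 1)) / card U"
    using prob_fst_snd_eq_inner[of P "\<lambda>_. True"] by simp
  also have "inner_on U (\<lambda>x. of_bool (P x)) (kernel_op V (transition U \<mu>) (\<lambda>y. 1)) = (\<Sum>x\<in>U. of_bool (P x))"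
    using equivariant_markovD(2)[OF equivariant_markov_transition] by (simp add: inner_on_def kernel_op_def)
  finally show ?thesis
    using U.finite_orbit by (simp add: Int_def)
qed

lemma prob_agree_on_conj:
  assumes J: "J \<subseteq> {1..n}" and R: "junta n V J (\<lambda>y. of_bool (R y))" and x: "x \<in> U"
  shows "measure_pmf.prob \<mu> {w. agree_on J (fst w) x \<and> R (snd w)} =
    measure_pmf.prob \<mu> {w. agree_on J (fst w) x} * kernel_op V (transition U \<mu>) (\<lambda>y. of_bool (R y)) x"
proof -
  let ?k = "kernel_op V (transition U \<mu>) (\<lambda>y. of_bool (R y))"
  have k: "junta n U J ?k"
    by (rule junta_kernel_op[OF V.perm_orbit_axioms equivariant_markovD(4)[OF equivariant_markov_transition] R])
  have "inner_on U (\<lambda>x'. of_bool (agree_on J x' x)) ?k = (\<Sum>x'\<in>U. of_bool (agree_on J x' x) * ?k x)"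
    unfolding inner_on_def using U.junta_eq[OF k J _ x] by (intro sum.cong) auto
  also have "\<dots> = card {x'\<in>U. agree_on J x' x} * ?k x"
    using U.finite_orbit by (simp add: sum_distrib_right[symmetric] Int_def)
  finally show ?thesis
    by (simp add: prob_fst_snd_eq_inner[of "\<lambda>x'. agree_on J x' x"] prob_fst_eq_card[of "\<lambda>x'. agree_on J x' x"])
qed

lemma letter_transition_ge_transition:
  assumes "\<And>i. i \<in> {1..n} \<Longrightarrow> \<alpha> \<le> measure_pmf.prob \<mu> {w. letters_at i w = (b, c)}"
  shows "letter_transition_ge n U V (transition U \<mu>) \<alpha> b c"
  unfolding letter_transition_ge_def
proof (intro ballI impI)
  fix i x assume i: "i \<in> {1..n}" and x: "x \<in> U" "x i = b"
  let ?k = "kernel_op V (transition U \<mu>) (letter_ind i c)"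
  have letter: "letter_ind i c = (\<lambda>y. of_bool (y i = c))" for c :: 'b
    by (simp add: letter_ind_def fun_eq_iff)
  have "\<alpha> \<le> measure_pmf.prob \<mu> {w. agree_on {i} (fst w) x \<and> snd w i = c}"
    using assms[OF i] x(2) by (simp add: letters_at_def agree_on_def)
  also have "\<dots> = measure_pmf.prob \<mu> {w. agree_on {i} (fst w) x} * ?k x"
    using i x(1) V.junta_letter_ind[OF i, of c] prob_agree_on_conj[of "{i}" "\<lambda>y. y i = c" x]
    by (simp add: letter)
  also have "\<dots> \<le> ?k x"
    by (intro mult_left_le_one_le kernel_op_bounds(1)[OF equivariant_markov_transition x(1)] letter_ind_bounds) auto
  finally show "\<alpha> \<le> ?k x" .
qed

end

definition pairwise_near_product ::
  "nat \<Rightarrow> ((nat \<Rightarrow> 'a) \<times> (nat \<Rightarrow> 'b)) pmf \<Rightarrow> ('a \<times> 'b) pmf \<Rightarrow> real \<Rightarrow> bool" where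
  "pairwise_near_product n \<mu> q \<tau> \<longleftrightarrow>
     (\<forall>i\<in>{1..n}. \<forall>A. \<bar>measure_pmf.prob \<mu> {w. letters_at i w \<in> A} - measure_pmf.prob q A\<bar> \<le> \<tau>) \<and>
     (\<forall>i\<in>{1..n}. \<forall>j\<in>{1..n}. i \<noteq> j \<longrightarrow> (\<forall>A B.
        \<bar>measure_pmf.prob \<mu> {w. letters_at i w \<in> A \<and> letters_at j w \<in> B} -
          measure_pmf.prob q A * measure_pmf.prob q B\<bar> \<le> \<tau>))"

lemma pairwise_near_productD:
  assumes "pairwise_near_product n \<mu> q \<tau>" "i \<in> {1..n}"
  shows "\<bar>measure_pmf.prob \<mu> {w. letters_at i w \<in> A} - measure_pmf.prob q A\<bar> \<le> \<tau>"
    and "j \<in> {1..n} \<Longrightarrow> i \<noteq> j \<Longrightarrow> \<bar>measure_pmf.prob \<mu> {w. letters_at i w \<in> A \<and> letters_at j w \<in> B} -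
      measure_pmf.prob q A * measure_pmf.prob q B\<bar> \<le> \<tau>"
  using assms unfolding pairwise_near_product_def by blast+

lemma abs_mult_diff_le:
  fixes a b c d :: real
  assumes "\<bar>a - c\<bar> \<le> t" "\<bar>b - d\<bar> \<le> t" "0 \<le> b" "b \<le> 1" "0 \<le> c" "c \<le> 1"
  shows "\<bar>a * b - c * d\<bar> \<le> 2 * t"
proof -
  have "a * b - c * d = (a - c) * b + c * (b - d)" by (simp add: algebra_simps)
  moreover have "\<bar>(a - c) * b\<bar> \<le> t * 1" unfolding abs_mult using assms by (intro mult_mono) auto
  moreover have "\<bar>c * (b - d)\<bar> \<le> 1 * t" unfolding abs_mult using assms by (intro mult_mono) auto
  ultimately show ?thesis by linarith
qed

lemma abs_conditional_covariance_le:
  fixes P p p' u v w a b c d \<tau> :: real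
  assumes joint: "\<bar>P * w - a * b\<bar> \<le> \<tau>" "\<bar>P - c * d\<bar> \<le> \<tau>"
    and single: "\<bar>p * u - a\<bar> \<le> \<tau>" "\<bar>p' * v - b\<bar> \<le> \<tau>" "\<bar>p - c\<bar> \<le> \<tau>" "\<bar>p' - d\<bar> \<le> \<tau>"
    and range: "{u, v, p, p', a, c} \<subseteq> {0..1}"
  shows "\<bar>P * (w - u * v)\<bar> \<le> 6 * \<tau>"
proof -
  have "\<bar>(p * u) * (p' * v) - a * b\<bar> \<le> 2 * \<tau>"
    using single range by (intro abs_mult_diff_le) (auto simp: mult_le_one)
  moreover have "\<bar>(p * p' - P) * (u * v)\<bar> \<le> 3 * \<tau>"
  proof -
    have "\<bar>p * p' - c * d\<bar> \<le> 2 * \<tau>" using single range by (intro abs_mult_diff_le) auto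
    then have "\<bar>p * p' - P\<bar> \<le> 3 * \<tau>" using joint(2) by linarith
    moreover have "\<bar>u * v\<bar> \<le> 1" using range by (simp add: mult_le_one)
    ultimately show ?thesis
      unfolding abs_mult[of "p * p' - P"] using mult_mono[of _ "3 * \<tau>" _ 1] by fastforce
  qed
  moreover have "P * (w - u * v) = (P * w - a * b) - ((p * u) * (p' * v) - a * b) + (p * p' - P) * (u * v)"
    by (simp add: algebra_simps)
  ultimately show ?thesis using joint(1) by linarith
qed

lemma (in perm_orbit) junta_mono: "junta n U I h \<Longrightarrow> I \<subseteq> J \<Longrightarrow> junta n U J h"
  unfolding junta_def using permutes_subset by (metis Diff_mono subset_refl)

context symmetric_law
begin

lemma junta_kernel_cov_transition:
  assumes "junta n V J f" "junta n V J g"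
  shows "junta n U J (kernel_cov V (transition U \<mu>) f g)"
proof -
  have "junta n V J (f * g)" using assms by (simp add: junta_def)
  note kernel = junta_kernel_op[OF V.perm_orbit_axioms equivariant_markovD(4)[OF equivariant_markov_transition]]
  from kernel[OF \<open>junta n V J (f * g)\<close>] kernel[OF assms(1)] kernel[OF assms(2)] show ?thesis
    by (simp add: junta_def kernel_cov_def)
qed

lemma prob_agree_on_mult_kernel_letter_ind:
  assumes i: "i \<in> {1..n}" and x: "x \<in> U"
  shows "measure_pmf.prob \<mu> {w. agree_on {i} (fst w) x} * kernel_op V (transition U \<mu>) (letter_ind i b) x =
    measure_pmf.prob \<mu> {w. letters_at i w \<in> {(x i, b)}}"
proof -
  have letter: "letter_ind i b = (\<lambda>y. of_bool (y i = b))"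
    by (simp add: letter_ind_def fun_eq_iff)
  have "junta n V {i} (\<lambda>y. of_bool (y i = b))"
    using V.junta_letter_ind[OF i, of b] by (simp only: letter)
  from prob_agree_on_conj[OF _ this x] i show ?thesis
    by (simp add: letter letters_at_def agree_on_def)
qed

lemma prob_agree_on_mult_kernel_letter_ind_pair:
  assumes ij: "i \<in> {1..n}" "j \<in> {1..n}" and x: "x \<in> U"
  shows "measure_pmf.prob \<mu> {w. agree_on {i, j} (fst w) x} *
      kernel_op V (transition U \<mu>) (letter_ind i b * letter_ind j c) x =
    measure_pmf.prob \<mu> {w. letters_at i w \<in> {(x i, b)} \<and> letters_at j w \<in> {(x j, c)}}"
proof -
  have letters: "letter_ind i b * letter_ind j c = (\<lambda>y. of_bool (y i = b \<and> y j = c))"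
    by (simp add: letter_ind_def fun_eq_iff)
  have "junta n V {i, j} (\<lambda>y. of_bool (y i = b \<and> y j = c))"
    using ij by (intro V.juntaI) (auto simp: agree_on_def)
  from prob_agree_on_conj[OF _ this x] ij show ?thesis
    unfolding letters by (simp add: letters_at_def agree_on_def conj_ac)
qed

lemma card_agree_on_mult_kernel_cov_transition_le:
  fixes \<tau> :: real
  assumes near: "pairwise_near_product n \<mu> q \<tau>" and ij: "i \<in> {1..n}" "j \<in> {1..n}" "i \<noteq> j" and x: "x \<in> U"
  shows "card {x'\<in>U. agree_on {i, j} x' x} * \<bar>kernel_cov V (transition U \<mu>) (letter_ind i b) (letter_ind j c) x\<bar>
    \<le> 6 * \<tau> * card U"
proof -
  let ?K = "kernel_op V (transition U \<mu>)" and ?prob = "measure_pmf.prob \<mu>" and ?q = "measure_pmf.prob q"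
  let ?agree = "\<lambda>J. ?prob {w. agree_on J (fst w) x}"
  note near_single = pairwise_near_productD(1)[OF near] and near_pair = pairwise_near_productD(2)[OF near ij]
    and K_single = prob_agree_on_mult_kernel_letter_ind[OF _ x]
  have agree_single: "?agree {k} = ?prob {w. letters_at k w \<in> {x k} \<times> UNIV}" for k
    by (simp add: letters_at_def agree_on_def)
  have agree_pair: "?agree {i, j} = ?prob {w. letters_at i w \<in> {x i} \<times> UNIV \<and> letters_at j w \<in> {x j} \<times> UNIV}"
    by (simp add: letters_at_def agree_on_def)
  have K_range: "?K (letter_ind k a) x \<in> {0..1}" for k a
    unfolding atLeastAtMost_iff
    by (intro conjI kernel_op_bounds[OF equivariant_markov_transition x] letter_ind_bounds)
  have "\<bar>?agree {i, j} * (?K (letter_ind i b * letter_ind j c) x - ?K (letter_ind i b) x * ?K (letter_ind j c) x)\<bar> \<le> 6 * \<tau>"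
  proof (rule abs_conditional_covariance_le)
    show "\<bar>?agree {i, j} * ?K (letter_ind i b * letter_ind j c) x - ?q {(x i, b)} * ?q {(x j, c)}\<bar> \<le> \<tau>"
      unfolding prob_agree_on_mult_kernel_letter_ind_pair[OF ij(1,2) x] by (rule near_pair)
    show "\<bar>?agree {i, j} - ?q ({x i} \<times> UNIV) * ?q ({x j} \<times> UNIV)\<bar> \<le> \<tau>"
      unfolding agree_pair by (rule near_pair)
    show "\<bar>?agree {i} * ?K (letter_ind i b) x - ?q {(x i, b)}\<bar> \<le> \<tau>"
      unfolding K_single[OF ij(1)] by (rule near_single[OF ij(1)])
    show "\<bar>?agree {j} * ?K (letter_ind j c) x - ?q {(x j, c)}\<bar> \<le> \<tau>"
      unfolding K_single[OF ij(2)] by (rule near_single[OF ij(2)])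
    show "\<bar>?agree {i} - ?q ({x i} \<times> UNIV)\<bar> \<le> \<tau>"
      unfolding agree_single by (rule near_single[OF ij(1)])
    show "\<bar>?agree {j} - ?q ({x j} \<times> UNIV)\<bar> \<le> \<tau>"
      unfolding agree_single by (rule near_single[OF ij(2)])
  qed (use K_range in auto)
  then have "?agree {i, j} * \<bar>kernel_cov V (transition U \<mu>) (letter_ind i b) (letter_ind j c) x\<bar> \<le> 6 * \<tau>"
    by (simp add: kernel_cov_def abs_mult)
  then show ?thesis
    using U.card_pos by (simp add: prob_fst_eq_card[of "\<lambda>x'. agree_on {i, j} x' x"] pos_divide_le_eq)
qed

lemma pair_dependence_le_transition:
  assumes near: "pairwise_near_product n \<mu> q \<tau>"
  shows "pair_dependence_le n U V (transition U \<mu>) (6 * (real (card \<Sigma>))\<^sup>2 * \<tau>)"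
  unfolding pair_dependence_le_def
proof (intro ballI impI allI)
  fix i j b c assume ij: "i \<in> {1..n}" "j \<in> {1..n}" "i \<noteq> j"
  let ?cov = "kernel_cov V (transition U \<mu>) (letter_ind i b) (letter_ind j c)"
  have cov: "junta n U {i, j} ?cov"
    using V.junta_mono[OF V.junta_letter_ind[OF ij(1)]] V.junta_mono[OF V.junta_letter_ind[OF ij(2)]]
    by (intro junta_kernel_cov_transition) auto
  have "0 \<le> \<tau>" using pairwise_near_productD(1)[OF near ij(1)] abs_ge_zero order_trans by blast
  have letter_class: "(\<Sum>x | x \<in> U \<and> (x i, x j) = p. \<bar>?cov x\<bar>) \<le> 6 * \<tau> * card U" for p
  proof (cases "\<exists>x\<in>U. (x i, x j) = p")
    case True
    then obtain x where x: "x \<in> U" "(x i, x j) = p" by blast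
    have "{y. y \<in> U \<and> (y i, y j) = p} = {y\<in>U. agree_on {i, j} y x}"
      using x(2) by (auto simp: agree_on_def)
    moreover have "?cov y = ?cov x" if "y \<in> {y\<in>U. agree_on {i, j} y x}" for y
      using U.junta_eq[OF cov _ _ x(1)] that ij by simp
    ultimately show ?thesis
      using card_agree_on_mult_kernel_cov_transition_le[OF near ij x(1)] by simp
  next
    case False
    then have "{x. x \<in> U \<and> (x i, x j) = p} = {}" by blast
    then show ?thesis using \<open>0 \<le> \<tau>\<close> by (simp only: sum.empty) simp
  qed
  have "(\<Sum>x\<in>U. \<bar>?cov x\<bar>) = (\<Sum>p\<in>\<Sigma> \<times> \<Sigma>. \<Sum>x | x \<in> U \<and> (x i, x j) = p. \<bar>?cov x\<bar>)"
    using U.finite_orbit U.finite_alphabet U.letters ij by (intro sum.group[symmetric]) auto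
  also have "\<dots> \<le> (\<Sum>p\<in>\<Sigma> \<times> \<Sigma>. 6 * \<tau> * card U)" by (rule sum_mono[OF letter_class])
  also have "\<dots> = 6 * (real (card \<Sigma>))\<^sup>2 * \<tau> * card U" by (simp add: card_cartesian_product power2_eq_square)
  finally show "(\<Sum>x\<in>U. \<bar>?cov x\<bar>) \<le> 6 * (real (card \<Sigma>))\<^sup>2 * \<tau> * card U" .
qed

end

section \<open>Laws that are coordinatewise close to a product\<close>

lemma finite_set_pmf_of_marginals:
  assumes "finite (set_pmf (map_pmf fst C))" "finite (set_pmf (map_pmf snd C))"
  shows "finite (set_pmf C)"
proof (rule finite_subset)
  show "set_pmf C \<subseteq> set_pmf (map_pmf fst C) \<times> set_pmf (map_pmf snd C)" by force
qed (use assms in simp)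

lemma finite_set_Pi_pmf: "finite A \<Longrightarrow> (\<And>i. i \<in> A \<Longrightarrow> finite (set_pmf (p i))) \<Longrightarrow> finite (set_pmf (Pi_pmf A d p))"
  by (rule finite_subset[OF set_Pi_pmf_subset' finite_PiE_dflt]) simp_all

lemma coupling_expectation_diff_le:
  fixes F :: "'a \<Rightarrow> real" and G :: "'b \<Rightarrow> real"
  assumes fin: "finite (set_pmf R)"
    and diff: "\<And>u v. (u, v) \<in> set_pmf R \<Longrightarrow> \<bar>F u - G v\<bar> \<le> c * of_bool (bad (u, v))"
  shows "\<bar>measure_pmf.expectation (map_pmf fst R) F - measure_pmf.expectation (map_pmf snd R) G\<bar>
    \<le> c * measure_pmf.prob R {w. bad w}"
proof -
  note int = integrable_measure_pmf_finite[OF fin]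
  have "measure_pmf.expectation (map_pmf fst R) F - measure_pmf.expectation (map_pmf snd R) G =
      measure_pmf.expectation R (\<lambda>w. F (fst w) - G (snd w))"
    by (simp add: int)
  also have "\<bar>\<dots>\<bar> \<le> measure_pmf.expectation R (\<lambda>w. \<bar>F (fst w) - G (snd w)\<bar>)"
    by (rule integral_abs_bound)
  also have "\<dots> \<le> measure_pmf.expectation R (\<lambda>w. c * indicator {w. bad w} w)"
  proof (intro integral_mono_AE int, unfold AE_measure_pmf_iff, intro ballI)
    fix w assume "w \<in> set_pmf R"
    then show "\<bar>F (fst w) - G (snd w)\<bar> \<le> c * indicator {w. bad w} w"
      using diff[of "fst w" "snd w"] by (simp add: indicator_def of_bool_def)
  qed
  also have "\<dots> = c * measure_pmf.prob R {w. bad w}" by simp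
  finally show ?thesis .
qed

lemma prob_ex_le:
  fixes t :: real
  assumes "finite J" "\<And>i. i \<in> J \<Longrightarrow> measure_pmf.prob R {w. bad i w} \<le> t"
  shows "measure_pmf.prob R {w. \<exists>i\<in>J. bad i w} \<le> card J * t"
proof -
  have "{w. \<exists>i\<in>J. bad i w} = (\<Union>i\<in>J. {w. bad i w})" by auto
  then have "measure_pmf.prob R {w. \<exists>i\<in>J. bad i w} \<le> (\<Sum>i\<in>J. measure_pmf.prob R {w. bad i w})"
    using assms(1) by (simp add: measure_pmf.finite_measure_subadditive_finite)
  also have "\<dots> \<le> (\<Sum>i\<in>J. t)" by (rule sum_mono[OF assms(2)])
  finally show ?thesis by simp
qed

lemma prob_Pi_pmf_subset:
  assumes "finite A" "J \<subseteq> A"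
  shows "measure_pmf.prob (Pi_pmf A d p) {z. \<forall>i\<in>J. z i \<in> S i} = (\<Prod>i\<in>J. measure_pmf.prob (p i) (S i))"
proof -
  have "{z. \<forall>i\<in>J. z i \<in> S i} = Pi A (\<lambda>i. {a. i \<in> J \<longrightarrow> a \<in> S i})"
    using assms(2) by (auto simp: Pi_iff)
  then have "measure_pmf.prob (Pi_pmf A d p) {z. \<forall>i\<in>J. z i \<in> S i} =
      (\<Prod>i\<in>A. measure_pmf.prob (p i) {a. i \<in> J \<longrightarrow> a \<in> S i})"
    using assms(1) by (simp add: measure_Pi_pmf_Pi)
  also have "\<dots> = (\<Prod>i\<in>J. measure_pmf.prob (p i) (S i))"
    using assms by (intro prod.mono_neutral_cong_right) auto
  finally show ?thesis .
qed

lemma map_Pi_pmf_restrict: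
  assumes "finite A"
  shows "map_pmf (\<lambda>z. \<lambda>i\<in>A. f (z i)) (Pi_pmf A d p) = Pi_pmf A undefined (\<lambda>i. map_pmf f (p i))"
proof -
  have "Pi_pmf A undefined (\<lambda>i. map_pmf f (p i)) = Pi_pmf A undefined (\<lambda>i. bind_pmf (p i) (\<lambda>a. return_pmf (f a)))"
    by (simp add: map_pmf_def)
  also have "\<dots> = bind_pmf (Pi_pmf A d p) (\<lambda>h. Pi_pmf A undefined (\<lambda>i. return_pmf (f (h i))))"
    by (rule Pi_pmf_bind[OF assms])
  also have "\<dots> = bind_pmf (Pi_pmf A d p) (\<lambda>h. return_pmf (\<lambda>i\<in>A. f (h i)))"
    using assms by (simp add: restrict_def)
  finally show ?thesis by (simp add: map_pmf_def)
qed

definition coordwise_close ::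
  "nat \<Rightarrow> ((nat \<Rightarrow> 'a) \<times> (nat \<Rightarrow> 'b)) pmf \<Rightarrow> ('a \<times> 'b) pmf \<Rightarrow> real \<Rightarrow> bool" where
  "coordwise_close n \<mu> q t \<longleftrightarrow> (\<exists>R. map_pmf fst R = \<mu> \<and> map_pmf snd R = Pi_pmf {1..n} undefined (\<lambda>_. q) \<and>
     (\<forall>i\<in>{1..n}. measure_pmf.prob R {w. letters_at i (fst w) \<noteq> snd w i} \<le> t))"

lemma coordwise_close_mono: "coordwise_close n \<mu> q t \<Longrightarrow> t \<le> t' \<Longrightarrow> coordwise_close n \<mu> q t'"
  unfolding coordwise_close_def by (fast intro: order_trans)

lemma coordwise_close_expectation_diff_le:
  fixes t :: real
  assumes "coordwise_close n \<mu> q t" and fin: "finite (set_pmf \<mu>)" "finite (set_pmf q)"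
    and J: "J \<subseteq> {1..n}" and c: "0 \<le> c" "\<And>w z. w \<in> set_pmf \<mu> \<Longrightarrow> \<bar>F w - G z\<bar> \<le> c"
    and eq: "\<And>w z. w \<in> set_pmf \<mu> \<Longrightarrow> (\<And>i. i \<in> J \<Longrightarrow> z i = letters_at i w) \<Longrightarrow> F w = G z"
  shows "\<bar>measure_pmf.expectation \<mu> F - measure_pmf.expectation (Pi_pmf {1..n} undefined (\<lambda>_. q)) G\<bar>
    \<le> c * (card J * t)"
proof -
  obtain R where R: "map_pmf fst R = \<mu>" "map_pmf snd R = Pi_pmf {1..n} undefined (\<lambda>_. q)"
    and dev: "\<And>i. i \<in> {1..n} \<Longrightarrow> measure_pmf.prob R {w. letters_at i (fst w) \<noteq> snd w i} \<le> t"
    using assms(1) unfolding coordwise_close_def by blast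
  have "finite (set_pmf (map_pmf fst R))" "finite (set_pmf (map_pmf snd R))"
    unfolding R using fin by (auto intro: finite_set_Pi_pmf)
  then have "finite (set_pmf R)" by (rule finite_set_pmf_of_marginals)
  then have "\<bar>measure_pmf.expectation (map_pmf fst R) F - measure_pmf.expectation (map_pmf snd R) G\<bar>
      \<le> c * measure_pmf.prob R {w. \<exists>i\<in>J. letters_at i (fst w) \<noteq> snd w i}"
  proof (rule coupling_expectation_diff_le)
    fix w z assume "(w, z) \<in> set_pmf R"
    then have w: "w \<in> set_pmf \<mu>" unfolding R(1)[symmetric] by force
    show "\<bar>F w - G z\<bar> \<le> c * of_bool (\<exists>i\<in>J. letters_at i (fst (w, z)) \<noteq> snd (w, z) i)"
      using c(2)[OF w] eq[OF w, of z] by (cases "\<exists>i\<in>J. letters_at i w \<noteq> z i") auto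
  qed
  also have "\<dots> \<le> c * (card J * t)"
    using J finite_subset[OF J] by (intro mult_left_mono prob_ex_le dev c(1)) auto
  finally show ?thesis by (simp only: R)
qed

lemma coordwise_close_prob_diff_le:
  fixes t :: real
  assumes close: "coordwise_close n \<mu> q t" and fin: "finite (set_pmf \<mu>)" "finite (set_pmf q)"
    and J: "J \<subseteq> {1..n}"
    and eq: "\<And>w z. w \<in> set_pmf \<mu> \<Longrightarrow> (\<And>i. i \<in> J \<Longrightarrow> z i = letters_at i w) \<Longrightarrow> w \<in> A \<longleftrightarrow> z \<in> B"
  shows "\<bar>measure_pmf.prob \<mu> A - measure_pmf.prob (Pi_pmf {1..n} undefined (\<lambda>_. q)) B\<bar> \<le> card J * t"
proof -
  have "\<bar>measure_pmf.expectation \<mu> (indicator A) -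
      measure_pmf.expectation (Pi_pmf {1..n} undefined (\<lambda>_. q)) (indicator B)\<bar> \<le> 1 * (card J * t)"
  proof (rule coordwise_close_expectation_diff_le[OF close fin J])
    fix w z
    show "\<bar>indicator A w - indicator B z\<bar> \<le> (1 :: real)" by (simp add: indicator_def)
    assume "w \<in> set_pmf \<mu>" "\<And>i. i \<in> J \<Longrightarrow> z i = letters_at i w"
    then show "indicator A w = (indicator B z :: real)" using eq[of w z] by (simp add: indicator_def)
  qed simp
  then show ?thesis by simp
qed

lemma pairwise_near_product_of_coordwise_close:
  fixes \<mu> :: "((nat \<Rightarrow> 'a) \<times> (nat \<Rightarrow> 'b)) pmf"
  assumes close: "coordwise_close n \<mu> q t" and fin: "finite (set_pmf \<mu>)" "finite (set_pmf q)" and "0 \<le> t"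
  shows "pairwise_near_product n \<mu> q (2 * t)"
  unfolding pairwise_near_product_def
proof (intro conjI ballI allI impI)
  fix i and A :: "('a \<times> 'b) set" assume i: "i \<in> {1..n}"
  have "\<bar>measure_pmf.prob \<mu> {w. letters_at i w \<in> A} -
      measure_pmf.prob (Pi_pmf {1..n} undefined (\<lambda>_. q)) {z. \<forall>k\<in>{i}. z k \<in> A}\<bar> \<le> card {i} * t"
    using i by (intro coordwise_close_prob_diff_le[OF close fin]) auto
  then show "\<bar>measure_pmf.prob \<mu> {w. letters_at i w \<in> A} - measure_pmf.prob q A\<bar> \<le> 2 * t"
    using prob_Pi_pmf_subset[of "{1..n}" "{i}" undefined "\<lambda>_. q" "\<lambda>_. A"] i \<open>0 \<le> t\<close> by simp
next
  fix i j and A B :: "('a \<times> 'b) set" assume ij: "i \<in> {1..n}" "j \<in> {1..n}" "i \<noteq> j"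
  let ?S = "\<lambda>k. if k = i then A else B"
  have "\<bar>measure_pmf.prob \<mu> {w. letters_at i w \<in> A \<and> letters_at j w \<in> B} -
      measure_pmf.prob (Pi_pmf {1..n} undefined (\<lambda>_. q)) {z. \<forall>k\<in>{i, j}. z k \<in> ?S k}\<bar> \<le> card {i, j} * t"
    using ij by (intro coordwise_close_prob_diff_le[OF close fin]) auto
  then show "\<bar>measure_pmf.prob \<mu> {w. letters_at i w \<in> A \<and> letters_at j w \<in> B} -
      measure_pmf.prob q A * measure_pmf.prob q B\<bar> \<le> 2 * t"
    using prob_Pi_pmf_subset[of "{1..n}" "{i, j}" undefined "\<lambda>_. q" ?S] ij by simp
qed

lemma coordwise_close_swap:
  fixes \<mu> :: "((nat \<Rightarrow> 'a) \<times> (nat \<Rightarrow> 'b)) pmf"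
  assumes "coordwise_close n \<mu> q t"
  shows "coordwise_close n (map_pmf prod.swap \<mu>) (map_pmf prod.swap q) t"
proof -
  obtain R where R: "map_pmf fst R = \<mu>" "map_pmf snd R = Pi_pmf {1..n} undefined (\<lambda>_. q)"
    and dev: "\<And>i. i \<in> {1..n} \<Longrightarrow> measure_pmf.prob R {w. letters_at i (fst w) \<noteq> snd w i} \<le> t"
    using assms unfolding coordwise_close_def by blast
  let ?R = "map_pmf (\<lambda>w. (prod.swap (fst w), \<lambda>i\<in>{1..n}. prod.swap (snd w i))) R"
  have "map_pmf fst ?R = map_pmf prod.swap \<mu>"
    unfolding R(1)[symmetric] by (simp add: map_pmf_comp)
  moreover have "map_pmf snd ?R = Pi_pmf {1..n} undefined (\<lambda>_. map_pmf prod.swap q)"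
    unfolding map_Pi_pmf_restrict[OF finite_atLeastAtMost, symmetric, where d = undefined] R(2)[symmetric]
    by (simp add: map_pmf_comp)
  moreover have "measure_pmf.prob ?R {w. letters_at i (fst w) \<noteq> snd w i} \<le> t" if "i \<in> {1..n}" for i
  proof -
    have "letters_at i (fst (prod.swap (fst w), \<lambda>i\<in>{1..n}. prod.swap (snd w i))) \<noteq>
        snd (prod.swap (fst w), \<lambda>i\<in>{1..n}. prod.swap (snd w i)) i \<longleftrightarrow> letters_at i (fst w) \<noteq> snd w i"
      for w :: "((nat \<Rightarrow> 'a) \<times> (nat \<Rightarrow> 'b)) \<times> (nat \<Rightarrow> 'a \<times> 'b)"
      using that by (auto simp: letters_at_def prod_eq_iff)
    then show ?thesis using dev[OF that] by (simp only: measure_map_pmf vimage_Collect_eq)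
  qed
  ultimately show ?thesis unfolding coordwise_close_def by blast
qed

text \<open>\<open>E O E\<inverse>\<close> joins letters with a common neighbour, so the last conjunct says that the bipartite graph with
  edge set \<open>set_pmf q\<close> is connected.\<close>

definition connected_letter_law :: "real \<Rightarrow> 'a set \<Rightarrow> 'b set \<Rightarrow> ('a \<times> 'b) pmf \<Rightarrow> bool" where
  "connected_letter_law \<alpha> \<Sigma> \<Sigma>' q \<longleftrightarrow> fst ` set_pmf q = \<Sigma> \<and> snd ` set_pmf q = \<Sigma>' \<and>
     (\<forall>e\<in>set_pmf q. \<alpha> \<le> pmf q e) \<and>
     (\<forall>b\<in>\<Sigma>. \<forall>c\<in>\<Sigma>. (b, c) \<in> (set_pmf q O (set_pmf q)\<inverse>)\<^sup>*)"

lemma connected_letter_law_prob_ge: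
  assumes "connected_letter_law \<alpha> \<Sigma> \<Sigma>' q" "e \<in> set_pmf q" "e \<in> A"
  shows "\<alpha> \<le> measure_pmf.prob q A"
proof -
  have "\<alpha> \<le> measure_pmf.prob q {e}"
    using assms(1,2) by (simp add: connected_letter_law_def measure_pmf_single)
  also have "\<dots> \<le> measure_pmf.prob q A"
    using assms(3) by (intro measure_pmf.finite_measure_mono) auto
  finally show ?thesis .
qed

lemma connected_letter_law_prob_letter_ge:
  assumes "connected_letter_law \<alpha> \<Sigma> \<Sigma>' q"
  shows "b \<in> \<Sigma> \<Longrightarrow> \<alpha> \<le> measure_pmf.prob q (fst -` {b})"
    and "c \<in> \<Sigma>' \<Longrightarrow> \<alpha> \<le> measure_pmf.prob q (snd -` {c})"
  using assms unfolding connected_letter_law_def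
  by (auto intro!: connected_letter_law_prob_ge[OF assms])

lemma relpow_of_rtrancl_of_loop:
  assumes "finite A" "R \<subseteq> A \<times> A" "(b, b) \<in> R" "(b, c) \<in> R\<^sup>*"
  shows "(b, c) \<in> R ^^ (2 ^ (card A * card A))"
proof -
  let ?N = "2 ^ (card A * card A) :: nat"
  have "finite R" and "card R \<le> card A * card A"
    using assms(1,2) card_mono[of "A \<times> A" R] finite_subset by (auto simp: card_cartesian_product)
  obtain l where "l \<le> card R" and l: "(b, c) \<in> R ^^ l"
    using assms(4) unfolding rtrancl_finite_eq_relpow[OF \<open>finite R\<close>] by blast
  then have "l \<le> ?N"
    using \<open>card R \<le> card A * card A\<close> less_exp[of "card A * card A"] by linarith
  moreover have "(b, b) \<in> R ^^ k" for k
    by (induction k) (use assms(3) in auto)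
  then have "(b, c) \<in> R ^^ (?N - l) O R ^^ l" using l by blast
  ultimately show ?thesis by (simp add: relpow_add[symmetric])
qed

lemma (in symmetric_law) sum_prob_fst_letter_eq_card_positions:
  assumes "x \<in> U"
  shows "(\<Sum>i\<in>{1..n}. measure_pmf.prob \<mu> {w. fst w i = c}) = card (positions n x c)"
proof -
  have "(\<Sum>i\<in>{1..n}. measure_pmf.prob \<mu> {w. fst w i = c}) * card U = (\<Sum>i\<in>{1..n}. \<Sum>y\<in>U. letter_ind i c y)"
    using U.nonempty U.finite_orbit
    by (simp add: prob_fst_eq_card[of "\<lambda>y. y _ = c"] letter_ind_def Int_def sum_distrib_right)
  also have "\<dots> = (\<Sum>y\<in>U. real (card (positions n y c)))"
    by (subst sum.swap) (simp add: letter_ind_def positions_def Int_def)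
  also have "\<dots> = real (card (positions n x c)) * card U"
    by (rule U.invariant_mult_card[symmetric, OF _ assms]) (simp add: card_positions_comp del: comp_apply)
  finally show ?thesis using U.card_pos by simp
qed

lemma (in symmetric_law) card_agree_on_ge:
  fixes \<alpha> t :: real
  assumes close: "coordwise_close n \<mu> q t" and fin: "finite (set_pmf q)"
    and letter: "\<And>c. c \<in> \<Sigma> \<Longrightarrow> \<alpha> \<le> measure_pmf.prob q (fst -` {c})" and \<alpha>: "0 \<le> \<alpha>"
    and J: "J \<subseteq> {1..n}" and x: "x \<in> U"
  shows "(\<alpha> ^ card J - card J * t) * card U \<le> card {y\<in>U. agree_on J y x}"
proof -
  have "finite (set_pmf \<mu>)"
    using finite_subset[OF supp] U.finite_orbit V.finite_orbit by simp
  then have "\<bar>measure_pmf.prob \<mu> {w. agree_on J (fst w) x} -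
      measure_pmf.prob (Pi_pmf {1..n} undefined (\<lambda>_. q)) {z. \<forall>i\<in>J. z i \<in> fst -` {x i}}\<bar> \<le> card J * t"
    by (intro coordwise_close_prob_diff_le[OF close _ fin J]) (auto simp: agree_on_def letters_at_def)
  moreover have "(\<Prod>i\<in>J. \<alpha>) \<le> (\<Prod>i\<in>J. measure_pmf.prob q (fst -` {x i}))"
    using J by (intro prod_mono conjI \<alpha> letter U.letters[OF x]) auto
  ultimately have "\<alpha> ^ card J - card J * t \<le> card {y\<in>U. agree_on J y x} / card U"
    unfolding prob_Pi_pmf_subset[OF finite_atLeastAtMost J] prob_fst_eq_card[of "\<lambda>y. agree_on J y x"] prod_constant
    by linarith
  then show ?thesis using U.card_pos by (simp add: pos_le_divide_eq)
qed

locale near_product_law = symmetric_law +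
  fixes q :: "('a \<times> 'b) pmf" and \<alpha> t :: real
  assumes close: "coordwise_close n \<mu> q t" and letter_law: "connected_letter_law \<alpha> \<Sigma> \<Sigma>' q"
    and \<alpha>_pos: "0 < \<alpha>" and t_nonneg: "0 \<le> t" and t_le: "t \<le> \<alpha> / 4"
begin

lemma finite_support: "finite (set_pmf \<mu>)"
  using finite_subset[OF supp] U.finite_orbit V.finite_orbit by simp

lemma finite_letter_support: "finite (set_pmf q)"
proof (rule finite_subset)
  show "set_pmf q \<subseteq> fst ` set_pmf q \<times> snd ` set_pmf q" by force
  show "finite (fst ` set_pmf q \<times> snd ` set_pmf q)"
    using letter_law U.finite_alphabet V.finite_alphabet by (simp only: connected_letter_law_def finite_cartesian_product)
qed

lemma near: "pairwise_near_product n \<mu> q (2 * t)"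
  by (rule pairwise_near_product_of_coordwise_close[OF close finite_support finite_letter_support t_nonneg])

lemma \<alpha>_le_1: "\<alpha> \<le> 1"
proof -
  obtain e where "e \<in> set_pmf q" using set_pmf_not_empty[of q] by blast
  then have "\<alpha> \<le> pmf q e" using letter_law by (simp add: connected_letter_law_def)
  then show ?thesis using pmf_le_1[of q e] by linarith
qed

lemma half_le_prob_letters_at:
  assumes "i \<in> {1..n}" "\<alpha> \<le> measure_pmf.prob q A"
  shows "\<alpha> / 2 \<le> measure_pmf.prob \<mu> {w. letters_at i w \<in> A}"
  using pairwise_near_productD(1)[OF near assms(1), of A] assms(2) t_le by linarith

lemma card_positions_ge:
  assumes "x \<in> U" "c \<in> \<Sigma>"
  shows "\<alpha> / 2 * n \<le> card (positions n x c)"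
proof -
  have "\<alpha> / 2 \<le> measure_pmf.prob \<mu> {w. fst w i = c}" if "i \<in> {1..n}" for i
    using half_le_prob_letters_at[OF that connected_letter_law_prob_letter_ge(1)[OF letter_law assms(2)]]
    by (simp add: letters_at_def)
  then have "(\<Sum>i\<in>{1..n}. \<alpha> / 2) \<le> (\<Sum>i\<in>{1..n}. measure_pmf.prob \<mu> {w. fst w i = c})"
    by (intro sum_mono)
  then show ?thesis
    unfolding sum_prob_fst_letter_eq_card_positions[OF assms(1)] by (simp add: mult.commute)
qed

definition two_step :: "(nat \<Rightarrow> 'a) \<Rightarrow> (nat \<Rightarrow> 'a) \<Rightarrow> real" where
  "two_step = kernel_comp V (transition U \<mu>) (transition V (map_pmf prod.swap \<mu>))"

lemma two_step_eq: "two_step x w = real (card U) * real (card V) * (\<Sum>y\<in>V. pmf \<mu> (x, y) * pmf \<mu> (w, y))"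
  by (simp add: two_step_def kernel_comp_def transition_def pmf_map_swap sum_distrib_left mult_ac)

lemma form_two_step_eq:
  "inner_on U h (kernel_op U two_step h) = real (card U) * real (card V) * sqnorm_on V (kernel_adjoint U (\<lambda>x y. pmf \<mu> (x, y)) h)"
proof -
  have "kernel_op U (transition V (map_pmf prod.swap \<mu>)) h = fscale (card V) (kernel_adjoint U (\<lambda>x y. pmf \<mu> (x, y)) h)"
    by (simp add: fun_eq_iff kernel_op_def transition_def pmf_map_swap sum_distrib_left mult_ac)
  moreover have "kernel_op V (transition U \<mu>) g = fscale (card U) (kernel_op V (\<lambda>x y. pmf \<mu> (x, y)) g)" for g
    by (simp add: fun_eq_iff kernel_op_def transition_def sum_distrib_left mult_ac)
  ultimately show ?thesis
    unfolding two_step_def kernel_op_comp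
    by (simp only: kernel_op_scale inner_on_scale_right inner_on_kernel_adjoint) simp
qed

lemma equivariant_markov_two_step: "equivariant_markov n U U two_step"
  unfolding two_step_def
  by (rule equivariant_markov_comp[OF V.perm_orbit_axioms equivariant_markov_transition
        symmetric_law.equivariant_markov_transition[OF symmetric_law_swap]])

lemma pair_dependence_le_two_step:
  "pair_dependence_le n U U two_step (12 * (real (card \<Sigma>'))\<^sup>2 * (1 + (real (card \<Sigma>))\<^sup>2) * t)"
proof -
  note swapped = symmetric_law_swap
  have "finite (set_pmf (map_pmf prod.swap \<mu>))" "finite (set_pmf (map_pmf prod.swap q))"
    using finite_support finite_letter_support by simp_all
  note near_swap = pairwise_near_product_of_coordwise_close[OF coordwise_close_swap[OF close] this t_nonneg]
  have "pair_dependence_le n U U two_step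
      (6 * (real (card \<Sigma>'))\<^sup>2 * (2 * t) + (real (card \<Sigma>'))\<^sup>2 * (6 * (real (card \<Sigma>))\<^sup>2 * (2 * t)))"
    unfolding two_step_def
    by (rule pair_dependence_le_comp[OF V.perm_orbit_axioms U.perm_orbit_axioms equivariant_markov_transition
          symmetric_law.equivariant_markov_transition[OF swapped] pair_dependence_le_transition[OF near]
          symmetric_law.pair_dependence_le_transition[OF swapped near_swap]])
  then show ?thesis by (simp add: algebra_simps)
qed

lemma letter_transition_ge_two_step:
  assumes "(b, c) \<in> set_pmf q O (set_pmf q)\<inverse>"
  shows "letter_transition_ge n U U two_step (\<alpha> / 2 * (\<alpha> / 2)) b c"
proof -
  note swapped = symmetric_law_swap
  obtain y where y: "(b, y) \<in> set_pmf q" "(c, y) \<in> set_pmf q" using assms by blast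
  have edge: "\<alpha> / 2 \<le> measure_pmf.prob \<mu> {w. letters_at i w = e}" if "e \<in> set_pmf q" "i \<in> {1..n}" for e i
    using half_le_prob_letters_at[OF that(2), of "{e}"] letter_law that(1)
    by (simp add: connected_letter_law_def measure_pmf_single)
  have "{w. letters_at i (prod.swap w) = (y, c)} = {w. letters_at i w = (c, y)}" for i
    by (auto simp: letters_at_def)
  then have "\<alpha> / 2 \<le> measure_pmf.prob (map_pmf prod.swap \<mu>) {w. letters_at i w = (y, c)}" if "i \<in> {1..n}" for i
    using edge[OF y(2) that] by (simp add: vimage_def)
  then show ?thesis
    unfolding two_step_def using \<alpha>_pos
    by (intro letter_transition_ge_comp[where b = y] equivariant_markov_transition letter_transition_ge_transition
        symmetric_law.equivariant_markov_transition[OF swapped] symmetric_law.letter_transition_ge_transition[OF swapped]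
        edge[OF y(1)]) auto
qed

lemma relpow_letters:
  assumes "b \<in> \<Sigma>" "c \<in> \<Sigma>"
  shows "(b, c) \<in> (set_pmf q O (set_pmf q)\<inverse>) ^^ (2 ^ (card \<Sigma> * card \<Sigma>))"
proof (rule relpow_of_rtrancl_of_loop[OF U.finite_alphabet])
  have letters: "fst ` set_pmf q = \<Sigma>"
    using letter_law by (simp add: connected_letter_law_def)
  show "set_pmf q O (set_pmf q)\<inverse> \<subseteq> \<Sigma> \<times> \<Sigma>"
    unfolding letters[symmetric] by (auto intro: rev_image_eqI)
  obtain y where "(b, y) \<in> set_pmf q"
    using assms(1) unfolding letters[symmetric] by auto
  then show "(b, b) \<in> set_pmf q O (set_pmf q)\<inverse>" by blast
  show "(b, c) \<in> (set_pmf q O (set_pmf q)\<inverse>)\<^sup>*"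
    using letter_law assms by (simp add: connected_letter_law_def)
qed

end

section \<open>Comparison of two laws\<close>

lemma (in near_product_law) alphabet_nonempty: "\<Sigma> \<noteq> {}"
  using letter_law set_pmf_not_empty[of q] by (auto simp: connected_letter_law_def)

lemma (in near_product_law) adjoint_contraction:
  fixes \<delta> :: real and d :: nat
  defines "r \<equiv> card \<Sigma> * card \<Sigma>"
  assumes h: "pure_junta n U J h" and d: "1 \<le> d" "d \<le> card J" "card J \<le> (1 - \<alpha> / 2) * n"
    and dep: "(1 + (real (card \<Sigma>))\<^sup>2) ^ r * (12 * (real (card \<Sigma>'))\<^sup>2 * (1 + (real (card \<Sigma>))\<^sup>2) * t) \<le> 1 / d"
    and \<delta>: "0 \<le> \<delta>" "contraction_rate (card \<Sigma>) ((\<alpha> / 2 * (\<alpha> / 2)) ^ 2 ^ r) (\<alpha> / 2) d \<le> \<delta> ^ 2 ^ r"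
  shows "real (card U) * real (card V) * sqnorm_on V (kernel_adjoint U (\<lambda>x y. pmf \<mu> (x, y)) h) \<le> \<delta> * sqnorm_on U h"
proof -
  obtain b where b: "b \<in> \<Sigma>" using alphabet_nonempty by blast
  have "inner_on U h (kernel_op U two_step h) \<le> \<delta> * sqnorm_on U h"
  proof (rule U.chain_contraction[OF equivariant_markov_two_step _ pair_dependence_le_two_step
        letter_transition_ge_two_step _ card_positions_ge[OF _ b] _ _ _ _ _ _ h d \<delta>])
    show "two_step x w = two_step w x" for x w by (simp add: two_step_eq mult.commute)
    show "(b, c) \<in> (set_pmf q O (set_pmf q)\<inverse>) ^^ (2 ^ r)" if "c \<in> \<Sigma>" for c
      unfolding r_def by (rule relpow_letters[OF b that])
    show "0 \<le> inner_on U h (kernel_op U two_step h)" by (simp add: form_two_step_eq sqnorm_on_nonneg)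
    show "\<alpha> / 2 * (\<alpha> / 2) \<le> 1" using \<alpha>_pos \<alpha>_le_1 by (intro mult_le_one) auto
  qed (use \<alpha>_pos \<alpha>_le_1 t_nonneg dep in auto)
  then show ?thesis by (simp only: form_two_step_eq)
qed

lemma (in perm_orbit) junta_abs_le:
  fixes \<rho> :: real
  assumes J: "J \<subseteq> {1..n}" "junta n U J h" and x: "x \<in> U"
    and \<rho>: "0 < \<rho>" "\<rho> * card U \<le> card {y\<in>U. agree_on J y x}"
  shows "\<bar>h x\<bar> \<le> sqrt (sqnorm_on U h / (\<rho> * card U))"
proof (rule real_le_rsqrt)
  have "(h x)\<^sup>2 * (\<rho> * card U) \<le> (h x)\<^sup>2 * card {y\<in>U. agree_on J y x}"
    using \<rho> by (intro mult_left_mono) auto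
  also have "\<dots> = (\<Sum>y | y \<in> U \<and> agree_on J y x. h y * h y)"
    using junta_eq[OF J(2,1) _ x] by (simp add: power2_eq_square)
  also have "\<dots> \<le> sqnorm_on U h"
    unfolding inner_on_def using finite_orbit by (intro sum_mono2) auto
  finally show "\<bar>h x\<bar>\<^sup>2 \<le> sqnorm_on U h / (\<rho> * card U)"
    using \<rho>(1) card_pos by (simp add: pos_le_divide_eq)
qed

lemma (in perm_orbit) sqnorm_on_adjoint_junta_le:
  fixes \<rho> l :: real
  assumes V: "perm_orbit n \<Sigma>' V" and D: "equivariant n U V D" and J: "J \<subseteq> {1..n}" "junta n U J h"
    and \<rho>: "0 < \<rho>" "\<And>x. x \<in> U \<Longrightarrow> \<rho> * card U \<le> card {y\<in>U. agree_on J y x}"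
      "\<And>x. x \<in> V \<Longrightarrow> \<rho> * card V \<le> card {y\<in>V. agree_on J y x}"
    and close: "\<And>g H G. junta n V J g \<Longrightarrow> (\<And>x. x \<in> U \<Longrightarrow> \<bar>h x\<bar> \<le> H) \<Longrightarrow> (\<And>y. y \<in> V \<Longrightarrow> \<bar>g y\<bar> \<le> G) \<Longrightarrow>
      \<bar>inner_on U h (kernel_op V D g)\<bar> \<le> l * H * G"
  shows "real (card U) * real (card V) * sqnorm_on V (kernel_adjoint U D h) \<le> (l / \<rho>)\<^sup>2 * sqnorm_on U h"
proof -
  interpret V: perm_orbit n \<Sigma>' V by fact
  define v where "v = kernel_adjoint U D h"
  define bU bV where "bU = sqnorm_on U h / (\<rho> * card U)" and "bV = sqnorm_on V v / (\<rho> * card V)"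
  have b_nonneg: "0 \<le> bU" "0 \<le> bV"
    using \<rho>(1) by (simp_all add: bU_def bV_def sqnorm_on_nonneg)
  have v: "junta n V J v"
    unfolding v_def by (rule junta_kernel_op[OF perm_orbit_axioms equivariant_swap[OF D] J(2)])
  have "sqnorm_on V v = inner_on U h (kernel_op V D v)"
    by (simp only: v_def inner_on_kernel_adjoint)
  also have "\<dots> \<le> l * sqrt bU * sqrt bV"
    using close[OF v junta_abs_le[OF J _ \<rho>(1,2)] V.junta_abs_le[OF J(1) v _ \<rho>(1,3)]]
    unfolding bU_def bV_def by simp
  finally have "(sqnorm_on V v)\<^sup>2 \<le> (l * sqrt bU * sqrt bV)\<^sup>2"
    using sqnorm_on_nonneg[of V v] by (intro power_mono) auto
  also have "\<dots> = l\<^sup>2 * bU * bV"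
    using b_nonneg by (simp add: power_mult_distrib)
  finally have "sqnorm_on V v * sqnorm_on V v \<le> (l\<^sup>2 * bU / (\<rho> * card V)) * sqnorm_on V v"
    by (simp add: power2_eq_square bV_def)
  then have "sqnorm_on V v \<le> l\<^sup>2 * bU / (\<rho> * card V)"
    by (rule le_of_square_le_mult) (use b_nonneg \<rho>(1) in \<open>simp_all add: sqnorm_on_nonneg\<close>)
  then have "real (card U) * real (card V) * sqnorm_on V v \<le> real (card U) * real (card V) * (l\<^sup>2 * bU / (\<rho> * card V))"
    by (rule mult_left_mono) simp
  also have "\<dots> = (l / \<rho>)\<^sup>2 * sqnorm_on U h"
    using \<rho>(1) card_pos V.card_pos by (simp add: bU_def field_simps power2_eq_square)
  finally show ?thesis by (simp only: v_def)
qed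

lemma (in perm_orbit) eq_of_agree_on_other_positions:
  assumes x: "x \<in> U" and y: "y \<in> U" and agree: "agree_on ({1..n} - positions n x c) y x"
  shows "y = x"
proof -
  let ?J = "{1..n} - positions n x c"
  have "agree_on ?J x y" using agree by (simp add: agree_on_def)
  then obtain \<pi> where \<pi>: "\<pi> permutes {1..n} - ?J" "y = x \<circ> \<pi>"
    using transitive[OF x y Diff_subset] by blast
  moreover have "{1..n} - ?J = positions n x c" by (auto simp: positions_def)
  ultimately have p: "\<pi> permutes positions n x c" by simp
  have "x (\<pi> i) = x i" for i
    using permutes_in_image[OF p, of i] permutes_not_in[OF p, of i]
    by (cases "i \<in> positions n x c") (auto simp: positions_def)
  then show ?thesis unfolding \<pi>(2) by auto
qed

lemma (in near_product_law) ex_determining_coordinates: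
  assumes x: "x \<in> U"
  shows "\<exists>J\<subseteq>{1..n}. card J \<le> nat \<lfloor>(1 - \<alpha> / 2) * n\<rfloor> \<and> (\<forall>y\<in>U. agree_on J y x \<longrightarrow> y = x)"
proof -
  obtain b where b: "b \<in> \<Sigma>" using alphabet_nonempty by blast
  let ?J = "{1..n} - positions n x b"
  have "card ?J + card (positions n x b) = n"
    using card_Diff_subset[OF finite_positions positions_subset[of n x b]] card_mono[OF _ positions_subset[of n x b]]
    by simp
  then have "real (card ?J) = n - real (card (positions n x b))"
    by linarith
  also have "\<dots> \<le> (1 - \<alpha> / 2) * n"
    using card_positions_ge[OF x b] by (simp add: left_diff_distrib)
  finally have "card ?J \<le> (1 - \<alpha> / 2) * n" .
  then have "card ?J \<le> nat \<lfloor>(1 - \<alpha> / 2) * n\<rfloor>" by (simp add: le_nat_floor)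
  then show ?thesis
    using U.eq_of_agree_on_other_positions[OF x] by (intro exI[of _ ?J] conjI ballI impI Diff_subset)
qed

text \<open>Meaningful only if \<open>F\<close> depends on the letters in \<open>J\<close> alone, so that the choice of \<open>w\<close> does not matter.\<close>

definition letters_ext ::
  "((nat \<Rightarrow> 'a) \<times> (nat \<Rightarrow> 'b)) set \<Rightarrow> nat set \<Rightarrow> ((nat \<Rightarrow> 'a) \<times> (nat \<Rightarrow> 'b) \<Rightarrow> real) \<Rightarrow> (nat \<Rightarrow> 'a \<times> 'b) \<Rightarrow> real"
where
  "letters_ext W J F z =
     (if \<exists>w\<in>W. \<forall>i\<in>J. z i = letters_at i w then F (SOME w. w \<in> W \<and> (\<forall>i\<in>J. z i = letters_at i w)) else 0)"

lemma letters_ext_cases: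
  obtains "letters_ext W J F z = 0" "\<not> (\<exists>w\<in>W. \<forall>i\<in>J. z i = letters_at i w)"
  | w where "letters_ext W J F z = F w" "w \<in> W" "\<forall>i\<in>J. z i = letters_at i w"
proof (cases "\<exists>w\<in>W. \<forall>i\<in>J. z i = letters_at i w")
  case True
  let ?w = "SOME w. w \<in> W \<and> (\<forall>i\<in>J. z i = letters_at i w)"
  have "?w \<in> W \<and> (\<forall>i\<in>J. z i = letters_at i ?w)"
    by (rule someI_ex) (use True in blast)
  moreover have "letters_ext W J F z = F ?w"
    unfolding letters_ext_def by (rule if_P[OF True])
  ultimately show thesis using that(2) by blast
next
  case False
  have "letters_ext W J F z = 0"
    unfolding letters_ext_def by (rule if_not_P[OF False])
  then show thesis using that(1) False by blast
qed

lemma coordwise_close_expectation_diff_le_of_bounded: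
  fixes t c :: real
  assumes close: "coordwise_close n \<mu> q t" "coordwise_close n \<mu>' q t"
    and fin: "finite W" "set_pmf \<mu> \<subseteq> W" "set_pmf \<mu>' \<subseteq> W" "finite (set_pmf q)"
    and J: "J \<subseteq> {1..n}" and bound: "\<And>w. w \<in> W \<Longrightarrow> \<bar>F w\<bar> \<le> c" and "0 \<le> c"
    and F: "\<And>w w'. w \<in> W \<Longrightarrow> w' \<in> W \<Longrightarrow> (\<And>i. i \<in> J \<Longrightarrow> letters_at i w = letters_at i w') \<Longrightarrow> F w = F w'"
  shows "\<bar>measure_pmf.expectation \<mu> F - measure_pmf.expectation \<mu>' F\<bar> \<le> 4 * (card J * t) * c"
proof -
  let ?prod = "measure_pmf.expectation (Pi_pmf {1..n} undefined (\<lambda>_. q)) (letters_ext W J F)"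
  have ext_bound: "\<bar>letters_ext W J F z\<bar> \<le> c" for z
    by (cases rule: letters_ext_cases[of W J F z]) (use bound \<open>0 \<le> c\<close> in auto)
  have ext_eq: "F w = letters_ext W J F z" if "w \<in> W" "\<forall>i\<in>J. z i = letters_at i w" for w z
  proof (cases rule: letters_ext_cases[of W J F z])
    case 1
    then show ?thesis using that by blast
  next
    case (2 w')
    then show ?thesis using F[OF that(1) 2(2)] that(2) by simp
  qed
  have "\<bar>measure_pmf.expectation \<nu> F - ?prod\<bar> \<le> 2 * c * (card J * t)"
    if "coordwise_close n \<nu> q t" "set_pmf \<nu> \<subseteq> W" for \<nu>
  proof (rule coordwise_close_expectation_diff_le[OF that(1) finite_subset[OF that(2) fin(1)] fin(4) J])
    fix w z assume "w \<in> set_pmf \<nu>"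
    then have w: "w \<in> W" using that(2) by blast
    show "\<bar>F w - letters_ext W J F z\<bar> \<le> 2 * c"
      using bound[OF w] ext_bound[of z] by linarith
    show "F w = letters_ext W J F z" if "\<And>i. i \<in> J \<Longrightarrow> z i = letters_at i w"
      using ext_eq[OF w] that by blast
  qed (use \<open>0 \<le> c\<close> in simp)
  from this[OF close(1) fin(2)] this[OF close(2) fin(3)] show ?thesis
    by (simp add: algebra_simps)
qed

lemma norm2_eq:
  assumes "finite U" "U \<noteq> {}"
  shows "norm2 U f = sqrt (sqnorm_on U f / card U)"
  unfolding norm2_def inner_on_def integral_pmf_of_set[OF assms(2,1)] by (simp add: power2_eq_square)

locale two_near_product_laws =
  near_product_law n \<Sigma> \<Sigma>' U V \<mu> q \<alpha> t + other: near_product_law n \<Sigma> \<Sigma>' U V \<mu>' q \<alpha> t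
  for n \<Sigma> \<Sigma>' U V \<mu> \<mu>' q \<alpha> t
begin

definition difference :: "(nat \<Rightarrow> 'a) \<Rightarrow> (nat \<Rightarrow> 'b) \<Rightarrow> real" where
  "difference x y = pmf \<mu> (x, y) - pmf \<mu>' (x, y)"

lemma equivariant_difference: "equivariant n U V difference"
  using equivariant_pmf other.equivariant_pmf by (simp add: equivariant_def difference_def)

lemma form_difference_eq:
  "inner_on U f (kernel_op V difference g) =
     measure_pmf.expectation \<mu> (\<lambda>(x, y). f x * g y) - measure_pmf.expectation \<mu>' (\<lambda>(x, y). f x * g y)"
  unfolding inner_on_kernel_op expectation_eq_sum other.expectation_eq_sum difference_def
  by (simp add: left_diff_distrib sum_subtractf mult.assoc)

lemma adjoint_difference_low_degree:
  fixes d :: nat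
  defines "\<rho> \<equiv> \<alpha> ^ d / 2"
  assumes J: "J \<subseteq> {1..n}" "card J \<le> d" and h: "junta n U J h" and dt: "d * t \<le> \<rho>"
  shows "real (card U) * real (card V) * sqnorm_on V (kernel_adjoint U difference h) \<le> (4 * (d * t) / \<rho>)\<^sup>2 * sqnorm_on U h"
proof (rule U.sqnorm_on_adjoint_junta_le[OF V.perm_orbit_axioms equivariant_difference J(1) h])
  show "0 < \<rho>" using \<alpha>_pos by (simp add: \<rho>_def)
  have Jdt: "card J * t \<le> d * t" using J(2) t_nonneg by (simp add: mult_right_mono)
  have "\<alpha> ^ d \<le> \<alpha> ^ card J" using \<alpha>_pos \<alpha>_le_1 J(2) by (intro power_decreasing) auto
  then have \<rho>_le: "\<rho> \<le> \<alpha> ^ card J - card J * t" using dt Jdt by (simp add: \<rho>_def)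
  note letter_ge = connected_letter_law_prob_letter_ge[OF letter_law]
  show "\<rho> * card U \<le> card {y\<in>U. agree_on J y x}" if "x \<in> U" for x
    using card_agree_on_ge[OF close finite_letter_support letter_ge(1) _ J(1) that] \<alpha>_pos
      mult_right_mono[OF \<rho>_le, of "card U"] by simp
  have "\<alpha> \<le> measure_pmf.prob (map_pmf prod.swap q) (fst -` {c})" if "c \<in> \<Sigma>'" for c
    using letter_ge(2)[OF that] by (simp add: vimage_comp comp_def)
  then show "\<rho> * card V \<le> card {y\<in>V. agree_on J y x}" if "x \<in> V" for x
    using symmetric_law.card_agree_on_ge[OF symmetric_law_swap coordwise_close_swap[OF close] _ _ _ J(1) that, of \<alpha>]
      finite_letter_support \<alpha>_pos mult_right_mono[OF \<rho>_le, of "card V"] by simp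
next
  fix g H G assume g: "junta n V J g" and H: "\<And>x. x \<in> U \<Longrightarrow> \<bar>h x\<bar> \<le> H" and G: "\<And>y. y \<in> V \<Longrightarrow> \<bar>g y\<bar> \<le> G"
  have HG: "0 \<le> H" "0 \<le> G" using U.nonempty V.nonempty H G abs_ge_zero order_trans by blast+
  let ?F = "\<lambda>(x, y). h x * g y"
  have "\<bar>measure_pmf.expectation \<mu> ?F - measure_pmf.expectation \<mu>' ?F\<bar> \<le> 4 * (card J * t) * (H * G)"
  proof (rule coordwise_close_expectation_diff_le_of_bounded[OF close other.close _ supp other.supp
        finite_letter_support J(1)])
    show "\<bar>?F w\<bar> \<le> H * G" if "w \<in> U \<times> V" for w
      using that H G HG by (auto simp: abs_mult intro!: mult_mono)
    fix w w' assume w: "w \<in> U \<times> V" "w' \<in> U \<times> V" and "\<And>i. i \<in> J \<Longrightarrow> letters_at i w = letters_at i w'"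
    then have "agree_on J (fst w) (fst w')" "agree_on J (snd w) (snd w')"
      by (auto simp: agree_on_def letters_at_def)
    then show "?F w = ?F w'"
      using U.junta_eq[OF h J(1)] V.junta_eq[OF g J(1)] w by (auto simp: split_def mem_Times_iff)
  qed (use U.finite_orbit V.finite_orbit HG in auto)
  also have "\<dots> \<le> 4 * (d * t) * (H * G)"
    using J(2) t_nonneg HG by (intro mult_right_mono mult_left_mono) auto
  finally show "\<bar>inner_on U h (kernel_op V difference g)\<bar> \<le> 4 * (d * t) * H * G"
    by (simp only: form_difference_eq mult.assoc)
qed

lemma adjoint_difference_high_degree:
  assumes "real (card U) * real (card V) * sqnorm_on V (kernel_adjoint U (\<lambda>x y. pmf \<mu> (x, y)) h) \<le> \<delta> * sqnorm_on U h"
    and "real (card U) * real (card V) * sqnorm_on V (kernel_adjoint U (\<lambda>x y. pmf \<mu>' (x, y)) h) \<le> \<delta> * sqnorm_on U h"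
  shows "real (card U) * real (card V) * sqnorm_on V (kernel_adjoint U difference h) \<le> 4 * \<delta> * sqnorm_on U h"
proof -
  let ?p = "kernel_adjoint U (\<lambda>x y. pmf \<mu> (x, y)) h" and ?p' = "kernel_adjoint U (\<lambda>x y. pmf \<mu>' (x, y)) h"
  have "kernel_adjoint U difference h = ?p + fscale (-1) ?p'"
    by (simp add: fun_eq_iff kernel_op_def difference_def left_diff_distrib sum_subtractf)
  then have "sqnorm_on V (kernel_adjoint U difference h) \<le> 2 * sqnorm_on V ?p + 2 * sqnorm_on V (fscale (-1) ?p')"
    by (simp only: sqnorm_on_add_le)
  also have "sqnorm_on V (fscale (-1) ?p') = sqnorm_on V ?p'"
    unfolding inner_on_scale_left inner_on_scale_right by simp
  finally have "real (card U) * real (card V) * sqnorm_on V (kernel_adjoint U difference h) \<le>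
      real (card U) * real (card V) * (2 * sqnorm_on V ?p + 2 * sqnorm_on V ?p')"
    by (rule mult_left_mono) simp
  then show ?thesis using assms by (simp add: algebra_simps)
qed

lemma forms_close:
  fixes \<epsilon> :: real and d :: nat
  defines "r \<equiv> card \<Sigma> * card \<Sigma>" and "\<rho> \<equiv> \<alpha> ^ d / 2"
  assumes "1 \<le> d" "0 < \<epsilon>"
    and dep: "(1 + (real (card \<Sigma>))\<^sup>2) ^ r * (12 * (real (card \<Sigma>'))\<^sup>2 * (1 + (real (card \<Sigma>))\<^sup>2) * t) \<le> 1 / d"
    and rate: "contraction_rate (card \<Sigma>) ((\<alpha> / 2 * (\<alpha> / 2)) ^ 2 ^ r) (\<alpha> / 2) d \<le> (\<epsilon>\<^sup>2 / 4) ^ 2 ^ r"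
    and dt: "d * t \<le> \<rho>" "4 * (d * t) \<le> \<epsilon> * \<rho>"
  shows "\<bar>measure_pmf.expectation \<mu> (\<lambda>(x, y). f x * g y) - measure_pmf.expectation \<mu>' (\<lambda>(x, y). f x * g y)\<bar>
    \<le> \<epsilon> * norm2 U f * norm2 V g"
proof -
  let ?N = "real (card U) * real (card V)" and ?D = "kernel_adjoint U difference"
  have N: "0 < ?N" using U.card_pos V.card_pos by simp
  have "?N * sqnorm_on V (?D h) \<le> \<epsilon>\<^sup>2 * sqnorm_on U h"
    if J: "card J \<le> nat \<lfloor>(1 - \<alpha> / 2) * n\<rfloor>" and h: "pure_junta n U J h" for J h
  proof (cases "d \<le> card J")
    case True
    have "real (card J) \<le> (1 - \<alpha> / 2) * n"
      using J \<alpha>_pos \<alpha>_le_1 by (simp add: le_nat_iff le_floor_iff)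
    note contraction = adjoint_contraction[OF h \<open>1 \<le> d\<close> True this dep[unfolded r_def] _ rate[unfolded r_def]]
      other.adjoint_contraction[OF h \<open>1 \<le> d\<close> True this dep[unfolded r_def] _ rate[unfolded r_def]]
    have "?N * sqnorm_on V (?D h) \<le> 4 * (\<epsilon>\<^sup>2 / 4) * sqnorm_on U h"
      by (intro adjoint_difference_high_degree contraction) simp_all
    then show ?thesis by simp
  next
    case False
    then have "?N * sqnorm_on V (?D h) \<le> (4 * (d * t) / \<rho>)\<^sup>2 * sqnorm_on U h"
      using adjoint_difference_low_degree[of J d h] pure_juntaD[OF h] dt(1) by (simp add: \<rho>_def)
    also have "\<dots> \<le> \<epsilon>\<^sup>2 * sqnorm_on U h"
      using dt(2) \<alpha>_pos t_nonneg
      by (intro mult_right_mono power_mono sqnorm_on_nonneg) (auto simp: pos_divide_le_eq \<rho>_def)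
    finally show ?thesis .
  qed
  then have pure: "sqnorm_on V (?D h) \<le> \<epsilon>\<^sup>2 / ?N * sqnorm_on U h"
    if "card J \<le> nat \<lfloor>(1 - \<alpha> / 2) * n\<rfloor>" "pure_junta n U J h" for J h
    using N that by (simp add: pos_le_divide_eq mult.commute)
  have "0 < \<epsilon>\<^sup>2 / ?N" using N \<open>0 < \<epsilon>\<close> by simp
  from U.sqnorm_on_kernel_adjoint_le_of_pure_juntas[OF V.perm_orbit_axioms equivariant_difference this pure
      ex_determining_coordinates]
  have "sqnorm_on V (?D f) \<le> \<epsilon>\<^sup>2 / ?N * sqnorm_on U f" .
  then have "(inner_on V (?D f) g)\<^sup>2 \<le> \<epsilon>\<^sup>2 / ?N * sqnorm_on U f * sqnorm_on V g"
    by (intro order_trans[OF inner_on_Cauchy_Schwarz] mult_right_mono sqnorm_on_nonneg)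
  also have "\<dots> = (\<epsilon> * norm2 U f * norm2 V g)\<^sup>2"
    by (simp add: norm2_eq U.finite_orbit V.finite_orbit U.nonempty V.nonempty power_mult_distrib sqnorm_on_nonneg)
  finally have "\<bar>inner_on V (?D f) g\<bar> \<le> \<epsilon> * norm2 U f * norm2 V g"
    using \<open>0 < \<epsilon>\<close> by (subst (asm) power2_le_iff_abs_le) (simp_all add: norm2_def)
  then show ?thesis
    by (simp only: inner_on_kernel_adjoint form_difference_eq)
qed

end

lemma ex_closeness_two_near_product_laws:
  fixes \<alpha> \<epsilon> :: real and \<Sigma> :: "'a set" and \<Sigma>' :: "'b set"
  assumes "0 < \<alpha>" "0 < \<epsilon>"
  shows "\<exists>t>0. t \<le> \<alpha> / 4 \<and> (\<forall>n U V \<mu> \<mu>' q f g. two_near_product_laws n \<Sigma> \<Sigma>' U V \<mu> \<mu>' q \<alpha> t \<longrightarrow>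
    \<bar>measure_pmf.expectation \<mu> (\<lambda>(x, y). f x * g y) - measure_pmf.expectation \<mu>' (\<lambda>(x, y). f x * g y)\<bar>
      \<le> \<epsilon> * norm2 U f * norm2 V g)"
proof -
  define r where "r = card \<Sigma> * card \<Sigma>"
  define c where "c = (1 + (real (card \<Sigma>))\<^sup>2) ^ r * (12 * (real (card \<Sigma>'))\<^sup>2 * (1 + (real (card \<Sigma>))\<^sup>2))"
  let ?rate = "contraction_rate (card \<Sigma>) ((\<alpha> / 2 * (\<alpha> / 2)) ^ 2 ^ r) (\<alpha> / 2)"
  have "0 < (\<epsilon>\<^sup>2 / 4) ^ 2 ^ r" using \<open>0 < \<epsilon>\<close> by simp
  then have "\<forall>\<^sub>F d in sequentially. ?rate d < (\<epsilon>\<^sup>2 / 4) ^ 2 ^ r"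
    by (rule order_tendstoD(2)[OF contraction_rate_tendsto_0])
  then have "\<forall>\<^sub>F d in sequentially. ?rate d < (\<epsilon>\<^sup>2 / 4) ^ 2 ^ r \<and> 1 \<le> d"
    by (intro eventually_conj eventually_ge_at_top)
  then obtain d where d: "?rate d < (\<epsilon>\<^sup>2 / 4) ^ 2 ^ r" "1 \<le> d"
    using eventually_happens'[OF sequentially_bot] by blast
  define \<rho> where "\<rho> = \<alpha> ^ d / 2"
  have "\<forall>\<^sub>F t in at_right (0::real). c * t < 1 / d \<and> real d * t < \<rho> \<and> 4 * (real d * t) < \<epsilon> * \<rho> \<and> t < \<alpha> / 4 \<and> 0 < t"
  proof (intro eventually_conj)
    have linear: "((\<lambda>t. a * t) \<longlongrightarrow> 0) (at_right 0)" for a :: real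
      by (rule tendsto_mult_right_zero) (rule tendsto_ident_at)
    show "\<forall>\<^sub>F t in at_right (0::real). c * t < 1 / d"
      using d(2) by (intro order_tendstoD(2)[OF linear]) simp
    show "\<forall>\<^sub>F t in at_right (0::real). real d * t < \<rho>"
      using \<open>0 < \<alpha>\<close> by (intro order_tendstoD(2)[OF linear]) (simp add: \<rho>_def)
    show "\<forall>\<^sub>F t in at_right (0::real). 4 * (real d * t) < \<epsilon> * \<rho>"
      using assms by (intro order_tendstoD(2)[OF tendsto_mult_right_zero[OF linear]]) (simp add: \<rho>_def)
    show "\<forall>\<^sub>F t in at_right (0::real). t < \<alpha> / 4"
      using \<open>0 < \<alpha>\<close> by (intro order_tendstoD(2)[OF tendsto_ident_at]) simp
  qed (rule eventually_at_right_less)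
  then obtain t where t: "c * t < 1 / d" "real d * t < \<rho>" "4 * (real d * t) < \<epsilon> * \<rho>" "t < \<alpha> / 4" "0 < t"
    using eventually_happens'[OF trivial_limit_at_right_real] by blast
  show ?thesis
  proof (intro exI[of _ t] conjI allI impI)
    fix n U V \<mu> \<mu>' q f g
    assume "two_near_product_laws n \<Sigma> \<Sigma>' U V \<mu> \<mu>' q \<alpha> t"
    then show "\<bar>measure_pmf.expectation \<mu> (\<lambda>(x, y). f x * g y) - measure_pmf.expectation \<mu>' (\<lambda>(x, y). f x * g y)\<bar>
        \<le> \<epsilon> * norm2 U f * norm2 V g"
      using d t unfolding c_def r_def \<rho>_def
      by (intro two_near_product_laws.forms_close[where d = d] \<open>0 < \<epsilon>\<close>) (auto simp: mult_ac)
  qed (use t in auto)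
qed

section \<open>Gluing couplings along a product law\<close>

definition fst_given :: "('a \<times> 'b) pmf \<Rightarrow> 'b \<Rightarrow> 'a pmf" where
  "fst_given C y = map_pmf fst (cond_pmf C {p. snd p = y})"

lemma coupling_op_eq: "coupling_op C f y = measure_pmf.expectation (fst_given C y) f"
  by (simp add: coupling_op_def fst_given_def)

lemma set_cond_pmf_snd:
  "y \<in> snd ` set_pmf C \<Longrightarrow> set_pmf (cond_pmf C {p. snd p = y}) = set_pmf C \<inter> {p. snd p = y}"
  by (rule set_cond_pmf) auto

lemma finite_set_fst_given: "finite (set_pmf C) \<Longrightarrow> y \<in> snd ` set_pmf C \<Longrightarrow> finite (set_pmf (fst_given C y))"
  by (simp add: fst_given_def set_cond_pmf_snd)

lemma map_fst_given:
  assumes "y \<in> snd ` set_pmf C"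
  shows "map_pmf (\<lambda>x. (x, y)) (fst_given C y) = cond_pmf C {p. snd p = y}"
proof -
  have "map_pmf (\<lambda>p. (fst p, y)) (cond_pmf C {p. snd p = y}) = map_pmf (\<lambda>p. p) (cond_pmf C {p. snd p = y})"
    by (rule map_pmf_cong) (use set_cond_pmf_snd[OF assms] in auto)
  then show ?thesis by (simp add: fst_given_def map_pmf_comp)
qed

lemma bind_fst_given:
  fixes C :: "('a \<times> 'b) pmf"
  shows "bind_pmf (map_pmf snd C) (\<lambda>y. map_pmf (\<lambda>x. (x, y)) (fst_given C y)) = C"
proof -
  have "bind_pmf (map_pmf snd C) (\<lambda>y. cond_pmf C {p. snd p = y}) = C"
  proof (rule bind_cond_pmf_cancel)
    fix y and p :: "'a \<times> 'b" assume "snd p = y"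
    then have "{x. snd p = x} = {y}" "snd -` {y} = {p :: 'a \<times> 'b. snd p = y}" by auto
    then show "measure_pmf.prob C {p. snd p = y} = measure_pmf.prob (map_pmf snd C) {x. snd p = x}"
      by (simp only: measure_map_pmf)
  qed auto
  moreover have "bind_pmf (map_pmf snd C) (\<lambda>y. map_pmf (\<lambda>x. (x, y)) (fst_given C y)) =
      bind_pmf (map_pmf snd C) (\<lambda>y. cond_pmf C {p. snd p = y})"
    by (intro bind_pmf_cong refl map_fst_given) simp
  ultimately show ?thesis by simp
qed

lemma fst_given_comp:
  fixes C :: "((nat \<Rightarrow> 'a) \<times> (nat \<Rightarrow> 'b)) pmf"
  assumes sym: "symmetric n C" and \<pi>: "\<pi> permutes {1..n}" and y: "y \<in> snd ` set_pmf C"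
  shows "fst_given C (y \<circ> \<pi>) = map_pmf (\<lambda>x. x \<circ> \<pi>) (fst_given C y)"
proof -
  let ?F = "\<lambda>(x :: nat \<Rightarrow> 'a, y :: nat \<Rightarrow> 'b). (x \<circ> \<pi>, y \<circ> \<pi>)"
  have "z = y" if "z \<circ> \<pi> = y \<circ> \<pi>" for z :: "nat \<Rightarrow> 'b"
    using arg_cong[OF that, of "\<lambda>z. z \<circ> inv \<pi>"] permutes_inv_o(1)[OF \<pi>] by (simp add: comp_assoc)
  then have vimage: "?F -` {p. snd p = y \<circ> \<pi>} = {p. snd p = y}" by auto
  have "cond_pmf (map_pmf ?F C) {p. snd p = y \<circ> \<pi>} = map_pmf ?F (cond_pmf C (?F -` {p. snd p = y \<circ> \<pi>}))"
    by (rule cond_map_pmf) (use y in \<open>auto simp: vimage\<close>)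
  moreover have "map_pmf ?F C = C" using sym \<pi> by (simp add: symmetric_def)
  ultimately have "cond_pmf C {p. snd p = y \<circ> \<pi>} = map_pmf ?F (cond_pmf C {p. snd p = y})"
    by (simp only: vimage)
  then show ?thesis
    by (simp add: fst_given_def map_pmf_comp split_def)
qed

definition glue :: "'z pmf \<Rightarrow> ('z \<Rightarrow> 'c) \<Rightarrow> ('a \<times> 'c) pmf \<Rightarrow> ('z \<Rightarrow> 'd) \<Rightarrow> ('b \<times> 'd) pmf \<Rightarrow> (('a \<times> 'b) \<times> 'z) pmf" where
  "glue Z a C b C' = bind_pmf Z (\<lambda>z. map_pmf (\<lambda>w. (w, z)) (pair_pmf (fst_given C (a z)) (fst_given C' (b z))))"

lemma map_snd_glue: "map_pmf snd (glue Z a C b C') = Z"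
  by (simp add: glue_def map_bind_pmf map_pmf_comp map_pmf_const bind_return_pmf')

lemma map_fst_glue:
  "map_pmf fst (glue Z a C b C') = bind_pmf Z (\<lambda>z. pair_pmf (fst_given C (a z)) (fst_given C' (b z)))"
  by (simp add: glue_def map_bind_pmf map_pmf_comp)

lemma glue_swap: "map_pmf (\<lambda>w. (prod.swap (fst w), snd w)) (glue Z a C b C') = glue Z b C' a C"
  unfolding glue_def map_bind_pmf
  by (subst (2) pair_commute_pmf) (simp add: map_pmf_comp split_def prod.swap_def)

lemma map_glue_left:
  assumes "map_pmf a Z = map_pmf snd C"
  shows "map_pmf (\<lambda>w. (fst (fst w), a (snd w))) (glue Z a C b C') = C"
proof -
  have "map_pmf (\<lambda>w. (fst (fst w), a (snd w))) (glue Z a C b C') =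
      bind_pmf Z (\<lambda>z. map_pmf (\<lambda>x. (x, a z)) (map_pmf fst (pair_pmf (fst_given C (a z)) (fst_given C' (b z)))))"
    by (simp add: glue_def map_bind_pmf map_pmf_comp del: map_fst_pair_pmf)
  also have "\<dots> = bind_pmf (map_pmf a Z) (\<lambda>y. map_pmf (\<lambda>x. (x, y)) (fst_given C y))"
    by (simp add: map_fst_pair_pmf bind_map_pmf)
  finally show ?thesis by (simp only: assms bind_fst_given)
qed

lemma map_glue_right:
  assumes "map_pmf b Z = map_pmf snd C'"
  shows "map_pmf (\<lambda>w. (snd (fst w), b (snd w))) (glue Z a C b C') = C'"
  using map_glue_left[OF assms, of a C] unfolding glue_swap[of Z a C b C', symmetric]
  by (simp add: map_pmf_comp)

lemma expectation_pair_pmf_mult: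
  fixes f :: "'a \<Rightarrow> real" and g :: "'b \<Rightarrow> real"
  assumes "finite (set_pmf p)" "finite (set_pmf q)"
  shows "measure_pmf.expectation (pair_pmf p q) (\<lambda>(x, y). f x * g y) =
    measure_pmf.expectation p f * measure_pmf.expectation q g"
proof -
  have "measure_pmf.expectation (pair_pmf p q) (\<lambda>(x, y). f x * g y) =
      (\<Sum>w\<in>set_pmf p \<times> set_pmf q. f (fst w) * g (snd w) * pmf (pair_pmf p q) w)"
    using assms by (subst integral_measure_pmf_real[of "set_pmf p \<times> set_pmf q"]) (auto simp: split_def)
  also have "\<dots> = (\<Sum>a\<in>set_pmf p. \<Sum>b\<in>set_pmf q. (f a * pmf p a) * (g b * pmf q b))"
    by (subst sum.cartesian_product) (auto simp: pmf_pair intro!: sum.cong)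
  also have "\<dots> = (\<Sum>a\<in>set_pmf p. f a * pmf p a) * (\<Sum>b\<in>set_pmf q. g b * pmf q b)"
    by (simp only: sum_product)
  finally show ?thesis
    using assms by (simp add: integral_measure_pmf_real[of "set_pmf p"] integral_measure_pmf_real[of "set_pmf q"])
qed

lemma expectation_glue:
  assumes fin: "finite (set_pmf Z)" "finite (set_pmf C)" "finite (set_pmf C')"
    and marginals: "map_pmf a Z = map_pmf snd C" "map_pmf b Z = map_pmf snd C'"
  shows "measure_pmf.expectation (map_pmf fst (glue Z a C b C')) (\<lambda>(x, y). f x * g y) =
    measure_pmf.expectation Z (\<lambda>z. coupling_op C f (a z) * coupling_op C' g (b z))"
proof -
  have "a z \<in> snd ` set_pmf C" "b z \<in> snd ` set_pmf C'" if "z \<in> set_pmf Z" for z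
    using that arg_cong[OF marginals(1), of set_pmf] arg_cong[OF marginals(2), of set_pmf] by auto
  then have fin_given: "finite (set_pmf (fst_given C (a z)))" "finite (set_pmf (fst_given C' (b z)))"
    if "z \<in> set_pmf Z" for z
    using that fin by (simp_all add: finite_set_fst_given)
  have "measure_pmf.expectation (map_pmf fst (glue Z a C b C')) (\<lambda>(x, y). f x * g y) =
      (\<Sum>z\<in>set_pmf Z. pmf Z z *\<^sub>R
        measure_pmf.expectation (pair_pmf (fst_given C (a z)) (fst_given C' (b z))) (\<lambda>(x, y). f x * g y))"
    unfolding map_fst_glue by (rule pmf_expectation_bind[OF fin(1)]) (simp_all add: fin_given)
  also have "\<dots> = (\<Sum>z\<in>set_pmf Z. (coupling_op C f (a z) * coupling_op C' g (b z)) * pmf Z z)"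
    by (intro sum.cong refl) (simp add: expectation_pair_pmf_mult[OF fin_given] coupling_op_eq)
  finally show ?thesis
    by (simp only: integral_measure_pmf_real[OF fin(1)])
qed

lemma fst_snd_vec_comp:
  fixes n :: nat
  assumes "\<pi> permutes {1..n}"
  shows "fst_vec n (z \<circ> \<pi>) = fst_vec n z \<circ> \<pi>" and "snd_vec n (z \<circ> \<pi>) = snd_vec n z \<circ> \<pi>"
  using permutes_in_image[OF assms] by (auto simp: fst_vec_def snd_vec_def fun_eq_iff restrict_def)

lemma map_comp_Pi_pmf:
  fixes n :: nat
  assumes "\<pi> permutes {1..n}"
  shows "map_pmf (\<lambda>z. z \<circ> \<pi>) (Pi_pmf {1..n} d (\<lambda>_. q)) = Pi_pmf {1..n} d (\<lambda>_. q)"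
  by (rule Pi_pmf_bij_betw[symmetric, OF finite_atLeastAtMost permutes_imp_bij[OF assms]])
    (simp only: permutes_in_image[OF assms] not_False_eq_True)

locale product_gluing =
  fixes n :: nat and q :: "('a \<times> 'b) pmf" and C :: "((nat \<Rightarrow> 'a) \<times> (nat \<Rightarrow> 'a)) pmf"
    and C' :: "((nat \<Rightarrow> 'b) \<times> (nat \<Rightarrow> 'b)) pmf"
  assumes finite_q: "finite (set_pmf q)"
    and finite_fst: "finite (set_pmf (map_pmf fst C))" "finite (set_pmf (map_pmf fst C'))"
    and snd_C: "map_pmf snd C = Pi_pmf {1..n} undefined (\<lambda>_. map_pmf fst q)"
    and snd_C': "map_pmf snd C' = Pi_pmf {1..n} undefined (\<lambda>_. map_pmf snd q)"
    and symmetric: "symmetric n C" "symmetric n C'"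
begin

abbreviation "product_law \<equiv> Pi_pmf {1..n} undefined (\<lambda>_. q)"

abbreviation "joint \<equiv> glue product_law (fst_vec n) C (snd_vec n) C'"

definition pullback :: "((nat \<Rightarrow> 'a) \<times> (nat \<Rightarrow> 'b)) pmf" where
  "pullback = map_pmf fst joint"

lemma marginals:
  "map_pmf (fst_vec n) product_law = map_pmf snd C" "map_pmf (snd_vec n) product_law = map_pmf snd C'"
  unfolding snd_C snd_C' fst_vec_def[abs_def] snd_vec_def[abs_def]
  by (rule map_Pi_pmf_restrict[OF finite_atLeastAtMost])+

lemma vec_in_snd_support:
  assumes "z \<in> set_pmf product_law"
  shows "fst_vec n z \<in> snd ` set_pmf C" "snd_vec n z \<in> snd ` set_pmf C'"
  using assms arg_cong[OF marginals(1), of set_pmf] arg_cong[OF marginals(2), of set_pmf] by auto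

lemma joint_left: "map_pmf (\<lambda>w. (fst (fst w), fst_vec n (snd w))) joint = C"
  and joint_right: "map_pmf (\<lambda>w. (snd (fst w), snd_vec n (snd w))) joint = C'"
  by (rule map_glue_left[OF marginals(1)] map_glue_right[OF marginals(2)])+

lemma set_pullback_subset: "set_pmf pullback \<subseteq> set_pmf (map_pmf fst C) \<times> set_pmf (map_pmf fst C')"
proof
  have "map_pmf fst pullback = map_pmf fst C" "map_pmf snd pullback = map_pmf fst C'"
    using arg_cong[OF joint_left, of "map_pmf fst"] arg_cong[OF joint_right, of "map_pmf fst"]
    by (simp_all add: pullback_def map_pmf_comp)
  moreover fix w assume "w \<in> set_pmf pullback"
  then have "fst w \<in> set_pmf (map_pmf fst pullback)" "snd w \<in> set_pmf (map_pmf snd pullback)"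
    by simp_all
  ultimately show "w \<in> set_pmf (map_pmf fst C) \<times> set_pmf (map_pmf fst C')"
    by (simp only: mem_Times_iff)
qed

lemma symmetric_pullback: "symmetric n pullback"
  unfolding symmetric_def
proof (intro allI impI)
  fix \<pi> assume \<pi>: "\<pi> permutes {1..n}"
  let ?pair = "\<lambda>z. pair_pmf (fst_given C (fst_vec n z)) (fst_given C' (snd_vec n z))"
  have "map_pmf (\<lambda>(x, x'). (x \<circ> \<pi>, x' \<circ> \<pi>)) pullback = bind_pmf product_law (\<lambda>z. ?pair (z \<circ> \<pi>))"
    unfolding pullback_def map_fst_glue map_bind_pmf
    by (intro bind_pmf_cong refl)
      (simp add: fst_snd_vec_comp[OF \<pi>] fst_given_comp[OF symmetric(1) \<pi> vec_in_snd_support(1)]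
        fst_given_comp[OF symmetric(2) \<pi> vec_in_snd_support(2)] map_pair)
  also have "\<dots> = bind_pmf (map_pmf (\<lambda>z. z \<circ> \<pi>) product_law) ?pair"
    by (simp add: bind_map_pmf)
  also have "\<dots> = pullback"
    by (simp only: map_comp_Pi_pmf[OF \<pi>] pullback_def map_fst_glue)
  finally show "map_pmf (\<lambda>(x, x'). (x \<circ> \<pi>, x' \<circ> \<pi>)) pullback = pullback" .
qed

lemma coordwise_close_pullback:
  fixes \<zeta> :: real
  assumes dev: "\<And>i. i \<in> {1..n} \<Longrightarrow> measure_pmf.prob C {(x, y). x i \<noteq> y i} \<le> \<zeta>"
    "\<And>i. i \<in> {1..n} \<Longrightarrow> measure_pmf.prob C' {(x, y). x i \<noteq> y i} \<le> \<zeta>"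
  shows "coordwise_close n pullback q (2 * \<zeta>)"
  unfolding coordwise_close_def
proof (intro exI[of _ joint] conjI ballI)
  fix i assume i: "i \<in> {1..n}"
  have "measure_pmf.prob joint {w. fst (fst w) i \<noteq> fst (snd w i)} \<le> \<zeta>"
    using dev(1)[OF i] i by (subst (asm) joint_left[symmetric]) (simp add: vimage_def fst_vec_def)
  moreover have "measure_pmf.prob joint {w. snd (fst w) i \<noteq> snd (snd w i)} \<le> \<zeta>"
    using dev(2)[OF i] i by (subst (asm) joint_right[symmetric]) (simp add: vimage_def snd_vec_def)
  moreover have "{w. letters_at i (fst w) \<noteq> snd w i} =
      {w. fst (fst w) i \<noteq> fst (snd w i)} \<union> {w :: _ \<times> (nat \<Rightarrow> 'a \<times> 'b). snd (fst w) i \<noteq> snd (snd w i)}"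
    by (auto simp: letters_at_def prod_eq_iff)
  ultimately show "measure_pmf.prob joint {w. letters_at i (fst w) \<noteq> snd w i} \<le> 2 * \<zeta>"
    using measure_Un_le[of "{w. fst (fst w) i \<noteq> fst (snd w i)}" joint "{w. snd (fst w) i \<noteq> snd (snd w i)}"] by simp
qed (simp_all add: pullback_def map_snd_glue)

lemma expectation_pullback:
  "measure_pmf.expectation pullback (\<lambda>(x, y). f x * g y) =
    measure_pmf.expectation product_law (\<lambda>z. coupling_op C f (fst_vec n z) * coupling_op C' g (snd_vec n z))"
proof -
  have "finite (set_pmf (map_pmf snd C))" "finite (set_pmf (map_pmf snd C'))"
    unfolding snd_C snd_C' using finite_q by (auto intro: finite_set_Pi_pmf)
  then show ?thesis
    unfolding pullback_def using finite_fst finite_q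
    by (intro expectation_glue marginals finite_set_pmf_of_marginals finite_set_Pi_pmf) auto
qed

end

section \<open>Multislices\<close>

lemma finite_multislice: "finite (multislice n m k)"
  unfolding multislice_def by (rule finite_subset[of _ "{1..n} \<rightarrow>\<^sub>E {1..m}"]) (auto intro: finite_PiE)

lemma multisliceD:
  assumes "x \<in> multislice n m k"
  shows "x \<in> {1..n} \<rightarrow>\<^sub>E {1..m}" and "c \<in> {1..m} \<Longrightarrow> card (positions n x c) = k c"
  using assms unfolding multislice_def positions_def by blast+

lemma card_positions_multislice:
  assumes "x \<in> multislice n m k"
  shows "card (positions n x c) = (if c \<in> {1..m} then k c else 0)"
proof (cases "c \<in> {1..m}")
  case False
  then have "positions n x c = {}" using multisliceD(1)[OF assms] unfolding positions_def by blast
  then show ?thesis by (simp only: False if_False card.empty)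
qed (simp add: multisliceD(2)[OF assms])

lemma multislice_comp:
  assumes x: "x \<in> multislice n m k" and \<pi>: "\<pi> permutes {1..n}"
  shows "x \<circ> \<pi> \<in> multislice n m k"
proof -
  have "x \<circ> \<pi> \<in> {1..n} \<rightarrow>\<^sub>E {1..m}"
  proof (rule PiE_I)
    fix i assume "i \<in> {1..n}"
    then show "(x \<circ> \<pi>) i \<in> {1..m}"
      using PiE_mem[OF multisliceD(1)[OF x]] permutes_in_image[OF \<pi>] by (simp only: comp_apply)
  next
    fix i assume "i \<notin> {1..n}"
    then show "(x \<circ> \<pi>) i = undefined"
      using PiE_arb[OF multisliceD(1)[OF x]] permutes_not_in[OF \<pi>] by (metis comp_apply)
  qed
  moreover have "card {i\<in>{1..n}. (x \<circ> \<pi>) i = c} = k c" if "c \<in> {1..m}" for c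
    using card_positions_comp[OF \<pi>, of x c] multisliceD(2)[OF x that] by (simp only: positions_def)
  ultimately show ?thesis unfolding multislice_def by blast
qed

lemma multislice_transitive:
  assumes x: "x \<in> multislice n m k" and y: "y \<in> multislice n m k" and J: "J \<subseteq> {1..n}" and agree: "agree_on J x y"
  shows "\<exists>\<pi>. \<pi> permutes {1..n} - J \<and> y = x \<circ> \<pi>"
proof -
  have card_fibre: "card {i\<in>{1..n} - J. z i = c} = card (positions n z c) - card {i\<in>J. z i = c}"
    for z :: "nat \<Rightarrow> nat" and c
  proof -
    have "{i\<in>{1..n} - J. z i = c} = positions n z c - {i\<in>J. z i = c}" by (auto simp: positions_def)
    moreover have "{i\<in>J. z i = c} \<subseteq> positions n z c" using J by (auto simp: positions_def)
    ultimately show ?thesis using finite_subset[OF J] by (simp add: card_Diff_subset)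
  qed
  have "{i\<in>J. y i = c} = {i\<in>J. x i = c}" for c using agree by (auto simp: agree_on_def)
  then have "card {i\<in>{1..n} - J. y i = c} = card {i\<in>{1..n} - J. x i = c}" for c
    by (simp only: card_fibre card_positions_multislice[OF x] card_positions_multislice[OF y])
  from ex_permutes_of_card_fibres_eq[OF _ this] obtain \<pi>
    where \<pi>: "\<pi> permutes {1..n} - J" "\<forall>i\<in>{1..n} - J. y i = x (\<pi> i)" by blast
  have "y i = x (\<pi> i)" for i
  proof (cases "i \<in> {1..n} - J")
    case False
    then have "y i = x i"
      using agree PiE_arb[OF multisliceD(1)[OF x], of i] PiE_arb[OF multisliceD(1)[OF y], of i]
      by (cases "i \<in> J") (auto simp: agree_on_def)
    then show ?thesis by (simp add: permutes_not_in[OF \<pi>(1) False])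
  qed (use \<pi>(2) in blast)
  then show ?thesis using \<pi>(1) by (intro exI[of _ \<pi>]) auto
qed

lemma perm_orbit_multislice:
  assumes "multislice n m k \<noteq> {}"
  shows "perm_orbit n {1..m} (multislice n m k)"
proof
  show "x i \<in> {1..m}" if "x \<in> multislice n m k" "i \<in> {1..n}" for x i
    using PiE_mem[OF multisliceD(1)[OF that(1)] that(2)] .
qed (rule finite_atLeastAtMost finite_multislice assms multislice_comp multislice_transitive; assumption)+

lemma symmetric_law_multislice:
  assumes supp: "set_pmf \<mu> \<subseteq> multislice n m k \<times> multislice n m' k'" and "symmetric n \<mu>"
  shows "symmetric_law n {1..m} {1..m'} (multislice n m k) (multislice n m' k') \<mu>"
proof -
  have "multislice n m k \<noteq> {}" "multislice n m' k' \<noteq> {}"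
    using supp set_pmf_not_empty[of \<mu>] by auto
  then show ?thesis
    using assms by (intro symmetric_law.intro symmetric_law_axioms.intro perm_orbit_multislice)
qed

lemma letter_occurs_of_balanced:
  assumes "balanced \<alpha> n m k" "0 < \<alpha>" "1 \<le> n" "x \<in> multislice n m k" "c \<in> {1..m}"
  shows "\<exists>i\<in>{1..n}. x i = c"
proof -
  have "0 < \<alpha> * n" using assms(2,3) by simp
  also have "\<alpha> * n \<le> k c" using assms(1,5) by (simp add: balanced_def)
  finally have "positions n x c \<noteq> {}" using multisliceD(2)[OF assms(4,5)] by auto
  then show ?thesis by (auto simp: positions_def)
qed

section \<open>The law of a pair of letters\<close>

lemma letter_law_eq_of_symmetric:
  assumes "symmetric n \<mu>" "i \<in> {1..n}" "j \<in> {1..n}"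
  shows "map_pmf (letters_at i) \<mu> = map_pmf (letters_at j) \<mu>"
proof -
  let ?t = "Transposition.transpose i j"
  have "?t permutes {1..n}" using assms by (intro permutes_swap_id)
  then have "map_pmf (letters_at i) \<mu> = map_pmf (letters_at i) (map_pmf (\<lambda>(x, x'). (x \<circ> ?t, x' \<circ> ?t)) \<mu>)"
    using assms(1) by (simp add: symmetric_def)
  also have "\<dots> = map_pmf (letters_at j) \<mu>"
    by (simp add: map_pmf_comp split_def letters_at_def[abs_def])
  finally show ?thesis .
qed

lemma product_version_eq:
  assumes "symmetric n \<mu>"
  shows "product_version n \<mu> = Pi_pmf {1..n} undefined (\<lambda>_. map_pmf (letters_at 1) \<mu>)"
proof -
  have "map_pmf (\<lambda>(x, x'). (x i, x' i)) \<mu> = map_pmf (letters_at 1) \<mu>" if "i \<in> {1..n}" for i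
  proof -
    have "map_pmf (\<lambda>(x, x'). (x i, x' i)) \<mu> = map_pmf (letters_at i) \<mu>"
      by (simp add: letters_at_def[abs_def] split_def)
    then show ?thesis using letter_law_eq_of_symmetric[OF assms that, of 1] that by simp
  qed
  then show ?thesis
    unfolding product_version_def by (intro Pi_pmf_cong) simp_all
qed

lemma pair_freq_eq:
  assumes "symmetric n \<mu>" "1 \<le> n"
  shows "pair_freq n \<mu> a = pmf (map_pmf (letters_at 1) \<mu>) a"
proof -
  let ?u = "pmf_of_set {1..n}"
  have "map_pmf (\<lambda>(w, i). letters_at i w) (pair_pmf \<mu> ?u) = bind_pmf ?u (\<lambda>i. map_pmf (letters_at i) \<mu>)"
    unfolding pair_pmf_def map_pmf_def
    by (subst bind_commute_pmf) (simp add: bind_assoc_pmf bind_return_pmf)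
  also have "\<dots> = bind_pmf ?u (\<lambda>_. map_pmf (letters_at 1) \<mu>)"
    using assms by (intro bind_pmf_cong refl letter_law_eq_of_symmetric[OF assms(1)]) (auto simp: set_pmf_of_set)
  finally have "map_pmf (letters_at 1) \<mu> = map_pmf (\<lambda>(w, i). letters_at i w) (pair_pmf \<mu> ?u)"
    by (simp add: bind_pmf_const)
  then have "pmf (map_pmf (letters_at 1) \<mu>) a =
      measure_pmf.prob (pair_pmf \<mu> ?u) ((\<lambda>(w, i). letters_at i w) -` {a})"
    by (simp only: pmf_map)
  also have "(\<lambda>(w, i). letters_at i w) -` {a} = {((x, x'), i). x i = fst a \<and> x' i = snd a}"
    by (auto simp: letters_at_def)
  finally show ?thesis by (simp add: pair_freq_def)
qed

lemma fst_letter_law_multislice: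
  assumes supp: "set_pmf \<mu> \<subseteq> multislice n m k \<times> multislice n m' k'" and sym: "symmetric n \<mu>"
    and n: "1 \<le> n" and k: "(\<Sum>j=1..m. k j) = n"
  shows "map_pmf fst (map_pmf (letters_at 1) \<mu>) = freq_pmf n m k"
proof (rule pmf_eqI)
  interpret symmetric_law n "{1..m}" "{1..m'}" "multislice n m k" "multislice n m' k'" \<mu>
    by (rule symmetric_law_multislice[OF supp sym])
  fix c
  obtain x where x: "x \<in> multislice n m k" using U.nonempty by blast
  have letter: "measure_pmf.prob \<mu> {w. fst w i = c} = pmf (map_pmf fst (map_pmf (letters_at 1) \<mu>)) c"
    if "i \<in> {1..n}" for i
  proof -
    have "map_pmf (letters_at 1) \<mu> = map_pmf (letters_at i) \<mu>"
      using that n by (intro letter_law_eq_of_symmetric[OF sym]) auto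
    then show ?thesis by (simp add: pmf_map vimage_def letters_at_def)
  qed
  have "n * pmf (map_pmf fst (map_pmf (letters_at 1) \<mu>)) c =
      (\<Sum>i\<in>{1..n}. pmf (map_pmf fst (map_pmf (letters_at 1) \<mu>)) c)" by simp
  also have "\<dots> = (\<Sum>i\<in>{1..n}. measure_pmf.prob \<mu> {w. fst w i = c})"
    by (rule sum.cong[OF refl letter[symmetric]])
  also have "\<dots> = (if c \<in> {1..m} then real (k c) else 0)"
    by (simp only: sum_prob_fst_letter_eq_card_positions[OF x] card_positions_multislice[OF x]) simp
  finally show "pmf (map_pmf fst (map_pmf (letters_at 1) \<mu>)) c = pmf (freq_pmf n m k) c"
    unfolding pmf_freq_pmf[OF n k] using n by (simp add: field_simps split: if_splits)
qed

lemma snd_letter_law_multislice: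
  assumes supp: "set_pmf \<mu> \<subseteq> multislice n m k \<times> multislice n m' k'" and sym: "symmetric n \<mu>"
    and n: "1 \<le> n" and k': "(\<Sum>j=1..m'. k' j) = n"
  shows "map_pmf snd (map_pmf (letters_at 1) \<mu>) = freq_pmf n m' k'"
proof -
  have "map_pmf fst (map_pmf (letters_at 1) (map_pmf prod.swap \<mu>)) = freq_pmf n m' k'"
    using supp by (intro fst_letter_law_multislice[OF _ symmetric_swap[OF sym] n k', where m' = m and k' = k]) auto
  then show ?thesis by (simp add: map_pmf_comp letters_at_def)
qed

lemma is_couplingD:
  assumes "is_coupling n \<alpha> \<zeta> \<nu>\<^sub>1 \<nu>\<^sub>2 C"
  shows "map_pmf fst C = \<nu>\<^sub>1" "map_pmf snd C = \<nu>\<^sub>2" "symmetric n C"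
    "i \<in> {1..n} \<Longrightarrow> measure_pmf.prob C {(x, y). x i \<noteq> y i} \<le> \<zeta>"
  using assms unfolding is_coupling_def by blast+

lemma coordwise_close_of_coupling:
  assumes supp: "set_pmf \<mu> \<subseteq> ({1..n} \<rightarrow>\<^sub>E A) \<times> ({1..n} \<rightarrow>\<^sub>E B)" and sym: "symmetric n \<mu>"
    and coupling: "is_coupling n \<alpha> \<zeta> (map_pmf (zip_vec n) \<mu>) (product_version n \<mu>) C"
  shows "coordwise_close n \<mu> (map_pmf (letters_at 1) \<mu>) \<zeta>"
  unfolding coordwise_close_def
proof (intro exI conjI ballI)
  let ?unzip = "\<lambda>z. (fst_vec n z, snd_vec n z)"
  let ?R = "map_pmf (\<lambda>w. (?unzip (fst w), snd w)) C"
  have "?unzip (zip_vec n w) = w" if "w \<in> set_pmf \<mu>" for w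
  proof -
    have w: "fst w \<in> {1..n} \<rightarrow>\<^sub>E A" "snd w \<in> {1..n} \<rightarrow>\<^sub>E B" using subsetD[OF supp that] by (simp_all only: mem_Times_iff)
    have "?unzip (zip_vec n w) = (restrict (fst w) {1..n}, restrict (snd w) {1..n})"
      by (simp add: fst_vec_def snd_vec_def zip_vec_def split_def restrict_def fun_eq_iff)
    then show ?thesis by (simp only: w[THEN PiE_restrict] prod.collapse)
  qed
  then have unzip: "map_pmf ?unzip (map_pmf (zip_vec n) \<mu>) = map_pmf (\<lambda>w. w) \<mu>"
    unfolding map_pmf_comp by (intro map_pmf_cong refl)
  have "map_pmf fst ?R = map_pmf ?unzip (map_pmf fst C)" by (simp add: map_pmf_comp)
  then show "map_pmf fst ?R = \<mu>" by (simp only: is_couplingD(1)[OF coupling] unzip pmf.map_ident)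
  show "map_pmf snd ?R = Pi_pmf {1..n} undefined (\<lambda>_. map_pmf (letters_at 1) \<mu>)"
    using is_couplingD(2)[OF coupling] by (simp add: map_pmf_comp product_version_eq[OF sym])
  fix i assume i: "i \<in> {1..n}"
  have "measure_pmf.prob ?R {w. letters_at i (fst w) \<noteq> snd w i} = measure_pmf.prob C {(x, y). x i \<noteq> y i}"
    using i by (simp add: vimage_def letters_at_def fst_vec_def snd_vec_def split_def)
  then show "measure_pmf.prob ?R {w. letters_at i (fst w) \<noteq> snd w i} \<le> \<zeta>"
    using is_couplingD(4)[OF coupling i] by simp
qed

lemma bipartite_invariant:
  assumes "(u, v) \<in> (bipartite_edges E)\<^sup>*" "\<And>x y. (x, y) \<in> E \<Longrightarrow> S (Inl x) = S (Inr y)"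
  shows "S u = S v"
  using assms(1) by induction (auto simp: bipartite_edges_def assms(2))

context symmetric_law
begin

lemma fst_set_pmf_eq: "fst ` set_pmf \<mu> = U"
proof (rule subset_antisym)
  show "U \<subseteq> fst ` set_pmf \<mu>"
  proof
    fix x assume "x \<in> U"
    then have "pmf (map_pmf fst \<mu>) x = 1 / card U"
      using prob_fst_eq_card[of "\<lambda>y. y = x"] by (simp add: pmf_map vimage_def Collect_conv_if conj_commute)
    then have "x \<in> set_pmf (map_pmf fst \<mu>)" using U.card_pos by (simp add: set_pmf_iff del: set_map_pmf)
    then show "x \<in> fst ` set_pmf \<mu>" by simp
  qed
qed (use supp in auto)

lemma letters_at_mem_letter_law:
  assumes "w \<in> set_pmf \<mu>" "i \<in> {1..n}"
  shows "letters_at i w \<in> set_pmf (map_pmf (letters_at 1) \<mu>)"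
proof -
  have "map_pmf (letters_at 1) \<mu> = map_pmf (letters_at i) \<mu>"
    using assms(2) by (intro letter_law_eq_of_symmetric[OF sym]) auto
  then show ?thesis using assms(1) by simp
qed

lemma fst_letter_law_support:
  assumes "1 \<le> n" and occurs: "\<And>x c. x \<in> U \<Longrightarrow> c \<in> \<Sigma> \<Longrightarrow> \<exists>i\<in>{1..n}. x i = c"
  shows "fst ` set_pmf (map_pmf (letters_at 1) \<mu>) = \<Sigma>"
proof (intro subset_antisym subsetI)
  fix c assume "c \<in> fst ` set_pmf (map_pmf (letters_at 1) \<mu>)"
  then obtain w where "w \<in> set_pmf \<mu>" "c = fst w 1" by (auto simp: letters_at_def)
  then show "c \<in> \<Sigma>" using supp U.letters[of "fst w" 1] assms(1) by auto
next
  fix c assume c: "c \<in> \<Sigma>"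
  obtain x where x: "x \<in> U" using U.nonempty by blast
  obtain i where i: "i \<in> {1..n}" "x i = c" using occurs[OF x c] by blast
  obtain w where w: "w \<in> set_pmf \<mu>" "fst w = x" using x fst_set_pmf_eq by (metis imageE)
  have "c = fst (letters_at i w)" using w(2) i(2) by (simp add: letters_at_def)
  then show "c \<in> fst ` set_pmf (map_pmf (letters_at 1) \<mu>)"
    using letters_at_mem_letter_law[OF w(1) i(1)] by (rule image_eqI)
qed

text \<open>Otherwise the set of coordinates whose letter lies in the component of \<open>b\<close> would be constant along the
  edges between vectors, hence constant; but a transposition moves it.\<close>

lemma letter_graph_connected:
  assumes connected: "connected_pmf \<mu>" and occurs: "\<And>x c. x \<in> U \<Longrightarrow> c \<in> \<Sigma> \<Longrightarrow> \<exists>i\<in>{1..n}. x i = c"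
    and b: "b \<in> \<Sigma>" and c: "c \<in> \<Sigma>"
  defines "E \<equiv> set_pmf (map_pmf (letters_at 1) \<mu>)"
  shows "(b, c) \<in> (E O E\<inverse>)\<^sup>*"
proof -
  define A where "A = {a. (b, a) \<in> (E O E\<inverse>)\<^sup>*}"
  define S where "S = case_sum (\<lambda>x. {i\<in>{1..n}. x i \<in> A}) (\<lambda>y. {i\<in>{1..n}. y i \<in> E `` A})"
  have component: "a \<in> A \<longleftrightarrow> y \<in> E `` A" if "(a, y) \<in> E" for a y
    using that unfolding A_def by (auto intro: rtrancl_into_rtrancl)
  have edge: "S (Inl x) = S (Inr y)" if "(x, y) \<in> set_pmf \<mu>" for x y
  proof -
    have "(x i, y i) \<in> E" if "i \<in> {1..n}" for i
      using letters_at_mem_letter_law[OF \<open>(x, y) \<in> set_pmf \<mu>\<close> that] by (simp only: E_def letters_at_def fst_conv snd_conv)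
    then show ?thesis using component by (simp only: S_def sum.case) blast
  qed
  have S_eq: "S (Inl x) = S (Inl x')" if "x \<in> U" "x' \<in> U" for x x'
  proof (rule bipartite_invariant[OF _ edge])
    show "(Inl x, Inl x') \<in> (bipartite_edges (set_pmf \<mu>))\<^sup>*"
      using connected that unfolding connected_pmf_def bipartite_connected_def set_map_pmf fst_set_pmf_eq by blast
  qed
  obtain x where x: "x \<in> U" using U.nonempty by blast
  obtain i j where i: "i \<in> {1..n}" "x i = b" and j: "j \<in> {1..n}" "x j = c"
    using occurs[OF x b] occurs[OF x c] by blast
  have "x \<circ> Transposition.transpose i j \<in> U" by (rule U.comp_closed[OF x permutes_swap_id[OF i(1) j(1)]])
  from S_eq[OF x this] have "i \<in> S (Inl x) \<longleftrightarrow> i \<in> S (Inl (x \<circ> Transposition.transpose i j))" by simp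
  then have "b \<in> A \<longleftrightarrow> c \<in> A" using i j by (simp add: S_def)
  then show ?thesis by (simp add: A_def)
qed

lemma connected_letter_law:
  assumes n: "1 \<le> n" and connected: "connected_pmf \<mu>" and admissible: "admissible \<alpha> n \<mu>"
    and occurs: "\<And>x c. x \<in> U \<Longrightarrow> c \<in> \<Sigma> \<Longrightarrow> \<exists>i\<in>{1..n}. x i = c"
      "\<And>y c. y \<in> V \<Longrightarrow> c \<in> \<Sigma>' \<Longrightarrow> \<exists>i\<in>{1..n}. y i = c"
  shows "connected_letter_law \<alpha> \<Sigma> \<Sigma>' (map_pmf (letters_at 1) \<mu>)"
  unfolding connected_letter_law_def
proof (intro conjI ballI)
  show "fst ` set_pmf (map_pmf (letters_at 1) \<mu>) = \<Sigma>"
    by (rule fst_letter_law_support[OF n occurs(1)])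
  show "snd ` set_pmf (map_pmf (letters_at 1) \<mu>) = \<Sigma>'"
    using symmetric_law.fst_letter_law_support[OF symmetric_law_swap n occurs(2)]
    by (simp add: image_image letters_at_def)
  show "\<alpha> \<le> pmf (map_pmf (letters_at 1) \<mu>) e" if "e \<in> set_pmf (map_pmf (letters_at 1) \<mu>)" for e
  proof -
    have "pair_freq n \<mu> e \<noteq> 0" using that unfolding pair_freq_eq[OF sym n] set_pmf_iff .
    then have "\<alpha> \<le> pair_freq n \<mu> e" using admissible unfolding admissible_def by blast
    then show ?thesis by (simp only: pair_freq_eq[OF sym n])
  qed
qed (rule letter_graph_connected[OF connected occurs(1)])

end

lemma near_product_law_multislice:
  fixes \<alpha> t :: real
  assumes n: "1 \<le> n" and \<alpha>: "0 < \<alpha>" and t: "0 \<le> t" "t \<le> \<alpha> / 4"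
    and balanced: "balanced \<alpha> n m k" "balanced \<alpha> n m' k'"
    and supp: "set_pmf \<mu> \<subseteq> multislice n m k \<times> multislice n m' k'"
    and connected: "connected_pmf \<mu>" and admissible: "admissible \<alpha> n \<mu>"
    and \<nu>: "set_pmf \<nu> \<subseteq> multislice n m k \<times> multislice n m' k'" "symmetric n \<nu>"
      "coordwise_close n \<nu> (map_pmf (letters_at 1) \<mu>) t"
  shows "near_product_law n {1..m} {1..m'} (multislice n m k) (multislice n m' k') \<nu>
    (map_pmf (letters_at 1) \<mu>) \<alpha> t"
proof -
  interpret symmetric_law n "{1..m}" "{1..m'}" "multislice n m k" "multislice n m' k'" \<mu>
    using admissible by (intro symmetric_law_multislice[OF supp]) (simp add: admissible_def)
  have "connected_letter_law \<alpha> {1..m} {1..m'} (map_pmf (letters_at 1) \<mu>)"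
    by (rule connected_letter_law[OF n connected admissible letter_occurs_of_balanced[OF balanced(1) \<alpha> n]
          letter_occurs_of_balanced[OF balanced(2) \<alpha> n]])
  then show ?thesis
    using \<nu> \<alpha> t by (intro near_product_law.intro near_product_law_axioms.intro symmetric_law_multislice)
qed

lemma product_gluing_multislice:
  assumes n: "1 \<le> n" and k: "(\<Sum>j=1..m. k j) = n" "(\<Sum>j=1..m'. k' j) = n"
    and supp: "set_pmf \<mu> \<subseteq> multislice n m k \<times> multislice n m' k'" and sym: "symmetric n \<mu>"
    and C: "is_coupling n \<alpha> \<zeta> (pmf_of_set (multislice n m k)) (Pi_pmf {1..n} undefined (\<lambda>_. freq_pmf n m k)) C"
    and C': "is_coupling n \<alpha> \<zeta> (pmf_of_set (multislice n m' k')) (Pi_pmf {1..n} undefined (\<lambda>_. freq_pmf n m' k')) C'"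
  shows "product_gluing n (map_pmf (letters_at 1) \<mu>) C C'"
    and "set_pmf (map_pmf fst C) = multislice n m k" "set_pmf (map_pmf fst C') = multislice n m' k'"
proof -
  interpret symmetric_law n "{1..m}" "{1..m'}" "multislice n m k" "multislice n m' k'" \<mu>
    by (rule symmetric_law_multislice[OF supp sym])
  show fst_C: "set_pmf (map_pmf fst C) = multislice n m k" "set_pmf (map_pmf fst C') = multislice n m' k'"
    unfolding is_couplingD(1)[OF C] is_couplingD(1)[OF C']
    by (simp_all only: set_pmf_of_set U.nonempty U.finite_orbit V.nonempty V.finite_orbit not_False_eq_True)
  have "finite (set_pmf (map_pmf (letters_at 1) \<mu>))"
    using finite_subset[OF supp] by (simp add: finite_multislice)
  then show "product_gluing n (map_pmf (letters_at 1) \<mu>) C C'"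
    by (intro product_gluing.intro)
      (simp_all only: fst_C finite_multislice is_couplingD(2,3)[OF C] is_couplingD(2,3)[OF C']
        fst_letter_law_multislice[OF supp sym n k(1)] snd_letter_law_multislice[OF supp sym n k(2)])
qed

lemma ex_pullback_two_near_product_laws:
  fixes \<alpha> t :: real
  assumes n: "1 \<le> n" and k: "(\<Sum>j=1..m. k j) = n" "(\<Sum>j=1..m'. k' j) = n"
    and \<alpha>: "0 < \<alpha>" and t: "0 \<le> t" "t \<le> \<alpha> / 4"
    and balanced: "balanced \<alpha> n m k" "balanced \<alpha> n m' k'"
    and supp: "set_pmf \<mu> \<subseteq> multislice n m k \<times> multislice n m' k'"
    and connected: "connected_pmf \<mu>" and admissible: "admissible \<alpha> n \<mu>"
    and C: "is_coupling n \<alpha> (t / 2) (pmf_of_set (multislice n m k)) (Pi_pmf {1..n} undefined (\<lambda>_. freq_pmf n m k)) C"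
    and C': "is_coupling n \<alpha> (t / 2) (pmf_of_set (multislice n m' k')) (Pi_pmf {1..n} undefined (\<lambda>_. freq_pmf n m' k')) C'"
    and C'': "is_coupling n \<alpha> (t / 2) (map_pmf (zip_vec n) \<mu>) (product_version n \<mu>) C''"
  shows "\<exists>\<mu>'. two_near_product_laws n {1..m} {1..m'} (multislice n m k) (multislice n m' k') \<mu> \<mu>'
      (map_pmf (letters_at 1) \<mu>) \<alpha> t \<and>
    (\<forall>f g. measure_pmf.expectation \<mu>' (\<lambda>(x, x'). f x * g x') =
      measure_pmf.expectation (product_version n \<mu>) (\<lambda>z. coupling_op C f (fst_vec n z) * coupling_op C' g (snd_vec n z)))"
proof -
  have sym: "symmetric n \<mu>" using admissible by (simp add: admissible_def)
  note gluing = product_gluing_multislice[OF n k supp sym C C']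
  interpret product_gluing n "map_pmf (letters_at 1) \<mu>" C C' by (rule gluing(1))
  have "set_pmf \<mu> \<subseteq> ({1..n} \<rightarrow>\<^sub>E {1..m}) \<times> ({1..n} \<rightarrow>\<^sub>E {1..m'})"
    by (rule order_trans[OF supp Sigma_mono]) (use multisliceD(1) in blast)+
  then have "coordwise_close n \<mu> (map_pmf (letters_at 1) \<mu>) t"
    using coordwise_close_of_coupling[OF _ sym C''] t(1) by (intro coordwise_close_mono[of n \<mu> _ "t / 2" t]) auto
  moreover have "coordwise_close n pullback (map_pmf (letters_at 1) \<mu>) t"
    using coordwise_close_pullback[OF is_couplingD(4)[OF C] is_couplingD(4)[OF C']] by simp
  ultimately have "two_near_product_laws n {1..m} {1..m'} (multislice n m k) (multislice n m' k') \<mu> pullback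
      (map_pmf (letters_at 1) \<mu>) \<alpha> t"
    using set_pullback_subset unfolding gluing(2,3)
    by (intro two_near_product_laws.intro near_product_law_multislice[OF n \<alpha> t balanced supp connected admissible]
        supp sym symmetric_pullback)
  then show ?thesis
    by (intro exI[of _ pullback]) (simp only: expectation_pullback product_version_eq[OF sym] simp_thms)
qed

theorem mainTheorem3:
  fixes \<alpha> \<epsilon> :: real and m m' :: nat
  assumes "0 < \<alpha>" and "\<alpha> < 1" and "0 < \<epsilon>"
  shows "\<exists>\<zeta>>0. \<forall>n\<ge>1. \<forall>(k :: nat \<Rightarrow> nat) (k' :: nat \<Rightarrow> nat)
            (\<mu> :: ((nat \<Rightarrow> nat) \<times> (nat \<Rightarrow> nat)) pmf)
            (C :: ((nat \<Rightarrow> nat) \<times> (nat \<Rightarrow> nat)) pmf)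
            (C' :: ((nat \<Rightarrow> nat) \<times> (nat \<Rightarrow> nat)) pmf).
          (\<Sum>j=1..m. k j) = n \<longrightarrow> (\<Sum>j=1..m'. k' j) = n \<longrightarrow>
          balanced \<alpha> n m k \<longrightarrow> balanced \<alpha> n m' k' \<longrightarrow>
          set_pmf \<mu> \<subseteq> multislice n m k \<times> multislice n m' k' \<longrightarrow>
          connected_pmf \<mu> \<longrightarrow> admissible \<alpha> n \<mu> \<longrightarrow>
          is_coupling n \<alpha> \<zeta> (pmf_of_set (multislice n m k))
            (Pi_pmf {1..n} undefined (\<lambda>_. freq_pmf n m k)) C \<longrightarrow>
          is_coupling n \<alpha> \<zeta> (pmf_of_set (multislice n m' k'))
            (Pi_pmf {1..n} undefined (\<lambda>_. freq_pmf n m' k')) C' \<longrightarrow>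
          (\<exists>C''. is_coupling n \<alpha> \<zeta> (map_pmf (zip_vec n) \<mu>) (product_version n \<mu>) C'') \<longrightarrow>
          (\<forall>(f :: (nat \<Rightarrow> nat) \<Rightarrow> real) (g :: (nat \<Rightarrow> nat) \<Rightarrow> real).
             \<bar>measure_pmf.expectation \<mu> (\<lambda>(x, x'). f x * g x')
               - measure_pmf.expectation (product_version n \<mu>)
                   (\<lambda>z. coupling_op C f (fst_vec n z) * coupling_op C' g (snd_vec n z))\<bar>
             \<le> \<epsilon> * norm2 (multislice n m k) f * norm2 (multislice n m' k') g)"
proof -
  obtain t where t: "0 < t" "t \<le> \<alpha> / 4" and forms_close:
    "\<And>n U V \<mu> \<mu>' q f g. two_near_product_laws n {1..m} {1..m'} U V \<mu> \<mu>' q \<alpha> t \<Longrightarrow>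
      \<bar>measure_pmf.expectation \<mu> (\<lambda>(x, y). f x * g y) - measure_pmf.expectation \<mu>' (\<lambda>(x, y). f x * g y)\<bar>
        \<le> \<epsilon> * norm2 U f * norm2 V g"
    using ex_closeness_two_near_product_laws[OF assms(1,3), of "{1..m}" "{1..m'}"] by blast
  show ?thesis
  proof (intro exI[of _ "t / 2"] conjI allI impI)
    fix n k k' \<mu> C C' f g
    let ?U = "multislice n m k" and ?V = "multislice n m' k'"
    assume hyps: "1 \<le> n" "(\<Sum>j=1..m. k j) = n" "(\<Sum>j=1..m'. k' j) = n" "balanced \<alpha> n m k" "balanced \<alpha> n m' k'"
      "set_pmf \<mu> \<subseteq> ?U \<times> ?V" "connected_pmf \<mu>" "admissible \<alpha> n \<mu>"
      "is_coupling n \<alpha> (t / 2) (pmf_of_set ?U) (Pi_pmf {1..n} undefined (\<lambda>_. freq_pmf n m k)) C"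
      "is_coupling n \<alpha> (t / 2) (pmf_of_set ?V) (Pi_pmf {1..n} undefined (\<lambda>_. freq_pmf n m' k')) C'"
    assume "\<exists>C''. is_coupling n \<alpha> (t / 2) (map_pmf (zip_vec n) \<mu>) (product_version n \<mu>) C''"
    then obtain C'' where "is_coupling n \<alpha> (t / 2) (map_pmf (zip_vec n) \<mu>) (product_version n \<mu>) C''" ..
    from ex_pullback_two_near_product_laws[OF hyps(1-3) assms(1) less_imp_le[OF t(1)] t(2) hyps(4-10) this]
    obtain \<mu>' where laws: "two_near_product_laws n {1..m} {1..m'} ?U ?V \<mu> \<mu>' (map_pmf (letters_at 1) \<mu>) \<alpha> t"
      and pullback: "\<And>f g. measure_pmf.expectation \<mu>' (\<lambda>(x, x'). f x * g x') = measure_pmf.expectation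
        (product_version n \<mu>) (\<lambda>z. coupling_op C f (fst_vec n z) * coupling_op C' g (snd_vec n z))"
      by blast
    show "\<bar>measure_pmf.expectation \<mu> (\<lambda>(x, x'). f x * g x') - measure_pmf.expectation (product_version n \<mu>)
        (\<lambda>z. coupling_op C f (fst_vec n z) * coupling_op C' g (snd_vec n z))\<bar> \<le> \<epsilon> * norm2 ?U f * norm2 ?V g"
      using forms_close[OF laws] unfolding pullback .
  qed (use t(1) in simp)
qed

end
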